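(* Let $G$ be the group of type $\frac1r(1,a,r-a)$ with $r$ coprime to $a$, $1\le a\le r-1$. Let $\Sigma_{\max}$ be the set of maximal cones in the fan of the economic resolution $Y$ of $X=\mathbb C^3/G$. Then there exists a set $\mathfrak S(r,a)$ of $G$-bricks together with a bijection $\Sigma_{\max}\to\mathfrak S(r,a)$, $\sigma\mapsto\Gamma_\sigma$, satisfying $S(\Gamma_\sigma)=\sigma^\vee\cap M$ for every $\sigma\in\Sigma_{\max}$. In particular, $U(\Gamma_\sigma)$ is isomorphic to the smooth toric variety $U_\sigma=\mathrm{Spec}\,\mathbb C[\sigma^\vee\cap M]$ corresponding to $\sigma$.
   Context: $G=\{\mathrm{diag}(\epsilon,\epsilon^a,\epsilon^{r-a}):\epsilon^r=1\}\subset\mathrm{GL}_3(\mathbb C)$, $L=\mathbb Z^3+\mathbb Z\cdot\frac1r(1,a,r-a)$, $e_1,e_2,e_3$ the standard basis of $\mathbb Z^3$. $\overline M$ is the multiplicative group of Laurent monomials in $x,y,z$, $\overline M_{\ge0}$ the genuine monomials, $M=\mathrm{Hom}(L,\mathbb Z)\subset\overline M$ the $G$-invariant Laurent monomials, and $\mathrm{wt}:\overline M\to\overline M/M\cong G^\vee=\mathrm{Hom}(G,\mathbb C^\times)$ the weight map. Economic resolution: for $1\le i<r$ put $v_i=\frac1r(i,\overline{ai},\overline{r-ai})\in L$, the bar denoting residue modulo $r$ in $\{0,\dots,r-1\}$. The economic resolution $Y\to X=\mathbb C^3/G$ is the toric variety (lattice $L$) whose fan is obtained from $\mathrm{Cone}(e_1,e_2,e_3)$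 and its faces by successive barycentric (star) subdivisions at $v_1,\dots,v_{r-1}$, in this order. A $G$-prebrick is a subset $\Gamma\subset\overline M$ such that: (1) $\mathbf 1\in\Gamma$; (2) $\mathrm{wt}:\Gamma\to G^\vee$ is bijective ($\mathbf m_\rho$ denotes the element of weight $\rho$); (3) if $\mathbf n'\mathbf n\mathbf m_\rho\in\Gamma$ with $\mathbf m_\rho\in\Gamma$, $\mathbf n,\mathbf n'\in\overline M_{\ge0}$, then $\mathbf n\mathbf m_\rho\in\Gamma$; (4) every element of $\Gamma$ is joined to $\mathbf 1$ by a path inside $\Gamma$ whose steps are multiplication or division by one of $x,y,z$. $\mathrm{wt}_\Gamma(\mathbf m)$ is the unique element of $\Gamma$ with the same weight as $\mathbf m\in\overline M$. $S(\Gamma)\subset M$ is the subsemigroup generated by all $\frac{\mathbf n\mathbf m_\rho}{\mathrm{wt}_\Gamma(\mathbf n\mathbf m_\rho)}$, $\mathbf n\in\overline M_{\ge0}$, $\mathbf m_\rho\in\Gamma$, and $U(\Gamma)=\mathrm{Spec}\,\mathbb C[S(\Gamma)]$. $\Gamma$ is a $G$-brick if $U(\Gamma)$ contains a torus fixed point, equivalently $S(\Gamma)\cap S(\Gamma)^{-1}=\{\mathbf 1\}$. *)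

theory Defs
  imports "HOL-Library.Poly_Mapping" "HOL-Analysis.Analysis" "HOL-Algebra.Algebra"
begin

section \<open>The group, the lattices and the weights\<close>

text \<open>A Laurent monomial in x, y, z is represented by its exponent vector in \<^typ>\<open>int^3\<close>. The
  multiplicative group of Laurent monomials is thereby written additively: \<^term>\<open>0\<close> is the monomial
  1, addition is multiplication of monomials, and the genuine monomials are the n with
  \<^term>\<open>0 \<le> n\<close>.\<close>

definition G_group :: "nat \<Rightarrow> nat \<Rightarrow> (complex^3^3) set" where
  "G_group r a =
     {(\<chi> i j. if i = j then (vector [\<epsilon>, \<epsilon> ^ a, \<epsilon> ^ (r - a)] :: complex^3) $ i else 0) | \<epsilon>. \<epsilon> ^ r = 1}"

definition G_dual :: "nat \<Rightarrow> nat \<Rightarrow> (complex^3^3 \<Rightarrow> complex) set" where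
  "G_dual r a = {\<rho> \<in> extensional (G_group r a).
     (\<forall>g \<in> G_group r a. \<rho> g \<noteq> 0) \<and>
     (\<forall>g \<in> G_group r a. \<forall>h \<in> G_group r a. \<rho> (g ** h) = \<rho> g * \<rho> h)}"

definition wt :: "nat \<Rightarrow> nat \<Rightarrow> int^3 \<Rightarrow> (complex^3^3 \<Rightarrow> complex)" where
  "wt r a m = restrict (\<lambda>g. \<Prod>i\<in>UNIV. (g $ i $ i) powi (m $ i)) (G_group r a)"

definition rvec :: "int^3 \<Rightarrow> real^3" where
  "rvec m = (\<chi> i. real_of_int (m $ i))"

definition L_lattice :: "nat \<Rightarrow> nat \<Rightarrow> (real^3) set" where
  "L_lattice r a =
     {rvec n + (of_int k / real r) *\<^sub>R vector [1, real a, real r - real a] | n k. True}"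

text \<open>Since L contains the standard lattice, restriction to it identifies the homomorphisms from L
  to the integers with the integer vectors pairing integrally with L.\<close>

definition M_lattice :: "nat \<Rightarrow> nat \<Rightarrow> (int^3) set" where
  "M_lattice r a = {m. \<forall>l \<in> L_lattice r a. rvec m \<bullet> l \<in> \<int>}"


section \<open>The fan of the economic resolution\<close>

definition v_vec :: "nat \<Rightarrow> nat \<Rightarrow> nat \<Rightarrow> real^3" where
  "v_vec r a i = (1 / real r) *\<^sub>R
     vector [real i, real (a * i mod r), real_of_int ((int r - int a * int i) mod int r)]"

definition star_subdivision :: "(real^3) set set \<Rightarrow> real^3 \<Rightarrow> (real^3) set set" where
  "star_subdivision \<Sigma> v =
     {\<sigma> \<in> \<Sigma>. v \<notin> \<sigma>} \<union>
     {convex_cone hull (insert v \<tau>) | \<tau>. \<tau> \<in> \<Sigma> \<and> v \<notin> \<tau> \<and> (\<exists>\<sigma>\<in>\<Sigma>. insert v \<tau> \<subseteq> \<sigma>)}"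

text \<open>The library regards the empty set as a face of every convex set, hence \<^term>\<open>F \<noteq> {}\<close>.\<close>

definition orthant_fan :: "(real^3) set set" where
  "orthant_fan = {F. F face_of (convex_cone hull (range (\<lambda>i. axis i 1))) \<and> F \<noteq> {}}"

definition economic_fan :: "nat \<Rightarrow> nat \<Rightarrow> (real^3) set set" where
  "economic_fan r a = fold (\<lambda>i \<Sigma>. star_subdivision \<Sigma> (v_vec r a i)) [1..<r] orthant_fan"

definition Sigma_max :: "nat \<Rightarrow> nat \<Rightarrow> (real^3) set set" where
  "Sigma_max r a = {\<sigma> \<in> economic_fan r a. \<forall>\<tau> \<in> economic_fan r a. \<sigma> \<subseteq> \<tau> \<longrightarrow> \<sigma> = \<tau>}"

definition dual_cone :: "(real^3) set \<Rightarrow> (real^3) set" where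
  "dual_cone \<sigma> = {m. \<forall>u \<in> \<sigma>. 0 \<le> m \<bullet> u}"

definition cone_semigroup :: "nat \<Rightarrow> nat \<Rightarrow> (real^3) set \<Rightarrow> (int^3) set" where
  "cone_semigroup r a \<sigma> = {m \<in> M_lattice r a. rvec m \<in> dual_cone \<sigma>}"


section \<open>Affine schemes over the complex numbers\<close>

text \<open>The algebra of a set S of exponent vectors, as a subring of the ring of Laurent polynomials.
  It is a ring when S is a submonoid.\<close>

definition semigroup_algebra :: "(int^3) set \<Rightarrow> (int^3 \<Rightarrow>\<^sub>0 complex) ring" where
  "semigroup_algebra S =
     \<lparr>carrier = {f. Poly_Mapping.keys f \<subseteq> S}, mult = (*), one = 1,
      ring.zero = 0, ring.add = (+)\<rparr>"

definition scalar :: "complex \<Rightarrow> (int^3 \<Rightarrow>\<^sub>0 complex)" where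
  "scalar c = Poly_Mapping.single 0 c"

definition Spec :: "('a, 'm) ring_scheme \<Rightarrow> 'a set set" where
  "Spec R = {P. primeideal P R}"

definition zariski :: "('a, 'm) ring_scheme \<Rightarrow> 'a set topology" where
  "zariski R = topology_generated_by ((\<lambda>f. {P \<in> Spec R. f \<notin> P}) ` carrier R)"

text \<open>The fraction f/g in the localization at P is the class of all pairs equivalent to (f, g).\<close>

definition fraction :: "('a, 'm) ring_scheme \<Rightarrow> 'a set \<Rightarrow> 'a \<Rightarrow> 'a \<Rightarrow> ('a \<times> 'a) set" where
  "fraction R P f g = {(f', g'). f' \<in> carrier R \<and> g' \<in> carrier R - P \<and>
     (\<exists>h \<in> carrier R - P. h \<otimes>\<^bsub>R\<^esub> (f \<otimes>\<^bsub>R\<^esub> g') = h \<otimes>\<^bsub>R\<^esub> (f' \<otimes>\<^bsub>R\<^esub> g))}"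

text \<open>In the sums and products below all the classes united are equal, as these operations on
  fractions do not depend on representatives.\<close>

definition stalk :: "('a, 'm) ring_scheme \<Rightarrow> 'a set \<Rightarrow> ('a \<times> 'a) set ring" where
  "stalk R P =
     \<lparr>carrier = {fraction R P f g | f g. f \<in> carrier R \<and> g \<in> carrier R - P},
      mult = (\<lambda>A B. \<Union>(f, g)\<in>A. \<Union>(f', g')\<in>B. fraction R P (f \<otimes>\<^bsub>R\<^esub> f') (g \<otimes>\<^bsub>R\<^esub> g')),
      one = fraction R P \<one>\<^bsub>R\<^esub> \<one>\<^bsub>R\<^esub>,
      ring.zero = fraction R P \<zero>\<^bsub>R\<^esub> \<one>\<^bsub>R\<^esub>,
      ring.add = (\<lambda>A B. \<Union>(f, g)\<in>A. \<Union>(f', g')\<in>B.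
        fraction R P ((f \<otimes>\<^bsub>R\<^esub> g') \<oplus>\<^bsub>R\<^esub> (f' \<otimes>\<^bsub>R\<^esub> g)) (g \<otimes>\<^bsub>R\<^esub> g'))\<rparr>"

text \<open>Sections over U of the structure sheaf: families of germs that locally are given by a single
  fraction.\<close>

definition sections :: "('a, 'm) ring_scheme \<Rightarrow> 'a set set \<Rightarrow> ('a set \<Rightarrow> ('a \<times> 'a) set) ring" where
  "sections R U =
     \<lparr>carrier = {s \<in> (\<Pi>\<^sub>E P\<in>U. carrier (stalk R P)).
        \<forall>P\<in>U. \<exists>V f g. openin (zariski R) V \<and> P \<in> V \<and> V \<subseteq> U \<and> f \<in> carrier R \<and> g \<in> carrier R \<and>
          (\<forall>Q\<in>V. g \<notin> Q \<and> s Q = fraction R Q f g)},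
      mult = (\<lambda>s t. restrict (\<lambda>P. s P \<otimes>\<^bsub>stalk R P\<^esub> t P) U),
      one = restrict (\<lambda>P. \<one>\<^bsub>stalk R P\<^esub>) U,
      ring.zero = restrict (\<lambda>P. \<zero>\<^bsub>stalk R P\<^esub>) U,
      ring.add = (\<lambda>s t. restrict (\<lambda>P. s P \<oplus>\<^bsub>stalk R P\<^esub> t P) U)\<rparr>"

text \<open>The spectra of two complex algebras, given by rings R, R' with structure maps k, k', are
  isomorphic as schemes over the complex numbers: there is a homeomorphism together with an
  isomorphism of structure sheaves of complex algebras. (An isomorphism of ringed spaces is
  automatically local on stalks.)\<close>

definition Spec_iso ::
  "('a, 'm) ring_scheme \<Rightarrow> (complex \<Rightarrow> 'a) \<Rightarrow> ('b, 'n) ring_scheme \<Rightarrow> (complex \<Rightarrow> 'b) \<Rightarrow> bool" where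
  "Spec_iso R k R' k' \<longleftrightarrow> (\<exists>\<phi> \<psi>.
     homeomorphic_map (zariski R) (zariski R') \<phi> \<and>
     (\<forall>V. openin (zariski R') V \<longrightarrow>
        (let U = {P \<in> Spec R. \<phi> P \<in> V} in
          \<psi> V \<in> ring_iso (sections R' V) (sections R U) \<and>
          (\<forall>c. \<psi> V (restrict (\<lambda>Q. fraction R' Q (k' c) \<one>\<^bsub>R'\<^esub>) V)
                = restrict (\<lambda>P. fraction R P (k c) \<one>\<^bsub>R\<^esub>) U))) \<and>
     (\<forall>V W. openin (zariski R') V \<longrightarrow> openin (zariski R') W \<longrightarrow> W \<subseteq> V \<longrightarrow>
        (\<forall>s \<in> carrier (sections R' V).
           \<psi> W (restrict s W) = restrict (\<psi> V s) {P \<in> Spec R. \<phi> P \<in> W})))"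

text \<open>The height of P is the Krull dimension of the local ring at P.\<close>

definition height :: "('a, 'm) ring_scheme \<Rightarrow> 'a set \<Rightarrow> enat" where
  "height R P = Sup {enat n | n. \<exists>Q :: nat \<Rightarrow> 'a set.
     (\<forall>i\<le>n. primeideal (Q i) R) \<and> (\<forall>i<n. Q i \<subset> Q (Suc i)) \<and> Q n = P}"

text \<open>For a maximal ideal P, the dimension of the cotangent space P/P^2 over the residue field R/P,
  i.e. the least size of a spanning set of P/P^2, with spanning sets lifted to P.\<close>

definition cotangent_dim :: "('a, 'm) ring_scheme \<Rightarrow> 'a set \<Rightarrow> enat" where
  "cotangent_dim R P =
     Inf {enat (card F) | F. finite F \<and> F \<subseteq> P \<and> genideal R (F \<union> ideal_prod R P P) = P}"

text \<open>Smoothness of the affine scheme Spec R over the complex numbers, k being the structure map: R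
  is of finite type, and the local ring at every closed point is regular.\<close>

definition smooth_Spec :: "('a, 'm) ring_scheme \<Rightarrow> (complex \<Rightarrow> 'a) \<Rightarrow> bool" where
  "smooth_Spec R k \<longleftrightarrow>
     (\<exists>F. finite F \<and> F \<subseteq> carrier R \<and> generate_ring R (range k \<union> F) = carrier R) \<and>
     (\<forall>P. maximalideal P R \<longrightarrow> cotangent_dim R P = height R P)"


section \<open>G-bricks\<close>

definition G_prebrick :: "nat \<Rightarrow> nat \<Rightarrow> (int^3) set \<Rightarrow> bool" where
  "G_prebrick r a \<Gamma> \<longleftrightarrow>
     0 \<in> \<Gamma> \<and>
     bij_betw (wt r a) \<Gamma> (G_dual r a) \<and>
     (\<forall>m n n'. m \<in> \<Gamma> \<longrightarrow> 0 \<le> n \<longrightarrow> 0 \<le> n' \<longrightarrow> n' + n + m \<in> \<Gamma> \<longrightarrow> n + m \<in> \<Gamma>) \<and>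
     (\<forall>m \<in> \<Gamma>. (m, 0) \<in>
        {(p, q). p \<in> \<Gamma> \<and> q \<in> \<Gamma> \<and> (\<exists>i. q = p + axis i 1 \<or> q = p - axis i 1)}\<^sup>*)"

definition wt_in :: "nat \<Rightarrow> nat \<Rightarrow> (int^3) set \<Rightarrow> int^3 \<Rightarrow> int^3" where
  "wt_in r a \<Gamma> m = (THE m'. m' \<in> \<Gamma> \<and> wt r a m' = wt r a m)"

inductive_set S_semigroup :: "nat \<Rightarrow> nat \<Rightarrow> (int^3) set \<Rightarrow> (int^3) set"
  for r a :: nat and \<Gamma> :: "(int^3) set" where
  gen: "0 \<le> n \<Longrightarrow> m \<in> \<Gamma> \<Longrightarrow> n + m - wt_in r a \<Gamma> (n + m) \<in> S_semigroup r a \<Gamma>"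
| add: "s \<in> S_semigroup r a \<Gamma> \<Longrightarrow> t \<in> S_semigroup r a \<Gamma> \<Longrightarrow> s + t \<in> S_semigroup r a \<Gamma>"

text \<open>The torus Hom(M, C^*); values outside M are irrelevant.\<close>

definition torus :: "nat \<Rightarrow> nat \<Rightarrow> (int^3 \<Rightarrow> complex) set" where
  "torus r a = {t. (\<forall>m \<in> M_lattice r a. t m \<noteq> 0) \<and>
     (\<forall>m \<in> M_lattice r a. \<forall>n \<in> M_lattice r a. t (m + n) = t m * t n)}"

definition torus_act :: "(int^3 \<Rightarrow> complex) \<Rightarrow> (int^3 \<Rightarrow>\<^sub>0 complex) \<Rightarrow> (int^3 \<Rightarrow>\<^sub>0 complex)" where
  "torus_act t f = Poly_Mapping.mapp (\<lambda>m c. t m * c) f"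

text \<open>A torus fixed point of U(\<Gamma>) is a closed point of the spectrum fixed by the torus action.\<close>

definition G_brick :: "nat \<Rightarrow> nat \<Rightarrow> (int^3) set \<Rightarrow> bool" where
  "G_brick r a \<Gamma> \<longleftrightarrow> G_prebrick r a \<Gamma> \<and>
     (\<exists>P. maximalideal P (semigroup_algebra (S_semigroup r a \<Gamma>)) \<and>
          (\<forall>t \<in> torus r a. torus_act t ` P = P))"

end

theory Submission
  imports Defs "HOL-Computational_Algebra.Fundamental_Theorem_Algebra"
begin

text \<open>
  The rays u1, u2, u3 of a maximal cone \<sigma> form a basis of L; let d1, d2, d3 be the dual basis of M.
  The brick of \<sigma> is the zero fibre of a map \<phi> from \<int>^3 to \<int>^3 whose i-th component is monotone and
  behaves like the pairing with the ray u i, up to rounding: adding l \<in> M to the argument adds the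
  pairing of l with u i to the value. A zero fibre of this kind meets every coset of M exactly once
  and contains n m_\<rho> as soon as it contains m_\<rho> and n' n m_\<rho>. Also, n m_\<rho> divided by its representative is the
  monomial with coordinates \<phi> (n m_\<rho>) in the basis d1, d2, d3, so it lies in the dual cone. Suppose
  moreover that \<phi> lifts steps: its fibres are connected by unit steps, and every unit step in the
  target is the image of a unit step. Then the zero fibre is connected, and a lift of the step from 0
  to the i-th unit vector shows that d i is one of the generators of S(\<Gamma>). Hence S(\<Gamma>) is the monoid
  generated by d1, d2, d3, which is the semigroup of \<sigma> (lemmas G_prebrick_fibre, S_semigroup_fibre).

  These maps are built along with the fan. The orthant has the identity. A star subdivision at
  v = (c1 u1 + c2 u2 + c3 u3) / w, with positive integers c1, c2, c3, replaces one ray u i by v, and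
  correspondingly the coordinate x i by the integer part of (c1 x1 + c2 x2 + c3 x3) / w. This rounding
  map lifts steps as soon as c i + c k \<le> w for all k \<noteq> i, and lifting of steps is stable under composition (lemmas
  lifts_steps_round_down, lifts_steps_comp).

  It remains to see which coefficients occur. The points v_1, ..., v_{r-1}, e2, e3 lie in the plane
  y + z = 1, with y-coordinates in [0, 1] and x-coordinates increasing with the index. Seen from e1,
  the cones containing e1 are strips between points with neighbouring y-coordinates, and v_n
  subdivides exactly one of them, the one between P and Q, say. The triangle P, v_n, Q contains no
  further lattice points, since they would have been inserted before; therefore it is unimodular,
  which means that v_n = (e1 + c Q + (w - c) P) / w with 0 < c < w (lemmas empty_triangle_unimodular,
  new_point_height_one). Any two of the coefficients 1, c, w - c have sum at most w.

  The semigroup of \<sigma> is free on three generators, so its algebra is a polynomial ring. The elements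
  without constant term form a maximal ideal that is fixed by the torus, and regularity at each closed
  point is proved directly: closed points are given by coordinates (Nullstellensatz), their height is
  three, and the three partial derivatives bound the cotangent space from below.
\<close>

section \<open>The algebra of a free commutative monoid of rank three\<close>

text \<open>Elimination: an equation that involves the unknown j is solved for it, and substituted
  into the others.\<close>

lemma homogeneous_system_nontrivial_solution:
  fixes M :: "'i \<Rightarrow> 'b \<Rightarrow> 'a::field"
  assumes "finite B" "finite I" "card B < card I"
  shows "\<exists>c. (\<exists>i\<in>I. c i \<noteq> 0) \<and> (\<forall>b\<in>B. (\<Sum>i\<in>I. c i * M i b) = 0)"
  using assms
proof (induction B arbitrary: I M rule: finite_induct)
  case empty
  then have "I \<noteq> {}" by auto
  then show ?case by (intro exI[of _ "\<lambda>_. 1"]) auto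
next
  case (insert b B)
  show ?case
  proof (cases "\<forall>i\<in>I. M i b = 0")
    case True
    from insert.prems insert.hyps have "card B < card I" by simp
    from insert.IH[OF insert.prems(1) this, of M] obtain c where
      "\<exists>i\<in>I. c i \<noteq> 0" "\<forall>b\<in>B. (\<Sum>i\<in>I. c i * M i b) = 0" by blast
    with True show ?thesis by (intro exI[of _ c]) auto
  next
    case False
    then obtain j where j: "j \<in> I" "M j b \<noteq> 0" by blast
    define J where "J = I - {j}"
    have J: "finite J" "card B < card J" "j \<notin> J" "I = insert j J"
      using insert.prems insert.hyps j by (auto simp: J_def)
    obtain c where c: "\<exists>i\<in>J. c i \<noteq> 0"
      "\<forall>b'\<in>B. (\<Sum>i\<in>J. c i * (M i b' - M i b / M j b * M j b')) = 0"
      using insert.IH[OF J(1,2), of "\<lambda>i b'. M i b' - M i b / M j b * M j b'"] by blast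
    define s where "s = (\<Sum>i\<in>J. c i * M i b)"
    define c' where "c' = c(j := - s / M j b)"
    have expand: "(\<Sum>i\<in>I. c' i * M i x) = - s / M j b * M j x + (\<Sum>i\<in>J. c i * M i x)" for x
    proof -
      have "(\<Sum>i\<in>J. c' i * M i x) = (\<Sum>i\<in>J. c i * M i x)"
        by (rule sum.cong) (use J(3) in \<open>auto simp: c'_def\<close>)
      then show ?thesis using J by (simp add: c'_def)
    qed
    have "(\<Sum>i\<in>I. c' i * M i x) = 0" if "x \<in> insert b B" for x
    proof (cases "x = b")
      case True
      then show ?thesis using j(2) by (simp add: expand s_def)
    next
      case False
      with that c(2) have "(\<Sum>i\<in>J. c i * (M i x - M i b / M j b * M j x)) = 0" by blast
      then have "(\<Sum>i\<in>J. c i * M i x) - (\<Sum>i\<in>J. c i * M i b) / M j b * M j x = 0"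
        by (simp add: right_diff_distrib sum_subtractf sum_distrib_right sum_divide_distrib mult.assoc)
      then show ?thesis by (simp add: expand s_def)
    qed
    moreover have "\<exists>i\<in>I. c' i \<noteq> 0"
      using c(1) J(3,4) by (auto simp: c'_def)
    ultimately show ?thesis by blast
  qed
qed

text \<open>The evaluations below extend such a map by a choice of images of the three
  generators.\<close>

definition coefficient_hom :: "(complex \<Rightarrow> 'a::comm_ring_1) \<Rightarrow> bool" where
  "coefficient_hom h \<longleftrightarrow> h 0 = 0 \<and> h 1 = 1 \<and> (\<forall>x y. h (x + y) = h x + h y) \<and> (\<forall>x y. h (x * y) = h x * h y)"

lemma coefficient_homD:
  assumes "coefficient_hom h"
  shows "h 0 = 0" "h 1 = 1" "h (x + y) = h x + h y" "h (x * y) = h x * h y"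
  using assms by (auto simp: coefficient_hom_def)

lemma coefficient_hom_id: "coefficient_hom (\<lambda>c. c)"
  by (simp add: coefficient_hom_def)

lemma coefficient_hom_const_poly:
  "coefficient_hom h \<Longrightarrow> coefficient_hom (\<lambda>c. [:h c:])"
  by (simp add: coefficient_hom_def one_pCons)

text \<open>S is free on e 1, e 2, e 3, and k i counts the occurrences of e i. The counting
  functions are part of the data because for a cone semigroup they are the pairings with the
  rays.\<close>

locale free_monoid3 =
  fixes S :: "(int^3) set" and e :: "3 \<Rightarrow> int^3" and k :: "3 \<Rightarrow> int^3 \<Rightarrow> nat"
  assumes zero_mem: "0 \<in> S"
    and add_mem: "s \<in> S \<Longrightarrow> t \<in> S \<Longrightarrow> s + t \<in> S"
    and gen_mem: "e i \<in> S"
    and k_add: "s \<in> S \<Longrightarrow> t \<in> S \<Longrightarrow> k i (s + t) = k i s + k i t"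
    and k_gen: "k i (e j) = (if i = j then 1 else 0)"
    and k_inj: "s \<in> S \<Longrightarrow> t \<in> S \<Longrightarrow> (\<And>i. k i s = k i t) \<Longrightarrow> s = t"
    and peel: "s \<in> S \<Longrightarrow> 0 < k i s \<Longrightarrow> s - e i \<in> S"
begin

lemma k_zero: "k i 0 = 0"
  using k_add[OF zero_mem zero_mem, of i] by simp

lemma monoid_induct [consumes 1, case_names zero gen]:
  assumes "s \<in> S" and "P 0" and "\<And>i s. s \<in> S \<Longrightarrow> P s \<Longrightarrow> P (e i + s)"
  shows "P s"
  using assms(1)
proof (induction "\<Sum>i\<in>UNIV. k i s" arbitrary: s rule: less_induct)
  case less
  show ?case
  proof (cases "s = 0")
    case False
    then obtain i where i: "0 < k i s" using k_inj[OF less.prems zero_mem] k_zero by (metis gr0I)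
    define t where "t = s - e i"
    have t: "t \<in> S" "s = e i + t" using peel[OF less.prems i] by (auto simp: t_def)
    have "(\<Sum>j\<in>UNIV. k j t) < (\<Sum>j\<in>UNIV. k j s)"
      unfolding t(2) k_add[OF gen_mem t(1)] sum.distrib k_gen by simp
    then show ?thesis using less.hyps[OF _ t(1)] assms(3) t by metis
  qed (use assms in simp)
qed

abbreviation "A \<equiv> {f :: int^3 \<Rightarrow>\<^sub>0 complex. Poly_Mapping.keys f \<subseteq> S}"
abbreviation "R \<equiv> semigroup_algebra S"

lemma A_zero: "0 \<in> A" by simp
lemma A_one: "1 \<in> A" using zero_mem by simp
lemma A_add: "f \<in> A \<Longrightarrow> g \<in> A \<Longrightarrow> f + g \<in> A" using keys_add[of f g] by auto
lemma A_uminus: "f \<in> A \<Longrightarrow> - f \<in> A" by (auto simp: in_keys_iff)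
lemma A_minus: "f \<in> A \<Longrightarrow> g \<in> A \<Longrightarrow> f - g \<in> A" using A_add[OF _ A_uminus, of f g] by simp
lemma A_mult: "f \<in> A \<Longrightarrow> g \<in> A \<Longrightarrow> f * g \<in> A" using keys_mult[of f g] add_mem by fastforce
lemma A_scalar: "scalar c \<in> A" using zero_mem by (simp add: scalar_def)
lemma A_power: "f \<in> A \<Longrightarrow> f ^ n \<in> A" by (induction n) (use A_one A_mult in auto)
lemma A_sum: "(\<And>i. i \<in> I \<Longrightarrow> f i \<in> A) \<Longrightarrow> sum f I \<in> A"
  by (induction I rule: infinite_finite_induct) (use A_zero A_add in auto)
lemma A_single: "s \<in> S \<Longrightarrow> Poly_Mapping.single s c \<in> A" by simp

lemma R_simps:
  "carrier R = A" "x \<otimes>\<^bsub>R\<^esub> y = x * y" "\<one>\<^bsub>R\<^esub> = 1" "\<zero>\<^bsub>R\<^esub> = 0" "x \<oplus>\<^bsub>R\<^esub> y = x + y"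
  by (simp_all add: semigroup_algebra_def)

lemma cring_R: "cring R"
proof (rule cringI)
  show "abelian_group R"
  proof (rule abelian_groupI)
    fix x assume "x \<in> carrier R"
    then show "\<exists>y\<in>carrier R. y \<oplus>\<^bsub>R\<^esub> x = \<zero>\<^bsub>R\<^esub>"
      by (intro bexI[of _ "- x"]) (use A_uminus in \<open>auto simp: R_simps\<close>)
  qed (use A_zero A_add in \<open>simp_all add: R_simps add.assoc add.commute\<close>)
  show "comm_monoid R"
    by (rule comm_monoidI) (use A_one A_mult in \<open>simp_all add: R_simps mult.assoc mult.commute\<close>)
qed (simp add: R_simps distrib_right)

lemma a_inv_R: "f \<in> A \<Longrightarrow> \<ominus>\<^bsub>R\<^esub> f = - f"
  using abelian_group.minus_equality[OF ring.is_abelian_group[OF cring.axioms(1)[OF cring_R]], of "- f" f]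
    A_uminus[of f] by (simp add: R_simps)

text \<open>Here and in primeideal_iff, the operations of the ring record are replaced by the
  arithmetic of the ambient type.\<close>

lemma ideal_iff:
  "ideal P R \<longleftrightarrow> P \<subseteq> A \<and> 0 \<in> P \<and> (\<forall>f\<in>P. \<forall>g\<in>P. f + g \<in> P) \<and> (\<forall>f\<in>A. \<forall>g\<in>P. f * g \<in> P)"
  (is "_ \<longleftrightarrow> ?rhs")
proof
  assume "ideal P R"
  then interpret ideal P R .
  show ?rhs
    using a_subset additive_subgroup.zero_closed[OF additive_subgroup_axioms]
      additive_subgroup.a_closed[OF additive_subgroup_axioms] I_l_closed
    by (simp add: R_simps)
next
  assume *: ?rhs
  interpret R: cring R by (rule cring_R)
  have neg: "- f \<in> P" if "f \<in> P" for f
  proof -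
    have "(-1) * f \<in> P" using * that A_uminus[OF A_one] by blast
    then show ?thesis by simp
  qed
  show "ideal P R"
  proof (rule idealI)
    show "subgroup P (add_monoid R)"
    proof (rule R.add.subgroupI)
      fix f assume "f \<in> P"
      then have "f \<in> A" using * by blast
      then show "\<ominus>\<^bsub>R\<^esub> f \<in> P" using neg[OF \<open>f \<in> P\<close>] by (simp only: a_inv_R)
    qed (use * in \<open>auto simp: R_simps\<close>)
    show "x \<otimes>\<^bsub>R\<^esub> f \<in> P" "f \<otimes>\<^bsub>R\<^esub> x \<in> P" if "f \<in> P" "x \<in> carrier R" for f x
      using * that by (simp_all add: R_simps mult.commute[of f])
  qed (rule R.ring_axioms)
qed

lemma ideal_minus:
  assumes "ideal P R" "f \<in> P" "g \<in> P"
  shows "f - g \<in> P"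
proof -
  have "(-1) * g \<in> P" using assms A_uminus[OF A_one] unfolding ideal_iff by blast
  then have "f + (-1) * g \<in> P" using assms unfolding ideal_iff by blast
  then show ?thesis by simp
qed

lemma primeideal_iff:
  "primeideal P R \<longleftrightarrow> ideal P R \<and> 1 \<notin> P \<and> (\<forall>f\<in>A. \<forall>g\<in>A. f * g \<in> P \<longrightarrow> f \<in> P \<or> g \<in> P)"
  (is "_ \<longleftrightarrow> ?rhs")
proof
  assume "primeideal P R"
  then interpret primeideal P R .
  have "1 \<notin> P" using one_imp_carrier I_notcarr by (auto simp: R_simps)
  moreover have "\<forall>f\<in>A. \<forall>g\<in>A. f * g \<in> P \<longrightarrow> f \<in> P \<or> g \<in> P"
    using I_prime by (simp add: R_simps)
  ultimately show ?rhs using is_ideal by blast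
next
  assume *: ?rhs
  show "primeideal P R"
    by (rule primeidealI) (use * A_one cring_R in \<open>auto simp: R_simps\<close>)
qed

definition gen :: "3 \<Rightarrow> int^3 \<Rightarrow>\<^sub>0 complex" where "gen i = Poly_Mapping.single (e i) 1"

lemma A_gen: "gen i \<in> A" using gen_mem by (simp add: gen_def)

lemma scalar_add: "scalar (x + y) = scalar x + scalar y" by (simp add: scalar_def single_add)
lemma scalar_mult: "scalar (x * y) = scalar x * scalar y" by (simp add: scalar_def mult_single)
lemma scalar_one: "scalar 1 = 1" by (simp add: scalar_def)
lemma scalar_zero: "scalar 0 = 0" by (simp add: scalar_def)

lemma single_gen_add: "Poly_Mapping.single (e i + s) c = gen i * Poly_Mapping.single s c"
  by (simp add: gen_def mult_single)

lemma algebra_induct [consumes 1, case_names zero add single]: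
  assumes "f \<in> A" and "P 0" and "\<And>f g. f \<in> A \<Longrightarrow> g \<in> A \<Longrightarrow> P f \<Longrightarrow> P g \<Longrightarrow> P (f + g)"
    and "\<And>s c. s \<in> S \<Longrightarrow> P (Poly_Mapping.single s c)"
  shows "P f"
proof -
  have "(\<Sum>s\<in>J. Poly_Mapping.single s (Poly_Mapping.lookup f s)) \<in> A \<and>
      P (\<Sum>s\<in>J. Poly_Mapping.single s (Poly_Mapping.lookup f s))"
    if "finite J" "J \<subseteq> S" for J
    using that by (induction J) (use assms(2-4) A_add A_single in auto)
  moreover have "(\<Sum>s\<in>Poly_Mapping.keys f. Poly_Mapping.single s (Poly_Mapping.lookup f s)) = f"
    by (rule poly_mapping_eqI) (simp add: lookup_sum lookup_single when_def in_keys_iff)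
  ultimately show ?thesis using assms(1) by (metis finite_keys mem_Collect_eq)
qed

definition ev :: "(complex \<Rightarrow> 'a::comm_ring_1) \<Rightarrow> (3 \<Rightarrow> 'a) \<Rightarrow> (int^3 \<Rightarrow>\<^sub>0 complex) \<Rightarrow> 'a" where
  "ev h t f = (\<Sum>s\<in>Poly_Mapping.keys f. h (Poly_Mapping.lookup f s) * (\<Prod>i\<in>UNIV. t i ^ k i s))"

context
  fixes h :: "complex \<Rightarrow> 'a::comm_ring_1"
  assumes h: "coefficient_hom h"
begin

lemma ev_superset:
  assumes "finite J" "Poly_Mapping.keys f \<subseteq> J"
  shows "ev h t f = (\<Sum>s\<in>J. h (Poly_Mapping.lookup f s) * (\<Prod>i\<in>UNIV. t i ^ k i s))"
  unfolding ev_def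
  by (rule sum.mono_neutral_left) (use assms coefficient_homD[OF h] in \<open>auto simp: in_keys_iff\<close>)

lemma ev_zero: "ev h t 0 = 0" by (simp add: ev_def)

lemma ev_add: "ev h t (f + g) = ev h t f + ev h t g"
proof -
  let ?J = "Poly_Mapping.keys f \<union> Poly_Mapping.keys g"
  have J: "finite ?J" by simp
  show ?thesis
    unfolding ev_superset[OF J keys_add] ev_superset[OF J Un_upper1] ev_superset[OF J Un_upper2]
    by (simp add: lookup_add coefficient_homD[OF h] distrib_right sum.distrib)
qed

lemma ev_single: "ev h t (Poly_Mapping.single s c) = h c * (\<Prod>i\<in>UNIV. t i ^ k i s)"
  by (cases "c = 0") (simp_all add: ev_def coefficient_homD[OF h])

lemma ev_scalar: "ev h t (scalar c) = h c"
  by (simp add: scalar_def ev_single k_zero)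

lemma ev_one: "ev h t 1 = 1"
  using ev_scalar[of t 1] by (simp add: scalar_one coefficient_homD[OF h])

lemma ev_gen: "ev h t (gen i) = t i"
proof -
  have "(\<Prod>j\<in>UNIV. t j ^ k j (e i)) = (\<Prod>j\<in>UNIV. if j = i then t j else 1)"
    by (rule prod.cong) (auto simp: k_gen)
  then show ?thesis by (simp add: gen_def ev_single coefficient_homD[OF h])
qed

lemma ev_mult:
  assumes "f \<in> A" "g \<in> A"
  shows "ev h t (f * g) = ev h t f * ev h t g"
  using assms(1)
proof (induction rule: algebra_induct)
  case (single s c)
  show ?case using assms(2)
  proof (induction rule: algebra_induct)
    case (single s' c')
    then show ?case using \<open>s \<in> S\<close>
      by (simp add: mult_single ev_single k_add coefficient_homD[OF h] power_add prod.distrib)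
  qed (simp_all add: ev_zero ev_add distrib_left)
qed (simp_all add: ev_zero ev_add distrib_right)

lemma ev_uminus: "f \<in> A \<Longrightarrow> ev h t (- f) = - ev h t f"
  using ev_add[of t f "- f"] by (simp add: ev_zero eq_neg_iff_add_eq_0 add.commute)

lemma ev_minus: "f \<in> A \<Longrightarrow> g \<in> A \<Longrightarrow> ev h t (f - g) = ev h t f - ev h t g"
  using ev_add[of t f "- g"] ev_uminus[of g t] by simp

end

definition vanishing :: "(complex \<Rightarrow> 'a::comm_ring_1) \<Rightarrow> (3 \<Rightarrow> 'a) \<Rightarrow> (int^3 \<Rightarrow>\<^sub>0 complex) set" where
  "vanishing h t = {f \<in> A. ev h t f = 0}"

text \<open>Evaluations into domains provide all prime ideals that are needed: those of the closed
  points, and those of a chain below a closed point.\<close>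

lemma primeideal_vanishing:
  fixes h :: "complex \<Rightarrow> 'a::idom"
  assumes "coefficient_hom h"
  shows "primeideal (vanishing h t) R"
  unfolding primeideal_iff ideal_iff vanishing_def
  using A_zero A_add A_mult A_one
  by (auto simp: ev_zero[OF assms] ev_add[OF assms] ev_mult[OF assms] ev_one[OF assms])

text \<open>Congruence of a polynomial to its value at p is stable under sums and products, so it
  propagates from the generators to all monomials. It yields the maximality of the ideal of a
  point, the last step of the Nullstellensatz, and generators of the ideal of a point.\<close>

lemma diff_scalar_ev_mem:
  assumes P: "ideal P R" and gens: "\<And>i. gen i - scalar (p i) \<in> P" and f: "f \<in> A"
  shows "f - scalar (ev (\<lambda>c. c) p f) \<in> P"
  using f
proof (induction rule: algebra_induct)
  case zero
  then show ?case using P by (simp add: ev_zero[OF coefficient_hom_id] scalar_zero ideal_iff)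
next
  case (add f g)
  have "(f - scalar (ev (\<lambda>c. c) p f)) + (g - scalar (ev (\<lambda>c. c) p g)) \<in> P"
    using add P unfolding ideal_iff by blast
  then show ?case by (simp add: ev_add[OF coefficient_hom_id] scalar_add algebra_simps)
next
  case (single s c)
  then show ?case
  proof (induction rule: monoid_induct)
    case zero
    have "ev (\<lambda>c. c) p (Poly_Mapping.single 0 c) = c"
      using ev_scalar[OF coefficient_hom_id, of p c] by (simp add: scalar_def)
    then show ?case using P by (simp add: scalar_def ideal_iff)
  next
    case (gen i s)
    let ?g = "Poly_Mapping.single s c" and ?E = "\<lambda>f. ev (\<lambda>c. c) p f"
    have E: "?E (gen i * ?g) = p i * ?E ?g"
      using ev_mult[OF coefficient_hom_id A_gen A_single[OF gen(1)], of p i c]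
      by (simp add: ev_gen[OF coefficient_hom_id])
    have "gen i * (?g - scalar (?E ?g)) + scalar (?E ?g) * (gen i - scalar (p i)) \<in> P"
      using gen gens P A_gen A_scalar unfolding ideal_iff by blast
    then show ?case
      unfolding single_gen_add E scalar_mult by (simp add: algebra_simps)
  qed
qed

lemma maximal_vanishing_point: "maximalideal (vanishing (\<lambda>c. c) p) R"
proof (rule maximalidealI)
  have prime: "primeideal (vanishing (\<lambda>c. c) p) R"
    by (rule primeideal_vanishing[OF coefficient_hom_id])
  then show "ideal (vanishing (\<lambda>c. c) p) R" by (simp add: primeideal_iff)
  show "carrier R \<noteq> vanishing (\<lambda>c. c) p" using prime A_one by (auto simp: primeideal_iff R_simps)
  fix J assume J: "ideal J R" "vanishing (\<lambda>c. c) p \<subseteq> J" "J \<subseteq> carrier R"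
  have Xp: "gen i - scalar (p i) \<in> J" for i
  proof -
    have "gen i - scalar (p i) \<in> vanishing (\<lambda>c. c) p"
      using A_minus[OF A_gen A_scalar]
      by (simp add: vanishing_def ev_minus[OF coefficient_hom_id A_gen A_scalar]
          ev_gen[OF coefficient_hom_id] ev_scalar[OF coefficient_hom_id])
    then show ?thesis using J by blast
  qed
  show "J = vanishing (\<lambda>c. c) p \<or> J = carrier R"
  proof (cases "J \<subseteq> vanishing (\<lambda>c. c) p")
    case False
    then obtain f where f: "f \<in> J" "f \<in> A" "ev (\<lambda>c. c) p f \<noteq> 0"
      using J by (auto simp: vanishing_def R_simps)
    let ?c = "ev (\<lambda>c. c) p f"
    have "f - (f - scalar ?c) \<in> J"
      using ideal_minus[OF J(1) f(1) diff_scalar_ev_mem[OF J(1) Xp f(2)]] .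
    then have "scalar (1 / ?c) * scalar ?c \<in> J"
      using J(1) A_scalar unfolding ideal_iff by simp
    then have "1 \<in> J" using f(3) by (simp flip: scalar_mult add: scalar_one)
    then have "g \<in> J" if "g \<in> A" for g
      using J(1) that unfolding ideal_iff by (metis mult.right_neutral)
    then show ?thesis using J by (auto simp: R_simps)
  qed (use J in blast)
qed


end

section \<open>Finite generation and closed points\<close>

context free_monoid3
begin

lemma finite_type: "generate_ring R (range scalar \<union> range gen) = carrier R"
proof -
  interpret R: cring R by (rule cring_R)
  let ?G = "generate_ring R (range scalar \<union> range gen)"
  have scalar_G: "scalar c \<in> ?G" for c by (auto intro: generate_ring.incl)
  have gen_G: "gen i \<in> ?G" for i by (auto intro: generate_ring.incl)
  have "f \<in> ?G" if "f \<in> A" for f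
    using that
  proof (induction rule: algebra_induct)
    case zero
    then show ?case using scalar_G[of 0] by (simp add: scalar_zero)
  next
    case (add f g)
    then show ?case using generate_ring.eng_add[of f R _ g] by (simp add: R_simps)
  next
    case (single s c)
    then show ?case
    proof (induction rule: monoid_induct)
      case zero
      then show ?case using scalar_G[of c] by (simp add: scalar_def)
    next
      case (gen i s)
      then show ?case using generate_ring.eng_mult[OF gen_G gen(2), of i]
        by (simp add: single_gen_add R_simps)
    qed
  qed
  moreover have "?G \<subseteq> carrier R"
    by (rule R.generate_ring_incl) (use A_scalar A_gen in \<open>auto simp: R_simps\<close>)
  ultimately show ?thesis by (auto simp: R_simps)
qed

text \<open>Polynomials with exponents in the box of size d form a space of dimension at most (d +
  1)^3, and the sizes add under multiplication.\<close>

definition box :: "nat \<Rightarrow> (int^3) set" where "box d = {s \<in> S. \<forall>i. k i s \<le> d}"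

lemma box: "finite (box d)" "card (box d) \<le> (d + 1) ^ 3"
proof -
  let ?\<kappa> = "\<lambda>s. (k 1 s, k 2 s, k 3 s)"
  have inj: "inj_on ?\<kappa> (box d)"
    by (rule inj_onI) (use k_inj in \<open>force simp: box_def forall_3\<close>)
  have sub: "?\<kappa> ` box d \<subseteq> {..d} \<times> {..d} \<times> {..d}" by (auto simp: box_def)
  have fin: "finite ({..d} \<times> {..d} \<times> {..d})" by blast
  show "finite (box d)" using inj_on_finite[OF inj sub fin] .
  have "(d + 1) ^ 3 = (d + 1) * ((d + 1) * (d + 1))" by (simp only: power3_eq_cube mult.assoc)
  then show "card (box d) \<le> (d + 1) ^ 3"
    using card_inj_on_le[OF inj sub fin] by (simp only: card_cartesian_product card_atMost Suc_eq_plus1)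
qed

lemma box_union: "f \<in> A \<Longrightarrow> \<exists>d. Poly_Mapping.keys f \<subseteq> box d"
proof -
  assume f: "f \<in> A"
  let ?d = "\<Sum>s\<in>Poly_Mapping.keys f. \<Sum>i\<in>UNIV. k i s"
  have "k i s \<le> ?d" if "s \<in> Poly_Mapping.keys f" for i s
    using member_le_sum[of i UNIV "\<lambda>i. k i s"]
      member_le_sum[of s "Poly_Mapping.keys f" "\<lambda>s. \<Sum>i\<in>UNIV. k i s"] that by fastforce
  then have "Poly_Mapping.keys f \<subseteq> box ?d" using f by (auto simp: box_def)
  then show ?thesis by blast
qed

lemma box_mono: "d \<le> d' \<Longrightarrow> box d \<subseteq> box d'"
  using order_trans by (fastforce simp: box_def)

lemma box_mult:
  assumes "Poly_Mapping.keys f \<subseteq> box d" "Poly_Mapping.keys g \<subseteq> box d'"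
  shows "Poly_Mapping.keys (f * g) \<subseteq> box (d + d')"
  using keys_mult[of f g] assms by (fastforce simp: box_def k_add add_mem intro: add_mono)

lemma box_power: "Poly_Mapping.keys f \<subseteq> box d \<Longrightarrow> Poly_Mapping.keys (f ^ n) \<subseteq> box (n * d)"
proof (induction n)
  case (Suc n)
  then show ?case using box_mult[of f d "f ^ n" "n * d"] by simp
qed (auto simp: box_def zero_mem k_zero)

lemma lookup_scalar_mult: "Poly_Mapping.lookup (scalar c * f) s = c * Poly_Mapping.lookup f s"
  unfolding scalar_def mult_map_scale_conv_mult[symmetric] by (simp add: map.rep_eq when_def)

lemma linear_dependence:
  assumes "finite I" "\<And>i. i \<in> I \<Longrightarrow> Poly_Mapping.keys (g i) \<subseteq> box d" "(d + 1) ^ 3 < card I"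
  shows "\<exists>c. (\<exists>i\<in>I. c i \<noteq> 0) \<and> (\<Sum>i\<in>I. scalar (c i) * g i) = 0"
proof -
  have "card (box d) < card I" using box(2)[of d] assms(3) by simp
  from homogeneous_system_nontrivial_solution[OF box(1) assms(1) this,
      where M = "\<lambda>i. Poly_Mapping.lookup (g i)"]
  obtain c where c: "\<exists>i\<in>I. c i \<noteq> 0" "\<forall>s\<in>box d. (\<Sum>i\<in>I. c i * Poly_Mapping.lookup (g i) s) = 0"
    by blast
  have "(\<Sum>i\<in>I. c i * Poly_Mapping.lookup (g i) s) = 0" for s
  proof (cases "s \<in> box d")
    case False
    then have "Poly_Mapping.lookup (g i) s = 0" if "i \<in> I" for i
      using assms(2)[OF that] by (auto simp: in_keys_iff)
    then show ?thesis by simp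
  qed (use c in blast)
  then have "(\<Sum>i\<in>I. scalar (c i) * g i) = 0"
    by (intro poly_mapping_eqI) (simp add: lookup_sum lookup_scalar_mult)
  with c(1) show ?thesis by blast
qed

definition subst_gen :: "3 \<Rightarrow> complex poly \<Rightarrow> (int^3 \<Rightarrow>\<^sub>0 complex)" where
  "subst_gen i q = poly (map_poly scalar q) (gen i)"

lemma subst_gen_pCons: "subst_gen i (pCons c q) = scalar c + gen i * subst_gen i q"
  by (simp add: subst_gen_def map_poly_pCons scalar_zero)

lemma subst_gen_0: "subst_gen i 0 = 0"
  by (simp add: subst_gen_def)

lemma subst_gen_add: "subst_gen i (p + q) = subst_gen i p + subst_gen i q"
  by (induction p q rule: poly_induct2)
     (simp_all add: subst_gen_pCons subst_gen_0 scalar_add algebra_simps)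

lemma subst_gen_smult: "subst_gen i (Polynomial.smult c q) = scalar c * subst_gen i q"
  by (induction q) (simp_all add: subst_gen_pCons subst_gen_0 scalar_mult algebra_simps)

lemma subst_gen_mult: "subst_gen i (p * q) = subst_gen i p * subst_gen i q"
  by (induction p)
     (simp_all add: subst_gen_pCons subst_gen_0 subst_gen_add subst_gen_smult scalar_zero algebra_simps)

lemma subst_gen_linear: "subst_gen i [:- c, 1:] = gen i - scalar c"
proof -
  have "scalar (- c) = - scalar c" by (simp add: scalar_def single_uminus)
  then show ?thesis by (simp add: subst_gen_pCons subst_gen_0 scalar_one)
qed

lemma A_subst_gen: "subst_gen i q \<in> A"
  by (induction q) (use A_add A_scalar A_mult A_gen A_zero in \<open>simp_all add: subst_gen_pCons subst_gen_0\<close>)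

lemma subst_gen_prod: "subst_gen i (\<Prod>c\<in>J. q c) = (\<Prod>c\<in>J. subst_gen i (q c))"
proof (induction J rule: infinite_finite_induct)
  case empty
  have "subst_gen i [:1:] = 1" by (simp only: subst_gen_pCons subst_gen_0 scalar_one) simp
  then show ?case by (simp add: one_pCons)
next
  case (infinite J)
  have "subst_gen i [:1:] = 1" by (simp only: subst_gen_pCons subst_gen_0 scalar_one) simp
  then show ?case using infinite by (simp add: one_pCons)
qed (simp add: subst_gen_mult)

lemma subst_gen_sum: "subst_gen i (\<Sum>c\<in>J. q c) = (\<Sum>c\<in>J. subst_gen i (q c))"
  by (induction J rule: infinite_finite_induct) (simp_all add: subst_gen_0 subst_gen_add)

text \<open>A polynomial in one variable over the complex numbers is a product of linear
  factors.\<close>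

lemma prime_contains_linear_factor:
  assumes P: "primeideal P R" and "q \<noteq> 0" "subst_gen i q \<in> P"
  shows "\<exists>c. gen i - scalar c \<in> P"
  using assms(2,3)
proof (induction "Polynomial.degree q" arbitrary: q rule: less_induct)
  case less
  show ?case
  proof (cases "Polynomial.degree q = 0")
    case True
    then obtain c where c: "q = [:c:]" "c \<noteq> 0" using less.prems(1) by (metis degree_eq_zeroE pCons_0_0)
    then have "scalar c \<in> P" using less.prems(2) by (simp add: subst_gen_pCons subst_gen_0)
    then have "scalar (1 / c) * scalar c \<in> P" using P A_scalar unfolding primeideal_iff ideal_iff by blast
    then have "1 \<in> P" using c by (simp flip: scalar_mult add: scalar_one)
    then show ?thesis using P by (simp add: primeideal_iff)
  next
    case False
    then obtain c where "poly q c = 0"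
      using fundamental_theorem_of_algebra[of q] by (auto simp: constant_degree)
    then obtain q' where q': "q = [:- c, 1:] * q'" by (auto simp: poly_eq_0_iff_dvd)
    have "q' \<noteq> 0" using less.prems(1) q' by auto
    moreover from this have "Polynomial.degree q' < Polynomial.degree q"
      unfolding q' by (subst degree_mult_eq) auto
    moreover have "gen i - scalar c \<in> P \<or> subst_gen i q' \<in> P"
      using P less.prems(2) A_subst_gen[of i q'] A_minus[OF A_gen A_scalar, of i c]
      unfolding q' subst_gen_mult subst_gen_linear primeideal_iff by blast
    ultimately show ?thesis using less.hyps by blast
  qed
qed

lemma maximal_inverse:
  assumes P: "maximalideal P R" and x: "x \<in> A" "x \<notin> P"
  shows "\<exists>u\<in>A. 1 - u * x \<in> P"
proof -
  interpret maximalideal P R by fact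
  have PI: "ideal P R" by (rule is_ideal)
  define J where "J = {f \<in> A. \<exists>u\<in>A. f - u * x \<in> P}"
  have "ideal J R"
    unfolding ideal_iff
  proof (intro conjI ballI)
    have "0 - 0 * x \<in> P" using PI by (simp add: ideal_iff)
    then show "0 \<in> J" using A_zero unfolding J_def by blast
  next
    fix f g assume "f \<in> J" "g \<in> J"
    then obtain u v where uv: "f \<in> A" "g \<in> A" "u \<in> A" "v \<in> A" "f - u * x \<in> P" "g - v * x \<in> P"
      by (auto simp: J_def)
    then have "(f - u * x) + (g - v * x) \<in> P" using PI unfolding ideal_iff by blast
    then have "f + g - (u + v) * x \<in> P" by (simp add: algebra_simps)
    then show "f + g \<in> J" using uv A_add unfolding J_def by blast
  next
    fix f g assume f: "f \<in> A" and "g \<in> J"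
    then obtain v where v: "g \<in> A" "v \<in> A" "g - v * x \<in> P" by (auto simp: J_def)
    then have "f * (g - v * x) \<in> P" using PI f unfolding ideal_iff by blast
    then have "f * g - (f * v) * x \<in> P" by (simp add: algebra_simps)
    then show "f * g \<in> J" using f v A_mult unfolding J_def by blast
  qed (auto simp: J_def)
  moreover have "P \<subseteq> J"
  proof
    fix f assume f: "f \<in> P"
    then have "f - 0 * x \<in> P" by simp
    moreover have "f \<in> A" using f PI unfolding ideal_iff by blast
    ultimately show "f \<in> J" using A_zero unfolding J_def by blast
  qed
  moreover have "x \<in> J"
  proof -
    have "x - 1 * x \<in> P" using PI by (simp add: ideal_iff)
    then show ?thesis using x A_one unfolding J_def by blast
  qed
  ultimately have "J = A" using I_maximal[of J] x by (auto simp: R_simps J_def)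
  then have "1 \<in> J" using A_one by simp
  then show ?thesis by (auto simp: J_def)
qed

text \<open>Otherwise gen i - c has an inverse u c modulo P for every complex number c. There are
  uncountably many c, whereas the algebra is a countable union of the finite-dimensional spaces
  given by boxes. So one box contains the exponents of u c for more values c than its dimension.
  Multiplying a linear relation between these u c by the product of the gen i - c gives a nonzero
  polynomial in gen i alone that lies in P.\<close>

lemma maximal_contains_linear:
  assumes P: "maximalideal P R"
  shows "\<exists>c. gen i - scalar c \<in> P"
proof (rule ccontr)
  assume no: "\<nexists>c. gen i - scalar c \<in> P"
  interpret R: cring R by (rule cring_R)
  have prime: "primeideal P R" using R.maximalideal_prime[OF P] .
  then have PI: "ideal P R" by (simp add: primeideal_iff)
  define x where "x c = gen i - scalar c" for c
  have xA: "x c \<in> A" for c using A_minus[OF A_gen A_scalar] by (simp add: x_def)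
  have "\<exists>u. u \<in> A \<and> 1 - u * x c \<in> P" for c
    using maximal_inverse[OF P xA, of c] no by (auto simp: x_def)
  then obtain u where u: "\<And>c. u c \<in> A" "\<And>c. 1 - u c * x c \<in> P" by metis
  define U where "U d = {c. Poly_Mapping.keys (u c) \<subseteq> box d}" for d
  have "\<exists>d. infinite (U d)"
  proof (rule ccontr)
    assume "\<nexists>d. infinite (U d)"
    then have "countable (\<Union>d. U d)" by (intro countable_UN) (auto intro: countable_finite)
    moreover have "(\<Union>d. U d) = UNIV" using box_union[OF u(1)] by (auto simp: U_def)
    ultimately show False using uncountable_UNIV_complex by simp
  qed
  then obtain d where "infinite (U d)" by blast
  then obtain J where J: "finite J" "card J = (d + 1) ^ 3 + 1" "J \<subseteq> U d"
    using infinite_arbitrarily_large by metis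
  then obtain l where l: "\<exists>c\<in>J. l c \<noteq> 0" "(\<Sum>c\<in>J. scalar (l c) * u c) = 0"
    using linear_dependence[of J u d] by (auto simp: U_def)
  \<comment> \<open>the relation between the inverses, multiplied by the product of all linear factors\<close>
  define w where "w c = (\<Prod>b\<in>J - {c}. [:- b, 1:])" for c
  define q where "q = (\<Sum>c\<in>J. Polynomial.smult (l c) (w c))"
  have "subst_gen i q \<in> P"
  proof -
    let ?y = "\<lambda>c. subst_gen i (Polynomial.smult (l c) (w c))"
    have y: "?y c = scalar (l c) * (\<Prod>b\<in>J - {c}. x b)" for c
      by (simp only: subst_gen_smult w_def subst_gen_prod subst_gen_linear x_def)
    have "(\<Prod>b\<in>J. x b) * (\<Sum>c\<in>J. scalar (l c) * u c) = (\<Sum>c\<in>J. ?y c * (u c * x c))"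
      unfolding sum_distrib_left
    proof (rule sum.cong[OF refl])
      fix c assume "c \<in> J"
      then have "(\<Prod>b\<in>J. x b) = x c * (\<Prod>b\<in>J - {c}. x b)" using J(1) by (simp add: prod.remove)
      then show "(\<Prod>b\<in>J. x b) * (scalar (l c) * u c) = ?y c * (u c * x c)"
        unfolding y by (simp add: ac_simps)
    qed
    then have "(\<Sum>c\<in>J. ?y c * (u c * x c)) = 0" using l(2) by simp
    then have "subst_gen i q = (\<Sum>c\<in>J. ?y c * (1 - u c * x c))"
      by (simp add: q_def subst_gen_sum right_diff_distrib sum_subtractf)
    moreover have "(\<Sum>c\<in>J'. ?y c * (1 - u c * x c)) \<in> P" for J'
      by (induction J' rule: infinite_finite_induct)
         (use PI u(2) A_subst_gen in \<open>simp_all add: ideal_iff\<close>)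
    ultimately show ?thesis by simp
  qed
  moreover have "q \<noteq> 0"
  proof -
    obtain c where c: "c \<in> J" "l c \<noteq> 0" using l by blast
    have "poly (w b) c = 0" if "b \<in> J" "b \<noteq> c" for b
      using that c J(1) by (auto simp: w_def poly_prod)
    then have "poly q c = (\<Sum>b\<in>J. if b = c then l c * poly (w c) c else 0)"
      unfolding q_def poly_sum by (intro sum.cong) auto
    also have "\<dots> = l c * poly (w c) c" using c J(1) by simp
    also have "\<dots> \<noteq> 0" using c J(1) by (auto simp: w_def poly_prod)
    finally show ?thesis by auto
  qed
  ultimately show False using prime_contains_linear_factor[OF prime] no by blast
qed

lemma weak_nullstellensatz:
  assumes P: "maximalideal P R"
  shows "\<exists>p. P = vanishing (\<lambda>c. c) p"
proof -
  interpret R: cring R by (rule cring_R)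
  interpret maximalideal P R by fact
  have PI: "ideal P R" by (rule is_ideal)
  obtain p where p: "\<And>i. gen i - scalar (p i) \<in> P" using maximal_contains_linear[OF P] by metis
  interpret V: maximalideal "vanishing (\<lambda>c. c) p" R by (rule maximal_vanishing_point)
  have "vanishing (\<lambda>c. c) p \<subseteq> P"
  proof
    fix f assume "f \<in> vanishing (\<lambda>c. c) p"
    then have "f \<in> A" "ev (\<lambda>c. c) p f = 0" by (auto simp: vanishing_def)
    then show "f \<in> P" using diff_scalar_ev_mem[OF PI p, of f] by (simp add: scalar_zero)
  qed
  then show ?thesis
    using V.I_maximal[OF PI] a_subset I_notcarr by blast
qed

end

section \<open>Height, cotangent dimension and smoothness\<close>

context free_monoid3
begin

lemma ideal_closed:
  assumes "ideal P R"
  shows "0 \<in> P" "P \<subseteq> A" "f \<in> P \<Longrightarrow> g \<in> P \<Longrightarrow> f + g \<in> P" "f \<in> A \<Longrightarrow> g \<in> P \<Longrightarrow> f * g \<in> P"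
  using assms by (auto simp: ideal_iff)

lemma ideal_sum: "ideal P R \<Longrightarrow> (\<And>i. i \<in> I \<Longrightarrow> f i \<in> P) \<Longrightarrow> sum f I \<in> P"
  by (induction I rule: infinite_finite_induct) (auto simp: ideal_closed)

fun power_product :: "(int^3 \<Rightarrow>\<^sub>0 complex) list \<Rightarrow> nat list \<Rightarrow> (int^3 \<Rightarrow>\<^sub>0 complex)" where
  "power_product (f # fs) (n # ns) = f ^ n * power_product fs ns"
| "power_product _ _ = 1"

lemma A_power_product: "set fs \<subseteq> A \<Longrightarrow> power_product fs ns \<in> A"
  by (induction fs ns rule: power_product.induct) (use A_one A_mult A_power in auto)

text \<open>Elements chosen in the successive differences of a chain of primes are algebraically
  independent: divide a relation by the highest possible power of the first element, which is
  allowed modulo the prime Q 0, and then drop the terms that still contain this element, which is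
  allowed modulo Q 1. What remains is a shorter relation modulo Q 1.\<close>

lemma prime_chain_independent:
  assumes "\<And>i. i \<le> length fs \<Longrightarrow> primeideal (Q i) R"
    and "\<And>i. i < length fs \<Longrightarrow> Q i \<subseteq> Q (Suc i)"
    and "\<And>i. i < length fs \<Longrightarrow> fs ! i \<in> Q (Suc i) - Q i"
    and "finite B" "\<And>ns. ns \<in> B \<Longrightarrow> length ns = length fs" "ns0 \<in> B" "c ns0 \<noteq> 0"
  shows "(\<Sum>ns\<in>B. scalar (c ns) * power_product fs ns) \<notin> Q 0"
  using assms
proof (induction fs arbitrary: Q B c ns0)
  case Nil
  have "B = {[]}" "ns0 = []" using Nil.prems(5,6) by auto
  moreover have "scalar (c []) \<notin> Q 0"
  proof
    assume *: "scalar (c []) \<in> Q 0"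
    have Q: "primeideal (Q 0) R" using Nil.prems(1) by simp
    then have "scalar (1 / c []) * scalar (c []) \<in> Q 0"
      using * A_scalar unfolding primeideal_iff ideal_iff by blast
    then show False using Q Nil.prems(7) \<open>ns0 = []\<close>
      by (simp add: primeideal_iff scalar_one flip: scalar_mult)
  qed
  ultimately show ?case by simp
next
  case (Cons f fs)
  have Q0: "primeideal (Q 0) R" and Q1: "primeideal (Q 1) R" using Cons.prems(1)[of 0] Cons.prems(1)[of 1] by auto
  have f: "f \<in> Q 1" "f \<notin> Q 0" using Cons.prems(3)[of 0] by auto
  have Q1I: "ideal (Q 1) R" using Q1 by (simp add: primeideal_iff)
  have fA: "f \<in> A" using f(1) ideal_closed(2)[OF Q1I] by blast
  have fsA: "set fs \<subseteq> A"
  proof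
    fix g assume "g \<in> set fs"
    then obtain i where i: "i < length fs" "g = fs ! i" by (auto simp: in_set_conv_nth)
    then have "g \<in> Q (Suc (Suc i))" using Cons.prems(3)[of "Suc i"] by simp
    moreover have "ideal (Q (Suc (Suc i))) R"
      using Cons.prems(1)[of "Suc (Suc i)"] i by (simp add: primeideal_iff)
    ultimately show "g \<in> A" using ideal_closed(2) by blast
  qed
  define B' where "B' = {ns \<in> B. c ns \<noteq> 0}"
  have B': "finite B'" "ns0 \<in> B'" using Cons.prems(4,6,7) by (auto simp: B'_def)
  have lenB: "ns = hd ns # tl ns" "length (tl ns) = length fs" if "ns \<in> B'" for ns
    using Cons.prems(5)[of ns] that by (cases ns; auto simp: B'_def)+
  define m where "m = Min (hd ` B')"
  have m_le: "m \<le> hd ns" if "ns \<in> B'" for ns using that B' by (simp add: m_def)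
  have "m \<in> hd ` B'" unfolding m_def using B' by (intro Min_in) auto
  then obtain ns1 where ns1: "ns1 \<in> B'" "hd ns1 = m" by auto
  define T where "T ns = scalar (c ns) * (f ^ (hd ns - m) * power_product fs (tl ns))" for ns
  define L where "L = {ns \<in> B'. hd ns = m}"
  have TA: "T ns \<in> A" for ns
    unfolding T_def using A_mult A_scalar A_power[OF fA] A_power_product[OF fsA] by blast
  have "(\<Sum>ns\<in>B. scalar (c ns) * power_product (f # fs) ns)
      = (\<Sum>ns\<in>B'. scalar (c ns) * power_product (f # fs) ns)"
    by (rule sum.mono_neutral_right) (use Cons.prems(4) in \<open>auto simp: B'_def scalar_zero\<close>)
  also have "\<dots> = (\<Sum>ns\<in>B'. f ^ m * T ns)"
  proof (rule sum.cong[OF refl])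
    fix ns assume ns: "ns \<in> B'"
    have "power_product (f # fs) ns = f ^ hd ns * power_product fs (tl ns)"
      by (subst lenB(1)[OF ns]) simp
    moreover have "f ^ hd ns = f ^ m * f ^ (hd ns - m)"
      using m_le[OF ns] by (simp flip: power_add)
    ultimately show "scalar (c ns) * power_product (f # fs) ns = f ^ m * T ns"
      by (simp add: T_def ac_simps)
  qed
  finally have total: "(\<Sum>ns\<in>B. scalar (c ns) * power_product (f # fs) ns) = f ^ m * (\<Sum>ns\<in>B'. T ns)"
    by (simp add: sum_distrib_left)
  have fm: "f ^ n \<notin> Q 0" for n
  proof (induction n)
    case (Suc n)
    then show ?case using f(2) Q0 fA A_power[OF fA] unfolding primeideal_iff power_Suc by blast
  qed (use Q0 in \<open>simp add: primeideal_iff\<close>)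
  have low: "(\<Sum>ns\<in>L. T ns) \<notin> Q 1"
  proof -
    have inj: "inj_on tl L" by (rule inj_onI) (metis (mono_tags, lifting) L_def lenB(1) mem_Collect_eq)
    have "(\<Sum>ms\<in>tl ` L. scalar (c (m # ms)) * power_product fs ms) \<notin> Q (Suc 0)"
    proof (rule Cons.IH[of "\<lambda>i. Q (Suc i)" "tl ` L" "tl ns1" "\<lambda>ms. c (m # ms)"])
      show "finite (tl ` L)" using B' by (simp add: L_def)
      show "tl ns1 \<in> tl ` L" using ns1 by (auto simp: L_def)
      show "c (m # tl ns1) \<noteq> 0" using ns1 lenB(1)[OF ns1(1)] by (simp add: B'_def)
      fix i
      show "primeideal (Q (Suc i)) R" if "i \<le> length fs" using Cons.prems(1)[of "Suc i"] that by simp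
      show "Q (Suc i) \<subseteq> Q (Suc (Suc i))" if "i < length fs" using Cons.prems(2)[of "Suc i"] that by simp
      show "fs ! i \<in> Q (Suc (Suc i)) - Q (Suc i)" if "i < length fs" using Cons.prems(3)[of "Suc i"] that by simp
    qed (use lenB(2) in \<open>auto simp: L_def\<close>)
    also have "(\<Sum>ms\<in>tl ` L. scalar (c (m # ms)) * power_product fs ms) = (\<Sum>ns\<in>L. T ns)"
      unfolding sum.reindex[OF inj]
    proof (rule sum.cong[OF refl])
      fix ns assume "ns \<in> L"
      then have "m # tl ns = ns" "hd ns = m" using lenB(1) by (auto simp: L_def)
      then show "((\<lambda>ms. scalar (c (m # ms)) * power_product fs ms) \<circ> tl) ns = T ns"
        by (simp add: T_def)
    qed
    finally show ?thesis by simp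
  qed
  have high: "(\<Sum>ns\<in>B' - L. T ns) \<in> Q 1"
  proof (rule ideal_sum[OF Q1I])
    fix ns assume "ns \<in> B' - L"
    then have "hd ns - m \<noteq> 0" using m_le[of ns] by (auto simp: L_def)
    then obtain n where "hd ns - m = Suc n" by (metis not0_implies_Suc)
    then have "T ns = (scalar (c ns) * (f ^ n * power_product fs (tl ns))) * f" by (simp add: T_def ac_simps)
    moreover have "scalar (c ns) * (f ^ n * power_product fs (tl ns)) \<in> A"
      using A_mult A_scalar A_power[OF fA] A_power_product[OF fsA] by blast
    ultimately show "T ns \<in> Q 1" using ideal_closed(4)[OF Q1I _ f(1)] by metis
  qed
  show ?case
  proof
    assume "(\<Sum>ns\<in>B. scalar (c ns) * power_product (f # fs) ns) \<in> Q 0"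
    then have "(\<Sum>ns\<in>B'. T ns) \<in> Q 0"
      using fm[of m] Q0 A_power[OF fA, of m] A_sum[of B' T] TA
      unfolding total primeideal_iff by blast
    then have "(\<Sum>ns\<in>B'. T ns) \<in> Q 1" using Cons.prems(2)[of 0] by auto
    moreover have "(\<Sum>ns\<in>B'. T ns) = (\<Sum>ns\<in>L. T ns) + (\<Sum>ns\<in>B' - L. T ns)"
      using B'(1) by (metis (no_types, lifting) L_def add.commute mem_Collect_eq subsetI sum.subset_diff)
    ultimately show False using low ideal_minus[OF Q1I _ high] by (metis add_diff_cancel_right')
  qed
qed

lemma box_power_product:
  assumes "\<And>f. f \<in> set fs \<Longrightarrow> Poly_Mapping.keys f \<subseteq> box d"
  shows "Poly_Mapping.keys (power_product fs ns) \<subseteq> box (sum_list ns * d)"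
  using assms
proof (induction fs ns rule: power_product.induct)
  case (1 f fs n ns)
  have "Poly_Mapping.keys (f ^ n) \<subseteq> box (n * d)" using 1(2)[of f] by (intro box_power) simp
  moreover have "Poly_Mapping.keys (power_product fs ns) \<subseteq> box (sum_list ns * d)" using 1 by simp
  ultimately show ?case using box_mult by (simp add: distrib_right)
qed (auto simp: box_def zero_mem k_zero)

text \<open>Four elements are algebraically dependent because the (N + 1)^4 products of their
  powers with exponents at most N lie in a space of dimension at most (4 N d + 1)^3, where d
  bounds the exponents of the four elements.\<close>

lemma no_prime_chain_of_length_four:
  assumes prime: "\<And>i. i \<le> 4 \<Longrightarrow> primeideal (Q i) R" and strict: "\<And>i. i < 4 \<Longrightarrow> Q i \<subset> Q (Suc i)"
  shows False
proof -
  have "\<exists>f. f \<in> Q (Suc i) - Q i" if "i < 4" for i using strict[OF that] by blast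
  then obtain F where F: "\<And>i. i < 4 \<Longrightarrow> F i \<in> Q (Suc i) - Q i" by metis
  define fs where "fs = map F [0..<4]"
  have fs: "length fs = 4" "\<And>i. i < 4 \<Longrightarrow> fs ! i = F i" by (simp_all add: fs_def)
  have FA: "F i \<in> A" if "i < 4" for i
  proof -
    have "ideal (Q (Suc i)) R" using prime[of "Suc i"] that by (simp add: primeideal_iff)
    then show ?thesis using F[OF that] ideal_closed(2) by blast
  qed
  then have "\<exists>d. Poly_Mapping.keys (F i) \<subseteq> box d" if "i < 4" for i using box_union that by blast
  then obtain D where D: "\<And>i. i < 4 \<Longrightarrow> Poly_Mapping.keys (F i) \<subseteq> box (D i)" by metis
  define d where "d = (\<Sum>i<4. D i)"
  have d: "Poly_Mapping.keys f \<subseteq> box d" if "f \<in> set fs" for f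
  proof -
    obtain i where "i < length fs" "fs ! i = f" using \<open>f \<in> set fs\<close> unfolding in_set_conv_nth by blast
    then have i: "i < 4" "f = F i" using fs by auto
    then have "D i \<le> d" unfolding d_def by (intro member_le_sum) auto
    then show ?thesis using D[OF i(1)] box_mono i(2) by blast
  qed
  \<comment> \<open>with this N one has (4 N d + 1)^3 < (N + 1)^4\<close>
  define C where "C = 4 * d + 1"
  define N where "N = C ^ 3"
  define B where "B = {ns :: nat list. set ns \<subseteq> {..N} \<and> length ns = 4}"
  have B: "finite B" "card B = (N + 1) ^ 4"
    using finite_lists_length_eq[of "{..N}" 4] card_lists_length_eq[of "{..N}" 4] by (simp_all add: B_def)
  have keys: "Poly_Mapping.keys (power_product fs ns) \<subseteq> box (4 * N * d)" if "ns \<in> B" for ns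
  proof -
    have "sum_list ns \<le> length ns * N"
      using sum_list_mono[of ns "\<lambda>x. x" "\<lambda>_. N"] that by (auto simp: B_def sum_list_triv)
    then have "sum_list ns * d \<le> 4 * N * d" using that by (auto simp: B_def)
    then show ?thesis using box_power_product[OF d] box_mono by blast
  qed
  have "(4 * N * d + 1) ^ 3 \<le> (C * (N + 1)) ^ 3"
    by (rule power_mono) (simp_all add: C_def algebra_simps)
  also have "\<dots> = N * (N + 1) ^ 3" by (simp only: N_def power_mult_distrib)
  also have "\<dots> < (N + 1) * (N + 1) ^ 3" by (rule mult_strict_right_mono) simp_all
  also have "\<dots> = (N + 1) ^ 4" by (simp only: power_Suc[symmetric]) simp
  finally have "(4 * N * d + 1) ^ 3 < card B" using B(2) by simp
  then have "\<exists>c. (\<exists>ns\<in>B. c ns \<noteq> 0) \<and> (\<Sum>ns\<in>B. scalar (c ns) * power_product fs ns) = 0"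
    by (intro linear_dependence[where g = "power_product fs" and d = "4 * N * d"] B(1) keys)
  then obtain c where c: "\<exists>ns\<in>B. c ns \<noteq> 0" "(\<Sum>ns\<in>B. scalar (c ns) * power_product fs ns) = 0"
    by (elim exE conjE)
  from c(1) obtain ns0 where "ns0 \<in> B" "c ns0 \<noteq> 0" by blast
  then have "(\<Sum>ns\<in>B. scalar (c ns) * power_product fs ns) \<notin> Q 0"
    by (intro prime_chain_independent) (use prime strict F B(1) fs in \<open>auto simp: B_def psubset_imp_subset\<close>)
  moreover have "ideal (Q 0) R" using prime[of 0] by (simp add: primeideal_iff)
  ultimately show False using c(2) ideal_closed(1) by simp
qed

lemma poly_ev: "poly (ev h t f) x = ev (\<lambda>c. poly (h c) x) (\<lambda>i. poly (t i) x) f"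
  by (simp add: ev_def poly_sum poly_prod)

lemma vanishing_specialize:
  assumes "\<And>c. poly (h c) x = h' c" "\<And>i. poly (t i) x = t' i"
  shows "vanishing h t \<subseteq> vanishing h' t'"
proof
  fix f assume f: "f \<in> vanishing h t"
  have "ev h' t' f = poly (ev h t f) x" by (simp add: poly_ev assms)
  then show "f \<in> vanishing h' t'" using f by (simp add: vanishing_def)
qed

lemma gen_minus_scalar_mem_vanishing:
  assumes "coefficient_hom h"
  shows "gen i - scalar c \<in> vanishing h t \<longleftrightarrow> t i = h c"
  using A_minus[OF A_gen A_scalar, of i c]
  by (simp add: vanishing_def ev_minus[OF assms A_gen A_scalar] ev_gen[OF assms] ev_scalar[OF assms])

text \<open>The chain of length three consists of the kernels of the evaluations at the generic
  point and at the points obtained from it by specializing the coordinates 3, 2 and 1 in turn. The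
  generic coordinates are the variables of iterated polynomial rings.\<close>

lemma height_vanishing_point: "height R (vanishing (\<lambda>c. c) p) = 3"
proof -
  let ?P = "vanishing (\<lambda>c. c) p"
  let ?chain = "\<lambda>n Q. (\<forall>i\<le>n. primeideal (Q i) R) \<and> (\<forall>i<n. Q i \<subset> Q (Suc i)) \<and> Q n = ?P"
  let ?N = "{enat n | n. \<exists>Q :: nat \<Rightarrow> (int^3 \<Rightarrow>\<^sub>0 complex) set. ?chain n Q}"
  have le: "n \<le> 3" if "?chain n Q" for n Q
  proof (rule ccontr)
    assume "\<not> n \<le> 3"
    then show False using that by (intro no_prime_chain_of_length_four[of Q]) auto
  qed
  define h1 :: "complex \<Rightarrow> complex poly" where "h1 c = [:c:]" for c
  define h2 where "h2 c = [:h1 c:]" for c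
  define h3 where "h3 c = [:h2 c:]" for c
  have h1: "coefficient_hom h1" using coefficient_hom_const_poly[OF coefficient_hom_id] by (simp add: h1_def[abs_def])
  have h2: "coefficient_hom h2" using coefficient_hom_const_poly[OF h1] by (simp add: h2_def[abs_def])
  have h3: "coefficient_hom h3" using coefficient_hom_const_poly[OF h2] by (simp add: h3_def[abs_def])
  define t1 where "t1 i = (if i = 1 then [:0, 1:] else h1 (p i))" for i
  define t2 where "t2 i = (if i = 2 then [:0, 1:] else [:t1 i:])" for i
  define t3 where "t3 i = (if i = 3 then [:0, 1:] else [:t2 i:])" for i
  have "(3::3) \<noteq> 1" "(3::3) \<noteq> 2" "(2::3) \<noteq> 1" by simp_all
  have sub1: "vanishing h1 t1 \<subset> ?P"
  proof
    show "vanishing h1 t1 \<subseteq> ?P" by (rule vanishing_specialize[of _ "p 1"]) (auto simp: h1_def t1_def)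
    have "gen 1 - scalar (p 1) \<in> ?P" "gen 1 - scalar (p 1) \<notin> vanishing h1 t1"
      unfolding gen_minus_scalar_mem_vanishing[OF h1] gen_minus_scalar_mem_vanishing[OF coefficient_hom_id]
      by (simp_all add: t1_def h1_def)
    then show "vanishing h1 t1 \<noteq> ?P" by blast
  qed
  have sub2: "vanishing h2 t2 \<subset> vanishing h1 t1"
  proof
    show "vanishing h2 t2 \<subseteq> vanishing h1 t1"
      by (rule vanishing_specialize[of _ "h1 (p 2)"]) (auto simp: h2_def t2_def t1_def)
    have "gen 2 - scalar (p 2) \<in> vanishing h1 t1" "gen 2 - scalar (p 2) \<notin> vanishing h2 t2"
      unfolding gen_minus_scalar_mem_vanishing[OF h1] gen_minus_scalar_mem_vanishing[OF h2]
      by (simp_all add: t1_def t2_def h2_def)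
    then show "vanishing h2 t2 \<noteq> vanishing h1 t1" by blast
  qed
  have sub3: "vanishing h3 t3 \<subset> vanishing h2 t2"
  proof
    show "vanishing h3 t3 \<subseteq> vanishing h2 t2"
      by (rule vanishing_specialize[of _ "h2 (p 3)"]) (auto simp: h3_def t3_def t2_def t1_def h2_def)
    have "gen 3 - scalar (p 3) \<in> vanishing h2 t2" "gen 3 - scalar (p 3) \<notin> vanishing h3 t3"
      unfolding gen_minus_scalar_mem_vanishing[OF h2] gen_minus_scalar_mem_vanishing[OF h3]
      by (simp_all add: t1_def t2_def t3_def h2_def h3_def)
    then show "vanishing h3 t3 \<noteq> vanishing h2 t2" by blast
  qed
  define Q where "Q n = [vanishing h3 t3, vanishing h2 t2, vanishing h1 t1, ?P] ! n" for n
  have "?chain 3 Q"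
  proof (intro conjI allI impI)
    fix i :: nat assume "i \<le> 3"
    then consider "i = 0" | "i = 1" | "i = 2" | "i = 3" by linarith
    then show "primeideal (Q i) R"
      using primeideal_vanishing[OF h1, of t1] primeideal_vanishing[OF h2, of t2]
        primeideal_vanishing[OF h3, of t3] primeideal_vanishing[OF coefficient_hom_id, of p]
      by cases (simp_all add: Q_def)
  next
    fix i :: nat assume "i < 3"
    then consider "i = 0" | "i = 1" | "i = 2" by linarith
    then show "Q i \<subset> Q (Suc i)"
      using sub1 sub2 sub3 by cases (simp_all add: Q_def)
  qed (simp add: Q_def)
  then have "enat 3 \<in> ?N" by blast
  then have "enat 3 \<le> Sup ?N" by (rule Sup_upper)
  moreover have "Sup ?N \<le> enat 3"
  proof (rule Sup_least)
    fix x assume "x \<in> ?N"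
    then obtain n Q where "x = enat n" "?chain n Q" by blast
    then show "x \<le> enat 3" using le[of n Q] by simp
  qed
  ultimately have "Sup ?N = enat 3" by (rule antisym[rotated])
  then show ?thesis unfolding height_def by (simp add: numeral_eq_enat)
qed

text \<open>The linear coefficient of the evaluation at p plus the variable times the j-th unit
  vector is the j-th partial derivative at p. The partial derivatives vanish on the square of the
  ideal of p. Given fewer than three elements of the ideal, some nonzero combination of the
  derivatives also vanishes on these elements, hence on the ideal that they generate together with
  the square; but it takes a nonzero value at one of the gen i - p i.\<close>

lemma cotangent_dim_vanishing_point: "cotangent_dim R (vanishing (\<lambda>c. c) p) = 3"
proof -
  interpret R: cring R by (rule cring_R)
  let ?P = "vanishing (\<lambda>c. c) p"
  have PI: "ideal ?P R" using primeideal_vanishing[OF coefficient_hom_id] by (simp add: primeideal_iff)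
  have PA: "?P \<subseteq> A" by (rule ideal_closed(2)[OF PI])
  let ?gens = "\<lambda>F. finite F \<and> F \<subseteq> ?P \<and> genideal R (F \<union> ideal_prod R ?P ?P) = ?P"
  have prodP: "ideal_prod R ?P ?P \<subseteq> ?P" using R.ideal_prod_inter[OF PI PI] by blast
  define G where "G = range (\<lambda>i. gen i - scalar (p i))"
  have GP: "G \<subseteq> ?P"
    by (auto simp: G_def gen_minus_scalar_mem_vanishing[OF coefficient_hom_id])
  have "?gens G"
  proof (intro conjI)
    let ?J = "genideal R (G \<union> ideal_prod R ?P ?P)"
    have sub: "G \<union> ideal_prod R ?P ?P \<subseteq> carrier R" using GP prodP PA by (auto simp: R_simps)
    have J: "ideal ?J R" by (rule R.genideal_ideal[OF sub])
    have "?J \<subseteq> ?P" by (rule R.genideal_minimal[OF PI]) (use GP prodP in blast)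
    moreover have "f \<in> ?J" if "f \<in> ?P" for f
    proof -
      have "gen i - scalar (p i) \<in> ?J" for i using R.genideal_self[OF sub] by (auto simp: G_def)
      from diff_scalar_ev_mem[OF J this, of f] that PA show ?thesis
        by (auto simp: vanishing_def scalar_zero)
    qed
    ultimately show "?J = ?P" by blast
  qed (use GP in \<open>auto simp: G_def\<close>)
  moreover have "card G \<le> 3" using card_image_le[of UNIV "\<lambda>i::3. gen i - scalar (p i)"] by (simp add: G_def)
  ultimately have upper: "cotangent_dim R ?P \<le> 3"
    unfolding cotangent_dim_def
    by (intro Inf_lower2[of "enat (card G)"]) (auto simp: numeral_eq_enat)
  have lower: "3 \<le> card F" if F: "?gens F" for F
  proof (rule ccontr)
    assume "\<not> 3 \<le> card F"
    then have "card F < card (UNIV :: 3 set)" by simp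
    define h1 :: "complex \<Rightarrow> complex poly" where "h1 c = [:c:]" for c
    have h1: "coefficient_hom h1" using coefficient_hom_const_poly[OF coefficient_hom_id] by (simp add: h1_def[abs_def])
    define t where "t j i = [:p i, if i = j then 1 else 0:]" for i j :: 3
    define D where "D j f = Polynomial.coeff (ev h1 (t j) f) 1" for j f
    have c0: "Polynomial.coeff (ev h1 (t j) f) 0 = ev (\<lambda>c. c) p f" for j f
    proof -
      have "poly (ev h1 (t j) f) 0 = ev (\<lambda>c. poly (h1 c) 0) (\<lambda>i. poly (t j i) 0) f" by (rule poly_ev)
      then show ?thesis by (simp add: h1_def t_def poly_0_coeff_0)
    qed
    have D_mult: "D j (f * g) = ev (\<lambda>c. c) p f * D j g + D j f * ev (\<lambda>c. c) p g" if "f \<in> A" "g \<in> A" for j f g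
      unfolding D_def ev_mult[OF h1 that] coeff_mult by (simp add: c0)
    have D_add: "D j (f + g) = D j f + D j g" for j f g
      by (simp add: D_def ev_add[OF h1])
    have D_zero: "D j 0 = 0" for j by (simp add: D_def ev_zero[OF h1])
    have "finite F" using F by blast
    from homogeneous_system_nontrivial_solution[OF this _ \<open>card F < card (UNIV :: 3 set)\<close>, of D]
    obtain v where v: "\<exists>i. v i \<noteq> 0" "\<forall>f\<in>F. (\<Sum>i\<in>UNIV. v i * D i f) = 0" by auto
    define J where "J = {f \<in> ?P. (\<Sum>i\<in>UNIV. v i * D i f) = 0}"
    have evP: "ev (\<lambda>c. c) p f = 0" if "f \<in> ?P" for f using that by (simp add: vanishing_def)
    have "ideal J R"
      unfolding ideal_iff
    proof (intro conjI ballI)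
      show "J \<subseteq> A" using PA by (auto simp: J_def)
      show "0 \<in> J" using ideal_closed(1)[OF PI] by (simp add: J_def D_zero)
      show "f + g \<in> J" if "f \<in> J" "g \<in> J" for f g
        using that ideal_closed(3)[OF PI] by (simp add: J_def D_add distrib_left sum.distrib)
      show "f * g \<in> J" if "f \<in> A" "g \<in> J" for f g
      proof -
        have g: "g \<in> ?P" "g \<in> A" using that PA by (auto simp: J_def)
        have "(\<Sum>i\<in>UNIV. v i * D i (f * g)) = ev (\<lambda>c. c) p f * (\<Sum>i\<in>UNIV. v i * D i g)"
          by (simp add: D_mult[OF that(1) g(2)] evP[OF g(1)] sum_distrib_left mult.left_commute)
        then show ?thesis using that g ideal_closed(4)[OF PI] by (simp add: J_def)
      qed
    qed
    moreover have "F \<subseteq> J" using F v(2) by (auto simp: J_def)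
    moreover have "ideal_prod R ?P ?P \<subseteq> J"
    proof
      fix f assume "f \<in> ideal_prod R ?P ?P"
      then show "f \<in> J"
      proof induction
        case (prod f g)
        then have fg: "f \<in> A" "g \<in> A" "f * g \<in> ?P" using PA ideal_closed(4)[OF PI] by blast+
        then show ?case by (simp add: J_def R_simps D_mult evP prod)
      next
        case (sum f g)
        then show ?case using ideal_closed(3)[OF \<open>ideal J R\<close>] by (simp add: R_simps)
      qed
    qed
    ultimately have "?P \<subseteq> J" using R.genideal_minimal[of J "F \<union> ideal_prod R ?P ?P"] F by blast
    then have "gen j - scalar (p j) \<in> J" for j using GP by (auto simp: G_def)
    then have "(\<Sum>i\<in>UNIV. v i * D i (gen j - scalar (p j))) = 0" for j by (simp add: J_def)
    moreover have "D i (gen j - scalar (p j)) = (if j = i then 1 else 0)" for i j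
      by (simp add: D_def ev_minus[OF h1 A_gen A_scalar] ev_gen[OF h1] ev_scalar[OF h1] t_def h1_def)
    ultimately have "(\<Sum>i\<in>UNIV. if j = i then v i else 0) = 0" for j
      by (simp add: if_distrib cong: if_cong)
    then have "v j = 0" for j by simp
    then show False using v(1) by blast
  qed
  have "3 \<le> cotangent_dim R ?P"
    unfolding cotangent_dim_def
  proof (rule Inf_greatest)
    fix x assume "x \<in> {enat (card F) | F. ?gens F}"
    then show "3 \<le> x" using lower by (auto simp: numeral_eq_enat)
  qed
  with upper show ?thesis by (rule antisym)
qed

theorem smooth_semigroup_algebra: "smooth_Spec R scalar"
  unfolding smooth_Spec_def
proof (intro conjI allI impI)
  show "\<exists>F. finite F \<and> F \<subseteq> carrier R \<and> generate_ring R (range scalar \<union> F) = carrier R"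
    by (intro exI[of _ "range gen"]) (use finite_type A_gen in \<open>auto simp: R_simps\<close>)
  fix P assume "maximalideal P R"
  then obtain p where "P = vanishing (\<lambda>c. c) p" using weak_nullstellensatz by blast
  then show "cotangent_dim R P = height R P"
    by (simp add: cotangent_dim_vanishing_point height_vanishing_point)
qed

lemma maximal_vanishing_origin: "maximalideal {f \<in> A. Poly_Mapping.lookup f 0 = 0} R"
proof -
  have "ev (\<lambda>c. c) (\<lambda>_. 0) f = Poly_Mapping.lookup f 0" if "f \<in> A" for f
    using that
  proof (induction rule: algebra_induct)
    case (single s c)
    have "(\<Prod>i\<in>UNIV. (0::complex) ^ k i s) = (if s = 0 then 1 else 0)"
    proof (cases "s = 0")
      case False
      then obtain i where "k i s \<noteq> 0" using k_inj[OF single zero_mem] k_zero by metis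
      then have "\<exists>i\<in>UNIV. (0::complex) ^ k i s = 0" by auto
      then have "(\<Prod>i\<in>UNIV. (0::complex) ^ k i s) = 0" by (intro prod_zero) auto
      then show ?thesis using False by simp
    qed (simp add: k_zero)
    then show ?case by (simp add: ev_single[OF coefficient_hom_id] lookup_single when_def)
  qed (simp_all add: ev_zero[OF coefficient_hom_id] ev_add[OF coefficient_hom_id] lookup_add)
  then have "{f \<in> A. Poly_Mapping.lookup f 0 = 0} = vanishing (\<lambda>c. c) (\<lambda>_. 0)"
    by (auto simp: vanishing_def)
  then show ?thesis using maximal_vanishing_point by simp
qed

end

lemma Spec_iso_refl: "Spec_iso R \<kappa> R \<kappa>"
proof -
  have V: "{P \<in> Spec R. P \<in> V} = V" if "openin (zariski R) V" for V
  proof -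
    have "topspace (zariski R) \<subseteq> Spec R"
      by (auto simp: zariski_def)
    then show ?thesis using openin_subset[OF that] by blast
  qed
  show ?thesis
    unfolding Spec_iso_def
  proof (intro exI[of _ id] exI[of _ "\<lambda>_. id"] conjI allI impI ballI)
    fix V assume "openin (zariski R) V"
    then show "let U = {P \<in> Spec R. id P \<in> V} in
          id \<in> ring_iso (sections R V) (sections R U) \<and>
          (\<forall>c. id (restrict (\<lambda>Q. fraction R Q (\<kappa> c) \<one>\<^bsub>R\<^esub>) V) = restrict (\<lambda>P. fraction R P (\<kappa> c) \<one>\<^bsub>R\<^esub>) U)"
      using V by (simp add: ring_iso_def ring_hom_def)
  qed (simp_all add: V)
qed

section \<open>Characters and invariant monomials\<close>

definition diag :: "nat \<Rightarrow> nat \<Rightarrow> complex \<Rightarrow> complex^3^3" where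
  "diag r a \<epsilon> = (\<chi> i j. if i = j then (vector [\<epsilon>, \<epsilon> ^ a, \<epsilon> ^ (r - a)] :: complex^3) $ i else 0)"

lemma G_group_diag: "G_group r a = diag r a ` {\<epsilon>. \<epsilon> ^ r = 1}"
  by (auto simp: G_group_def diag_def)

lemma diag_mult: "diag r a \<epsilon> ** diag r a \<delta> = diag r a (\<epsilon> * \<delta>)"
  by (simp add: vec_eq_iff diag_def matrix_matrix_mult_def forall_3 sum_3 power_mult_distrib)

lemma diag_nth: "diag r a \<epsilon> $ 1 $ 1 = \<epsilon>" "diag r a \<epsilon> $ 2 $ 2 = \<epsilon> ^ a" "diag r a \<epsilon> $ 3 $ 3 = \<epsilon> ^ (r - a)"
  by (simp_all add: diag_def)

lemma prod_UNIV_3: "prod f (UNIV :: 3 set) = f 1 * f 2 * f 3"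
  unfolding UNIV_3 by (simp add: mult.assoc)

text \<open>The character of the monomial m sends diag(\<epsilon>, \<epsilon>^a, \<epsilon>^(r-a))
  to this power of \<epsilon>.\<close>

definition weight_exponent :: "nat \<Rightarrow> int^3 \<Rightarrow> int" where
  "weight_exponent a m = m $ 1 + int a * m $ 2 - int a * m $ 3"

lemma weight_exponent_add: "weight_exponent a (m + n) = weight_exponent a m + weight_exponent a n"
  by (simp add: weight_exponent_def algebra_simps)

lemma weight_exponent_diff: "weight_exponent a (m - n) = weight_exponent a m - weight_exponent a n"
  by (simp add: weight_exponent_def algebra_simps)

context
  fixes r a :: nat
  assumes a: "1 \<le> a" "a < r"
begin

lemma M_lattice_iff: "m \<in> M_lattice r a \<longleftrightarrow> int r dvd weight_exponent a m"
proof -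
  let ?w = "vector [1, real a, real r - real a] :: real^3"
  have w: "rvec m \<bullet> ?w = real_of_int (weight_exponent a m + int r * m $ 3)"
    by (simp add: inner_vec_def sum_3 rvec_def weight_exponent_def algebra_simps)
  have int: "rvec m \<bullet> rvec n = real_of_int (m $ 1 * n $ 1 + m $ 2 * n $ 2 + m $ 3 * n $ 3)" for n
    by (simp add: inner_vec_def sum_3 rvec_def)
  show ?thesis
  proof
    assume m: "m \<in> M_lattice r a"
    have "rvec 0 + (of_int 1 / real r) *\<^sub>R ?w \<in> L_lattice r a" unfolding L_lattice_def by blast
    then have "rvec m \<bullet> (rvec 0 + (of_int 1 / real r) *\<^sub>R ?w) \<in> \<int>"
      using m unfolding M_lattice_def by blast
    then obtain k where "rvec m \<bullet> (rvec 0 + (of_int 1 / real r) *\<^sub>R ?w) = of_int k"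
      by (auto simp: Ints_def)
    then have "real_of_int (weight_exponent a m + int r * m $ 3) / real r = of_int k"
      by (simp only: inner_add_right inner_scaleR_right int w) simp
    then have "real_of_int (weight_exponent a m + int r * m $ 3) = of_int (int r * k)"
      using a by (simp add: nonzero_divide_eq_eq mult.commute)
    then have "weight_exponent a m + int r * m $ 3 = int r * k" by (simp only: of_int_eq_iff)
    then have "weight_exponent a m = int r * (k - m $ 3)" by (simp add: algebra_simps)
    then show "int r dvd weight_exponent a m" by simp
  next
    assume "int r dvd weight_exponent a m"
    then obtain q where q: "weight_exponent a m = int r * q" by blast
    show "m \<in> M_lattice r a"
      unfolding M_lattice_def L_lattice_def
    proof clarify
      fix n :: "int^3" and k :: int
      have "(of_int k / real r) * real_of_int (weight_exponent a m + int r * m $ 3) = of_int (k * (q + m $ 3))"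
        using a by (simp add: q field_simps)
      then have "rvec m \<bullet> (rvec n + (of_int k / real r) *\<^sub>R ?w)
          = of_int (m $ 1 * n $ 1 + m $ 2 * n $ 2 + m $ 3 * n $ 3 + k * (q + m $ 3))"
        by (simp only: inner_add_right inner_scaleR_right int w of_int_add)
      then show "rvec m \<bullet> (rvec n + (of_int k / real r) *\<^sub>R ?w) \<in> \<int>"
        by (metis Ints_of_int)
    qed
  qed
qed

lemma M_lattice_closed:
  "0 \<in> M_lattice r a" "m \<in> M_lattice r a \<Longrightarrow> n \<in> M_lattice r a \<Longrightarrow> m + n \<in> M_lattice r a"
  "m \<in> M_lattice r a \<Longrightarrow> n \<in> M_lattice r a \<Longrightarrow> m - n \<in> M_lattice r a"
  by (simp_all add: M_lattice_iff weight_exponent_add weight_exponent_diff) (simp add: weight_exponent_def)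

lemma power_int_root_of_unity:
  assumes "(\<epsilon> :: complex) ^ r = 1"
  shows "\<epsilon> powi n = \<epsilon> ^ nat (n mod int r)"
proof -
  have nz: "\<epsilon> \<noteq> 0" using assms a by (auto simp: power_0_left)
  have "\<epsilon> powi n = \<epsilon> powi (int r * (n div int r) + n mod int r)" by simp
  also have "\<dots> = (\<epsilon> powi int r) powi (n div int r) * \<epsilon> powi (n mod int r)"
    using nz by (subst power_int_add) (simp_all add: power_int_mult)
  also have "\<dots> = \<epsilon> ^ nat (n mod int r)" using a assms by (simp add: power_int_def)
  finally show ?thesis .
qed

lemma wt_diag:
  assumes "\<epsilon> ^ r = 1"
  shows "wt r a m (diag r a \<epsilon>) = \<epsilon> ^ nat (weight_exponent a m mod int r)"
proof -
  have nz: "\<epsilon> \<noteq> 0" using assms a by (auto simp: power_0_left)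
  have "diag r a \<epsilon> \<in> G_group r a" using assms by (auto simp: G_group_diag)
  then have "wt r a m (diag r a \<epsilon>) = \<epsilon> powi (m $ 1) * (\<epsilon> ^ a) powi (m $ 2) * (\<epsilon> ^ (r - a)) powi (m $ 3)"
    by (simp only: wt_def restrict_apply' prod_UNIV_3 diag_nth)
  also have "\<dots> = \<epsilon> powi (m $ 1 + int a * m $ 2 + int (r - a) * m $ 3)"
    unfolding power_int_add[OF disjI1[OF nz]] power_int_mult power_int_of_nat ..
  also have "\<dots> = \<epsilon> ^ nat ((m $ 1 + int a * m $ 2 + int (r - a) * m $ 3) mod int r)"
    by (rule power_int_root_of_unity[OF assms])
  also have "(m $ 1 + int a * m $ 2 + int (r - a) * m $ 3) = weight_exponent a m + int r * m $ 3"
    using a by (simp add: weight_exponent_def of_nat_diff algebra_simps)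
  finally show ?thesis by simp
qed

lemma primitive_root_of_unity:
  obtains \<zeta> :: complex where "\<zeta> ^ r = 1" "\<And>\<epsilon>. \<epsilon> ^ r = 1 \<Longrightarrow> \<exists>j<r. \<epsilon> = \<zeta> ^ j"
    "\<And>i j. i < r \<Longrightarrow> j < r \<Longrightarrow> \<zeta> ^ i = \<zeta> ^ j \<Longrightarrow> i = j"
proof -
  let ?\<zeta> = "cis (2 * pi / real r)"
  have pow: "?\<zeta> ^ k = cis (2 * pi * real k / real r)" for k
    by (simp only: Complex.DeMoivre) (simp add: field_simps)
  have bij: "bij_betw (\<lambda>k. ?\<zeta> ^ k) {..<r} {z. z ^ r = 1}"
    unfolding pow using Complex.bij_betw_roots_unity[of r] a by simp
  show ?thesis
  proof (rule that)
    show "?\<zeta> ^ r = 1" using a by (simp add: pow)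
    show "\<exists>j<r. \<epsilon> = ?\<zeta> ^ j" if "\<epsilon> ^ r = 1" for \<epsilon>
    proof -
      have "\<epsilon> \<in> (\<lambda>k. ?\<zeta> ^ k) ` {..<r}" using bij that by (simp add: bij_betw_def)
      then show ?thesis by blast
    qed
    show "i = j" if "i < r" "j < r" "?\<zeta> ^ i = ?\<zeta> ^ j" for i j
      using bij that unfolding bij_betw_def inj_on_def by simp
  qed
qed

lemma wt_eq_iff: "wt r a m = wt r a n \<longleftrightarrow> m - n \<in> M_lattice r a"
proof
  assume eq: "wt r a m = wt r a n"
  obtain \<zeta> :: complex where \<zeta>: "\<zeta> ^ r = 1" "\<And>i j. i < r \<Longrightarrow> j < r \<Longrightarrow> \<zeta> ^ i = \<zeta> ^ j \<Longrightarrow> i = j"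
    by (rule primitive_root_of_unity) iprover
  have "\<zeta> ^ nat (weight_exponent a m mod int r) = \<zeta> ^ nat (weight_exponent a n mod int r)"
    using eq by (simp flip: wt_diag[OF \<zeta>(1)])
  then have "nat (weight_exponent a m mod int r) = nat (weight_exponent a n mod int r)"
    by (rule \<zeta>(2)[rotated 2]) (use a in \<open>simp_all add: nat_less_iff\<close>)
  then have "weight_exponent a m mod int r = weight_exponent a n mod int r"
    using a by (simp add: eq_nat_nat_iff)
  then show "m - n \<in> M_lattice r a" by (simp add: M_lattice_iff weight_exponent_diff mod_eq_dvd_iff)
next
  assume "m - n \<in> M_lattice r a"
  then have mod: "weight_exponent a m mod int r = weight_exponent a n mod int r"
    by (simp add: M_lattice_iff weight_exponent_diff mod_eq_dvd_iff)
  show "wt r a m = wt r a n"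
  proof (rule extensionalityI)
    show "wt r a m \<in> extensional (G_group r a)" "wt r a n \<in> extensional (G_group r a)"
      by (simp_all add: wt_def)
  qed (auto simp: G_group_diag wt_diag mod)
qed

lemma wt_mem_G_dual: "wt r a m \<in> G_dual r a"
proof -
  have nz: "\<epsilon> \<noteq> 0" if "\<epsilon> ^ r = 1" for \<epsilon> :: complex using that a by (auto simp: power_0_left)
  have prod1: "(x * y) ^ r = 1" if "x ^ r = 1" "y ^ r = 1" for x y :: complex
    using that by (simp add: power_mult_distrib)
  show ?thesis
    unfolding G_dual_def mem_Collect_eq
  proof (intro conjI)
    show "wt r a m \<in> extensional (G_group r a)" by (simp add: wt_def)
  qed (auto simp: G_group_diag wt_diag diag_mult prod1 nz power_mult_distrib)
qed

text \<open>A character of the cyclic group G is determined by its value on a generator, which is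
  an r-th root of unity.\<close>

lemma G_dual_eq_wt:
  assumes \<rho>: "\<rho> \<in> G_dual r a"
  shows "\<exists>m. wt r a m = \<rho>"
proof -
  obtain \<zeta> :: complex where \<zeta>: "\<zeta> ^ r = 1" "\<And>\<epsilon>. \<epsilon> ^ r = 1 \<Longrightarrow> \<exists>j<r. \<epsilon> = \<zeta> ^ j"
    by (rule primitive_root_of_unity) iprover
  have G: "diag r a \<epsilon> \<in> G_group r a" if "\<epsilon> ^ r = 1" for \<epsilon> using that by (auto simp: G_group_diag)
  have \<zeta>k: "(\<zeta> ^ k) ^ r = 1" for k 
  proof -
    have "(\<zeta> ^ k) ^ r = (\<zeta> ^ r) ^ k" unfolding power_mult[symmetric] mult.commute[of k] ..
    then show ?thesis by (simp add: \<zeta>(1))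
  qed
  have mult: "\<rho> (diag r a (\<epsilon> * \<delta>)) = \<rho> (diag r a \<epsilon>) * \<rho> (diag r a \<delta>)"
    if "\<epsilon> ^ r = 1" "\<delta> ^ r = 1" for \<epsilon> \<delta>
    using \<rho> G[OF that(1)] G[OF that(2)] unfolding G_dual_def by (auto simp flip: diag_mult)
  have "\<rho> (diag r a 1) \<noteq> 0" using \<rho> G[of 1] by (auto simp: G_dual_def)
  then have one: "\<rho> (diag r a 1) = 1" using mult[of 1 1] by simp
  have pow: "\<rho> (diag r a (\<zeta> ^ k)) = \<rho> (diag r a \<zeta>) ^ k" for k
    by (induction k) (simp_all add: one mult[OF \<zeta>(1) \<zeta>k])
  have "\<rho> (diag r a \<zeta>) ^ r = 1" using pow[of r] \<zeta>(1) one by simp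
  then obtain j where j: "j < r" "\<rho> (diag r a \<zeta>) = \<zeta> ^ j" using \<zeta>(2) by blast
  have "wt r a (axis 1 (int j)) = \<rho>"
  proof (rule extensionalityI)
    show "wt r a (axis 1 (int j)) \<in> extensional (G_group r a)" by (simp add: wt_def)
    show "\<rho> \<in> extensional (G_group r a)" using \<rho> by (simp add: G_dual_def)
    fix g assume "g \<in> G_group r a"
    then obtain \<epsilon> where \<epsilon>: "\<epsilon> ^ r = 1" "g = diag r a \<epsilon>" by (auto simp: G_group_diag)
    then obtain k where k: "\<epsilon> = \<zeta> ^ k" using \<zeta>(2) by blast
    have "weight_exponent a (axis 1 (int j)) = int j" by (simp add: weight_exponent_def axis_def)
    then have "wt r a (axis 1 (int j)) g = \<epsilon> ^ j" using wt_diag[OF \<epsilon>(1)] \<epsilon>(2) j(1) by simp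
    also have "\<dots> = \<rho> g" by (simp add: \<epsilon>(2) k pow j(2) flip: power_mult) (simp add: mult.commute)
    finally show "wt r a (axis 1 (int j)) g = \<rho> g" .
  qed
  then show ?thesis by blast
qed

end

section \<open>Maps that lift steps\<close>

definition steps :: "(int^3) set \<Rightarrow> ((int^3) \<times> (int^3)) set" where
  "steps \<Gamma> = {(p, q). p \<in> \<Gamma> \<and> q \<in> \<Gamma> \<and> (\<exists>i. q = p + axis i 1 \<or> q = p - axis i 1)}"

lemma steps_mono: "\<Gamma> \<subseteq> \<Delta> \<Longrightarrow> (steps \<Gamma>)\<^sup>* \<subseteq> (steps \<Delta>)\<^sup>*"
  by (intro rtrancl_mono) (auto simp: steps_def)

lemma sym_steps: "sym ((steps \<Gamma>)\<^sup>*)"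
proof (intro sym_rtrancl symI)
  fix p q assume "(p, q) \<in> steps \<Gamma>"
  then obtain i where i: "p \<in> \<Gamma>" "q \<in> \<Gamma>" "q = p + axis i 1 \<or> q = p - axis i 1" by (auto simp: steps_def)
  then have "p = q - axis i 1 \<or> p = q + axis i 1" by auto
  with i show "(q, p) \<in> steps \<Gamma>" by (auto simp: steps_def)
qed

text \<open>The first condition makes the zero fibre connected. The second one makes every dual
  basis element a generator of the semigroup of the zero fibre; it implies surjectivity.\<close>

definition lifts_steps :: "(int^3 \<Rightarrow> int^3) \<Rightarrow> bool" where
  "lifts_steps \<phi> \<longleftrightarrow>
     (\<forall>m m'. \<phi> m = \<phi> m' \<longrightarrow> (m, m') \<in> (steps (\<phi> -` {\<phi> m}))\<^sup>*) \<and>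
     (\<forall>k i. \<exists>m j. \<phi> m = k \<and> \<phi> (m + axis j 1) = k + axis i 1)"

lemma lifts_steps_fibre: "lifts_steps \<phi> \<Longrightarrow> \<phi> m = k \<Longrightarrow> \<phi> m' = k \<Longrightarrow> (m, m') \<in> (steps (\<phi> -` {k}))\<^sup>*"
  unfolding lifts_steps_def by metis

lemma lifts_steps_step:
  assumes "lifts_steps \<phi>"
  obtains m j where "\<phi> m = k" "\<phi> (m + axis j 1) = k + axis i 1"
  using assms unfolding lifts_steps_def by blast

lemma lifts_steps_id: "lifts_steps (\<lambda>m. m)"
  by (auto simp: lifts_steps_def)

text \<open>A path in a fibre of g is lifted step by step. Consecutive lifted steps end and begin
  in the same fibre of \<phi>, where they are joined by a path.\<close>

lemma lifts_steps_comp: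
  assumes \<phi>: "lifts_steps \<phi>" and g: "lifts_steps g"
  shows "lifts_steps (\<lambda>m. g (\<phi> m))"
proof -
  have lift: "\<forall>m m'. \<phi> m = p \<longrightarrow> \<phi> m' = q \<longrightarrow> (m, m') \<in> (steps ((\<lambda>m. g (\<phi> m)) -` {k}))\<^sup>*"
    if "(p, q) \<in> (steps (g -` {k}))\<^sup>*" "g p = k" for p q k
    using that
  proof (induction rule: rtrancl_induct)
    case base
    then have "\<phi> -` {p} \<subseteq> (\<lambda>m. g (\<phi> m)) -` {k}" by auto
    then show ?case using lifts_steps_fibre[OF \<phi>] steps_mono by blast
  next
    case (step q q')
    have q: "g q = k" "g q' = k" using step.hyps(2) by (auto simp: steps_def)
    obtain n n' where n: "\<phi> n = q" "\<phi> n' = q'" "\<exists>j. n' = n + axis j 1 \<or> n' = n - axis j 1"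
    proof -
      obtain i where "q' = q + axis i 1 \<or> q' = q - axis i 1" using step.hyps(2) by (auto simp: steps_def)
      then show ?thesis
      proof
        assume "q' = q + axis i 1"
        moreover obtain m j where "\<phi> m = q" "\<phi> (m + axis j 1) = q + axis i 1"
          using lifts_steps_step[OF \<phi>] .
        ultimately show ?thesis using that[of m "m + axis j 1"] by blast
      next
        assume "q' = q - axis i 1"
        moreover obtain m j where "\<phi> m = q'" "\<phi> (m + axis j 1) = q' + axis i 1"
          using lifts_steps_step[OF \<phi>] .
        ultimately show ?thesis using that[of "m + axis j 1" m] by (metis add_diff_cancel_right' diff_add_cancel)
      qed
    qed
    have nn': "(n, n') \<in> steps ((\<lambda>m. g (\<phi> m)) -` {k})" using n q by (auto simp: steps_def)
    show ?case
    proof (intro allI impI)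
      fix m m' assume m: "\<phi> m = p" "\<phi> m' = q'"
      have "(m, n) \<in> (steps ((\<lambda>m. g (\<phi> m)) -` {k}))\<^sup>*" using step.IH step.prems m(1) n(1) by blast
      moreover have "\<phi> -` {q'} \<subseteq> (\<lambda>m. g (\<phi> m)) -` {k}" using q by auto
      then have "(n', m') \<in> (steps ((\<lambda>m. g (\<phi> m)) -` {k}))\<^sup>*"
        using lifts_steps_fibre[OF \<phi> n(2) m(2)] steps_mono by blast
      ultimately show "(m, m') \<in> (steps ((\<lambda>m. g (\<phi> m)) -` {k}))\<^sup>*"
        using nn' by (meson converse_rtrancl_into_rtrancl rtrancl_trans)
    qed
  qed
  show ?thesis
    unfolding lifts_steps_def
  proof (intro conjI allI impI)
    fix m m' assume "g (\<phi> m) = g (\<phi> m')"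
    then have "(\<phi> m, \<phi> m') \<in> (steps (g -` {g (\<phi> m)}))\<^sup>*" using lifts_steps_fibre[OF g] by simp
    from lift[OF this refl] show "(m, m') \<in> (steps ((\<lambda>m. g (\<phi> m)) -` {g (\<phi> m)}))\<^sup>*" by blast
  next
    fix k i
    obtain p j where p: "g p = k" "g (p + axis j 1) = k + axis i 1" using lifts_steps_step[OF g] .
    obtain m l where "\<phi> m = p" "\<phi> (m + axis l 1) = p + axis j 1" using lifts_steps_step[OF \<phi>] .
    with p show "\<exists>m j. g (\<phi> m) = k \<and> g (\<phi> (m + axis j 1)) = k + axis i 1"
      by (intro exI[of _ m] exI[of _ l]) simp
  qed
qed

text \<open>The new coordinate when the star subdivision at v = (\<Sum> c k u k) / w replaces the
  ray u i by v: the pairing with v in terms of the pairings with the u k, rounded down.\<close>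

definition round_down :: "3 \<Rightarrow> (3 \<Rightarrow> int) \<Rightarrow> int \<Rightarrow> int^3 \<Rightarrow> int^3" where
  "round_down i c w x = (\<chi> j. if j = i then (\<Sum>k\<in>UNIV. c k * x $ k) div w else x $ j)"

lemma sum_mult_add_axis: "(\<Sum>k\<in>UNIV. c k * (x + axis l t) $ k) = (\<Sum>k\<in>UNIV. c k * x $ k) + c l * (t::int)"
proof -
  have "(\<Sum>k\<in>UNIV. c k * (x + axis l t) $ k) = (\<Sum>k\<in>UNIV. c k * x $ k + (if k = l then c l * t else 0))"
    by (rule sum.cong) (auto simp: axis_def algebra_simps)
  then show ?thesis by (simp add: sum.distrib)
qed

context
  fixes i :: 3 and c :: "3 \<Rightarrow> int" and w :: int
  assumes c_pos: "\<And>k. 0 < c k" and c_le: "\<And>k. k \<noteq> i \<Longrightarrow> c i + c k \<le> w"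
begin

lemma w_bounds: "0 < w" "c i \<le> w"
proof -
  obtain k :: 3 where "k \<noteq> i" by (metis (full_types) exhaust_3 zero_neq_one num1_eq1 one_neq_zero)
  then show "0 < w" "c i \<le> w" using c_pos[of k] c_pos[of i] c_le[of k] by linarith+
qed

text \<open>Fix all coordinates but the i-th. As that one grows, the linear form grows by c i
  \<le> w in each step, so every integer is the rounded value on a nonempty interval of arguments,
  and the step out of an interval raises the rounded value by one. For a step in another
  coordinate k start from the smallest argument of the interval: there the remainder modulo w is
  below c i, so adding c k \<le> w - c i does not change the rounded value.\<close>

lemma lifts_steps_round_down: "lifts_steps (round_down i c w)"
proof -
  let ?g = "round_down i c w" and ?s = "\<lambda>x. \<Sum>k\<in>UNIV. c k * x $ k"
  have g_i: "?g x $ i = ?s x div w" for x by (simp add: round_down_def)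
  have g_j: "?g x $ j = x $ j" if "j \<noteq> i" for x j using that by (simp add: round_down_def)
  have up: "(x, x + axis i (int n)) \<in> (steps (?g -` {?g x}))\<^sup>*" if "?g (x + axis i (int n)) = ?g x" for x n
    using that
  proof (induction n)
    case (Suc n)
    let ?y = "x + axis i (int n)"
    have Suc_y: "x + axis i (int (Suc n)) = ?y + axis i 1"
      by (simp add: vec_eq_iff axis_def)
    have "?s x div w \<le> ?s ?y div w" "?s ?y div w \<le> ?s (?y + axis i 1) div w"
      using w_bounds(1) c_pos[of i] by (auto intro!: zdiv_mono1 simp del: vector_add_component simp: sum_mult_add_axis)
    moreover have "?s (?y + axis i 1) div w = ?s x div w"
      using arg_cong[OF Suc.prems, of "\<lambda>v. v $ i"] unfolding Suc_y g_i .
    ultimately have "?g ?y $ i = ?g x $ i" unfolding g_i by simp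
    moreover have "?g ?y $ j = ?g x $ j" if "j \<noteq> i" for j using that by (simp add: g_j axis_def)
    ultimately have y: "?g ?y = ?g x" by (metis vec_eq_iff)
    then have "(?y, ?y + axis i 1) \<in> steps (?g -` {?g x})" using Suc.prems unfolding Suc_y by (auto simp: steps_def)
    then show ?case using Suc.IH[OF y] unfolding Suc_y by (rule rtrancl_into_rtrancl[rotated])
  qed (simp add: axis_def vec_eq_iff flip: zero_vec_def)
  have le: "(x, y) \<in> (steps (?g -` {?g x}))\<^sup>*" if "?g x = ?g y" "x $ i \<le> y $ i" for x y
  proof -
    have "x $ j = y $ j" if "j \<noteq> i" for j using g_j[OF that, of x] g_j[OF that, of y] \<open>?g x = ?g y\<close> by simp
    then have "y = x + axis i (int (nat (y $ i - x $ i)))"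
      using that(2) by (auto simp: vec_eq_iff axis_def)
    then show ?thesis using up[of x "nat (y $ i - x $ i)"] that(1) by simp
  qed
  show ?thesis
    unfolding lifts_steps_def
  proof (intro conjI allI impI)
    fix x y assume eq: "?g x = ?g y"
    show "(x, y) \<in> (steps (?g -` {?g x}))\<^sup>*"
    proof (cases "x $ i \<le> y $ i")
      case False
      then have "(y, x) \<in> (steps (?g -` {?g y}))\<^sup>*" using le[of y x] eq by simp
      then show ?thesis using sym_steps eq by (metis symD)
    qed (rule le[OF eq])
  next
    fix K :: "int^3" and l
    define N where "N = (\<Sum>k\<in>UNIV - {i}. c k * K $ k)"
    define point where "point t = (\<chi> j. if j = i then t else K $ j)" for t :: int
    have s: "?s (point t) = N + c i * t" for t
    proof -
      have "?s (point t) = c i * t + (\<Sum>k\<in>UNIV - {i}. c k * point t $ k)"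
        by (subst sum.remove[of _ i]) (auto simp: point_def)
      also have "(\<Sum>k\<in>UNIV - {i}. c k * point t $ k) = N"
        unfolding N_def by (rule sum.cong) (auto simp: point_def)
      finally show ?thesis by simp
    qed
    have div_eq: "x div w = q" if "q * w \<le> x" "x < q * w + w" for x q
      using that by (intro int_div_pos_eq[of x w q "x - q * w"]) (simp_all add: algebra_simps)
    have g_eq: "?g x = v" if "?s x div w = v $ i" "\<And>j. j \<noteq> i \<Longrightarrow> x $ j = v $ j" for x v
      using that by (auto simp: vec_eq_iff round_down_def)
    have c_i: "0 < c i" "c i \<le> w" using c_pos w_bounds by blast+
    show "\<exists>m j. ?g m = K \<and> ?g (m + axis j 1) = K + axis l 1"
    proof (cases "l = i")
      case True
      \<comment> \<open>the largest value of the coordinate that stays in the fibre\<close>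
      define A where "A = (K $ i + 1) * w - 1 - N"
      define t where "t = A div c i"
      define \<mu> where "\<mu> = A mod c i"
      have A: "c i * t = A - \<mu>" by (simp add: t_def \<mu>_def minus_mod_eq_mult_div)
      have mod: "0 \<le> \<mu>" "\<mu> < c i" using c_i by (simp_all add: \<mu>_def)
      have "?g (point t) = K"
      proof (rule g_eq)
        show "?s (point t) div w = K $ i"
          by (rule div_eq) (use mod c_i in \<open>simp_all add: s A, simp_all add: A_def algebra_simps\<close>)
      qed (simp add: point_def)
      moreover have "?g (point t + axis i 1) = K + axis i 1"
      proof (rule g_eq)
        have "?s (point t + axis i 1) div w = K $ i + 1"
          by (rule div_eq) (use mod c_i in \<open>simp_all only: sum_mult_add_axis s A, simp_all add: A_def algebra_simps\<close>)
        then show "?s (point t + axis i 1) div w = (K + axis i 1) $ i" by (simp add: axis_def)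
      qed (simp add: point_def axis_def)
      ultimately show ?thesis using True by blast
    next
      case False
      \<comment> \<open>the smallest value of the coordinate in the fibre\<close>
      define A where "A = N - K $ i * w"
      define t where "t = - (A div c i)"
      define \<mu> where "\<mu> = A mod c i"
      have A: "c i * t = \<mu> - A" by (simp add: t_def \<mu>_def minus_mult_div_eq_mod[symmetric])
      have mod: "0 \<le> \<mu>" "\<mu> < c i" using c_i by (simp_all add: \<mu>_def)
      have "?g (point t) = K"
      proof (rule g_eq)
        show "?s (point t) div w = K $ i"
          by (rule div_eq) (use mod c_i in \<open>simp_all add: s A, simp_all add: A_def algebra_simps\<close>)
      qed (simp add: point_def)
      moreover have "?g (point t + axis l 1) = K + axis l 1"
      proof (rule g_eq)
        have "?s (point t + axis l 1) div w = K $ i"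
          by (rule div_eq) (use mod c_pos[of l] c_le[OF False] in
              \<open>simp_all only: sum_mult_add_axis s A, simp_all add: A_def algebra_simps\<close>)
        then show "?s (point t + axis l 1) div w = (K + axis l 1) $ i" using False by (simp add: axis_def)
      qed (simp add: point_def axis_def)
      ultimately show ?thesis by blast
    qed
  qed
qed

end

text \<open>The components of \<phi> are substitutes for the rational pairings with the rays u i:
  they are integral, and they agree with the pairings as far as translations by M are
  concerned.\<close>

definition ray_coordinates :: "nat \<Rightarrow> nat \<Rightarrow> real^3^3 \<Rightarrow> (int^3 \<Rightarrow> int^3) \<Rightarrow> bool" where
  "ray_coordinates r a u \<phi> \<longleftrightarrow> \<phi> 0 = 0 \<and> (\<forall>m n. 0 \<le> n \<longrightarrow> \<phi> m \<le> \<phi> (n + m)) \<and>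
     (\<forall>m. \<forall>l\<in>M_lattice r a. \<forall>i. real_of_int (\<phi> (m + l) $ i) = \<phi> m $ i + rvec l \<bullet> u $ i) \<and>
     lifts_steps \<phi>"

lemma ray_coordinates_orthant: "ray_coordinates r a (\<chi> i. axis i 1) (\<lambda>m. m)"
  by (simp add: ray_coordinates_def lifts_steps_id inner_axis rvec_def less_eq_vec_def)

text \<open>Translation by l \<in> M changes the linear form by w times the integer pairing of l
  with v, so the rounding does not interfere.\<close>

lemma ray_coordinates_star:
  assumes \<phi>: "ray_coordinates r a u \<phi>"
    and c_pos: "\<And>k. 0 < c k" and c_le: "\<And>k. k \<noteq> i \<Longrightarrow> c i + c k \<le> w"
    and v: "v \<in> L_lattice r a" "of_int w *\<^sub>R v = (\<Sum>k\<in>UNIV. of_int (c k) *\<^sub>R u $ k)"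
  shows "ray_coordinates r a (\<chi> j. if j = i then v else u $ j) (\<lambda>m. round_down i c w (\<phi> m))"
  unfolding ray_coordinates_def
proof (intro conjI allI impI ballI)
  have w: "0 < w" using w_bounds(1)[where c = c and i = i and w = w] c_pos c_le by blast
  show "round_down i c w (\<phi> 0) = 0"
    using \<phi> by (simp add: ray_coordinates_def round_down_def vec_eq_iff)
  show "lifts_steps (\<lambda>m. round_down i c w (\<phi> m))"
    using \<phi> lifts_steps_comp[OF _ lifts_steps_round_down[where c = c and i = i and w = w]] c_pos c_le
    by (simp add: ray_coordinates_def)
  fix m
  show "round_down i c w (\<phi> m) \<le> round_down i c w (\<phi> (n + m))" if "0 \<le> n" for n
  proof -
    have le: "\<phi> m $ k \<le> \<phi> (n + m) $ k" for k
      using \<phi> that by (simp add: ray_coordinates_def less_eq_vec_def)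
    then have "(\<Sum>k\<in>UNIV. c k * \<phi> m $ k) \<le> (\<Sum>k\<in>UNIV. c k * \<phi> (n + m) $ k)"
      by (intro sum_mono mult_left_mono) (use less_imp_le[OF c_pos] in auto)
    then show ?thesis using le w by (auto simp: less_eq_vec_def round_down_def intro: zdiv_mono1)
  qed
  fix l j assume l: "l \<in> M_lattice r a"
  have add: "real_of_int (\<phi> (m + l) $ k) = \<phi> m $ k + rvec l \<bullet> u $ k" for k
    using \<phi> l by (simp add: ray_coordinates_def)
  show "real_of_int (round_down i c w (\<phi> (m + l)) $ j)
      = round_down i c w (\<phi> m) $ j + rvec l \<bullet> (\<chi> j. if j = i then v else u $ j) $ j"
  proof (cases "j = i")
    case True
    have "rvec l \<bullet> v \<in> \<int>" using l v(1) by (simp add: M_lattice_def)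
    then obtain z where z: "rvec l \<bullet> v = of_int z" by (auto simp: Ints_def)
    have "real_of_int (\<Sum>k\<in>UNIV. c k * \<phi> (m + l) $ k)
        = real_of_int (\<Sum>k\<in>UNIV. c k * \<phi> m $ k) + rvec l \<bullet> (\<Sum>k\<in>UNIV. of_int (c k) *\<^sub>R u $ k)"
      by (simp add: add distrib_left sum.distrib inner_sum_right)
    also have "\<dots> = real_of_int ((\<Sum>k\<in>UNIV. c k * \<phi> m $ k) + w * z)"
      by (simp flip: v(2) add: z)
    finally have "(\<Sum>k\<in>UNIV. c k * \<phi> (m + l) $ k) = (\<Sum>k\<in>UNIV. c k * \<phi> m $ k) + w * z"
      by (simp only: of_int_eq_iff)
    then show ?thesis using True w by (simp add: round_down_def z)
  qed (simp add: round_down_def add)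
qed

section \<open>Bricks of unimodular cones\<close>

locale unimodular_cone =
  fixes r a :: nat and u :: "real^3^3" and d :: "int^3^3"
  assumes a: "1 \<le> a" "a < r"
    and dual_mem: "d $ i \<in> M_lattice r a"
    and ray_mem: "u $ i \<in> L_lattice r a"
    and dual: "rvec (d $ i) \<bullet> u $ j = (if i = j then 1 else 0)"
begin

abbreviation "\<sigma> \<equiv> convex_cone hull (range (\<lambda>i. u $ i))"

lemma rvec_add: "rvec (m + n) = rvec m + rvec n"
  and rvec_diff: "rvec (m - n) = rvec m - rvec n"
  and rvec_zero: "rvec 0 = 0"
  by (simp_all add: rvec_def vec_eq_iff)

text \<open>A left inverse of a square matrix is also a right inverse.\<close>

lemma expand:
  "x = (\<Sum>i\<in>UNIV. (x \<bullet> u $ i) *\<^sub>R rvec (d $ i))"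
  "x = (\<Sum>i\<in>UNIV. (rvec (d $ i) \<bullet> x) *\<^sub>R u $ i)"
proof -
  define D :: "real^3^3" where "D = (\<chi> i. rvec (d $ i))"
  have "D ** transpose u = mat 1"
    using dual by (auto simp: vec_eq_iff matrix_matrix_mult_def transpose_def D_def mat_def inner_vec_def)
  then have "transpose u ** D = mat 1" by (simp only: matrix_left_right_inverse)
  then have entry: "(\<Sum>k\<in>UNIV. u $ k $ p * D $ k $ q) = (if p = q then 1 else 0)" for p q
    by (auto simp: vec_eq_iff matrix_matrix_mult_def transpose_def mat_def)
  have "(\<Sum>i\<in>UNIV. (x \<bullet> u $ i) *\<^sub>R rvec (d $ i)) $ q = x $ q" for q
  proof -
    have "(\<Sum>i\<in>UNIV. (x \<bullet> u $ i) *\<^sub>R rvec (d $ i)) $ q = (\<Sum>i\<in>UNIV. \<Sum>p\<in>UNIV. x $ p * (u $ i $ p * D $ i $ q))"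
      by (simp add: inner_vec_def sum_distrib_right D_def mult.assoc)
    also have "\<dots> = (\<Sum>p\<in>UNIV. x $ p * (\<Sum>i\<in>UNIV. u $ i $ p * D $ i $ q))"
      by (subst sum.swap) (simp add: sum_distrib_left)
    also have "\<dots> = x $ q" by (simp add: entry if_distrib cong: if_cong)
    finally show ?thesis .
  qed
  then show "x = (\<Sum>i\<in>UNIV. (x \<bullet> u $ i) *\<^sub>R rvec (d $ i))" unfolding vec_eq_iff by simp
  have "(\<Sum>i\<in>UNIV. (rvec (d $ i) \<bullet> x) *\<^sub>R u $ i) $ p = x $ p" for p
  proof -
    have "(\<Sum>i\<in>UNIV. (rvec (d $ i) \<bullet> x) *\<^sub>R u $ i) $ p = (\<Sum>i\<in>UNIV. \<Sum>q\<in>UNIV. x $ q * (u $ i $ p * D $ i $ q))"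
      by (simp add: inner_vec_def sum_distrib_right sum_distrib_left D_def ac_simps)
    also have "\<dots> = (\<Sum>q\<in>UNIV. x $ q * (\<Sum>i\<in>UNIV. u $ i $ p * D $ i $ q))"
      by (subst sum.swap) (simp add: sum_distrib_left)
    also have "\<dots> = x $ p" by (simp add: entry if_distrib cong: if_cong)
    finally show ?thesis .
  qed
  then show "x = (\<Sum>i\<in>UNIV. (rvec (d $ i) \<bullet> x) *\<^sub>R u $ i)" unfolding vec_eq_iff by simp
qed

lemma eq_if_pairings_eq:
  assumes "\<And>i. rvec m \<bullet> u $ i = rvec n \<bullet> u $ i"
  shows "m = n"
proof -
  have "rvec m = (\<Sum>i\<in>UNIV. (rvec n \<bullet> u $ i) *\<^sub>R rvec (d $ i))"
    using expand(1)[of "rvec m"] unfolding assms .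
  then have "rvec m = rvec n" using expand(1)[of "rvec n"] by (rule trans[OF _ sym])
  then show ?thesis by (simp add: rvec_def vec_eq_iff)
qed

lemma cone_semigroup_iff:
  "m \<in> cone_semigroup r a \<sigma> \<longleftrightarrow> m \<in> M_lattice r a \<and> (\<forall>i. 0 \<le> rvec m \<bullet> u $ i)"
proof -
  have "rvec m \<in> dual_cone \<sigma> \<longleftrightarrow> (\<forall>i. 0 \<le> rvec m \<bullet> u $ i)"
  proof
    assume "rvec m \<in> dual_cone \<sigma>"
    then show "\<forall>i. 0 \<le> rvec m \<bullet> u $ i" unfolding dual_cone_def by (auto intro: hull_inc)
  next
    assume "\<forall>i. 0 \<le> rvec m \<bullet> u $ i"
    then have "range (\<lambda>i. u $ i) \<subseteq> {x. rvec m \<bullet> x \<ge> 0}" by auto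
    then have "\<sigma> \<subseteq> {x. rvec m \<bullet> x \<ge> 0}" by (rule hull_minimal) (rule convex_cone_halfspace_ge)
    then show "rvec m \<in> dual_cone \<sigma>" by (auto simp: dual_cone_def)
  qed
  then show ?thesis by (simp add: cone_semigroup_def)
qed

text \<open>Recovers the cone from its semigroup; therefore different cones have different
  bricks.\<close>

lemma cone_eq_dual_of_semigroup: "\<sigma> = {x. \<forall>m\<in>cone_semigroup r a \<sigma>. 0 \<le> rvec m \<bullet> x}"
proof (intro subset_antisym subsetI)
  fix x assume "x \<in> {x. \<forall>m\<in>cone_semigroup r a \<sigma>. 0 \<le> rvec m \<bullet> x}"
  moreover have "d $ i \<in> cone_semigroup r a \<sigma>" for i
    by (simp add: cone_semigroup_iff dual_mem dual)
  ultimately have "0 \<le> rvec (d $ i) \<bullet> x" for i by blast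
  then have "(rvec (d $ i) \<bullet> x) *\<^sub>R u $ i \<in> \<sigma>" for i
    by (intro convex_cone_scaleR convex_cone_convex_cone_hull hull_inc) auto
  then have "(\<Sum>i\<in>UNIV. (rvec (d $ i) \<bullet> x) *\<^sub>R u $ i) \<in> \<sigma>"
    unfolding sum_3 by (intro convex_cone_add[OF convex_cone_convex_cone_hull]) auto
  then show "x \<in> \<sigma>" using expand(2)[of x] by simp
qed (auto simp: cone_semigroup_def dual_cone_def)

lemma pairing_int:
  assumes "m \<in> M_lattice r a"
  shows "rvec m \<bullet> u $ i = of_int \<lfloor>rvec m \<bullet> u $ i\<rfloor>"
proof -
  have "rvec m \<bullet> u $ i \<in> \<int>" using assms ray_mem by (auto simp: M_lattice_def)
  then show ?thesis by (auto simp: Ints_def)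
qed

sublocale free_monoid3 "cone_semigroup r a \<sigma>" "\<lambda>i. d $ i" "\<lambda>i m. nat \<lfloor>rvec m \<bullet> u $ i\<rfloor>"
proof
  let ?S = "cone_semigroup r a \<sigma>"
  note M = M_lattice_closed[OF a]
  show "0 \<in> ?S" by (simp add: cone_semigroup_iff M rvec_zero)
  show "s + t \<in> ?S" if "s \<in> ?S" "t \<in> ?S" for s t
    using that by (simp add: cone_semigroup_iff M rvec_add inner_add_left)
  show "d $ i \<in> ?S" for i by (simp add: cone_semigroup_iff dual_mem dual)
  show "nat \<lfloor>rvec (s + t) \<bullet> u $ i\<rfloor> = nat \<lfloor>rvec s \<bullet> u $ i\<rfloor> + nat \<lfloor>rvec t \<bullet> u $ i\<rfloor>"
    if "s \<in> ?S" "t \<in> ?S" for s t i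
  proof -
    have st: "s \<in> M_lattice r a" "0 \<le> rvec s \<bullet> u $ i" "t \<in> M_lattice r a" "0 \<le> rvec t \<bullet> u $ i"
      using that by (auto simp: cone_semigroup_iff)
    have "rvec (s + t) \<bullet> u $ i = of_int (\<lfloor>rvec s \<bullet> u $ i\<rfloor> + \<lfloor>rvec t \<bullet> u $ i\<rfloor>)"
      by (subst of_int_add, subst (1 2) pairing_int[symmetric]) (use st in \<open>simp_all add: rvec_add inner_add_left\<close>)
    then show ?thesis using st by (simp add: nat_add_distrib)
  qed
  show "nat \<lfloor>rvec (d $ j) \<bullet> u $ i\<rfloor> = (if i = j then 1 else 0)" for i j
    by (simp add: dual)
  show "s = t" if st: "s \<in> ?S" "t \<in> ?S" and eq: "\<And>i. nat \<lfloor>rvec s \<bullet> u $ i\<rfloor> = nat \<lfloor>rvec t \<bullet> u $ i\<rfloor>" for s t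
  proof (rule eq_if_pairings_eq)
    fix i
    have "\<lfloor>rvec s \<bullet> u $ i\<rfloor> = \<lfloor>rvec t \<bullet> u $ i\<rfloor>"
      using eq[of i] st by (simp add: cone_semigroup_iff eq_nat_nat_iff)
    then show "rvec s \<bullet> u $ i = rvec t \<bullet> u $ i"
      using pairing_int[of s i] pairing_int[of t i] st by (simp add: cone_semigroup_iff)
  qed
  show "s - d $ i \<in> ?S" if s: "s \<in> ?S" and pos: "0 < nat \<lfloor>rvec s \<bullet> u $ i\<rfloor>" for s i
  proof -
    have "1 \<le> rvec s \<bullet> u $ i" using pos by linarith
    then show ?thesis using s
      by (auto simp: cone_semigroup_iff M dual_mem rvec_diff inner_diff_left dual)
  qed
qed

definition combination :: "int^3 \<Rightarrow> int^3" where
  "combination z = (\<Sum>i\<in>UNIV. z $ i *s d $ i)"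

lemma combination_mem: "combination z \<in> M_lattice r a"
proof -
  have scale: "c *s m \<in> M_lattice r a" if "m \<in> M_lattice r a" for c m
    using that a by (simp add: M_lattice_iff[OF a] weight_exponent_def)
      (metis dvd_mult distrib_left right_diff_distrib mult.left_commute)
  then show ?thesis unfolding combination_def sum_3 by (intro M_lattice_closed(2)[OF a] scale dual_mem)
qed

lemma pairing_combination: "rvec (combination z) \<bullet> u $ j = of_int (z $ j)"
proof -
  have "rvec (combination z) = (\<Sum>i\<in>UNIV. of_int (z $ i) *\<^sub>R rvec (d $ i))"
    by (simp add: vec_eq_iff rvec_def combination_def)
  then show ?thesis by (simp add: inner_sum_left dual if_distrib cong: if_cong)
qed

lemma combination_axis: "combination (axis i 1) = d $ i"
  by (rule eq_if_pairings_eq) (simp add: pairing_combination dual axis_def eq_commute)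

lemma combination_zero: "combination 0 = 0"
  by (simp add: combination_def)

context
  fixes \<phi> :: "int^3 \<Rightarrow> int^3"
  assumes \<phi>: "ray_coordinates r a u \<phi>"
begin

abbreviation "\<Gamma> \<equiv> \<phi> -` {0}"

lemma coordinates_add: "l \<in> M_lattice r a \<Longrightarrow> real_of_int (\<phi> (m + l) $ i) = \<phi> m $ i + rvec l \<bullet> u $ i"
  using \<phi> by (simp add: ray_coordinates_def)

lemma coordinates_mono: "0 \<le> n \<Longrightarrow> \<phi> m \<le> \<phi> (n + m)"
  using \<phi> by (simp add: ray_coordinates_def)

lemma coordinates_zero: "\<phi> 0 = 0"
  using \<phi> by (simp add: ray_coordinates_def)

lemma coordinates_lift: "lifts_steps \<phi>"
  using \<phi> by (simp add: ray_coordinates_def)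

text \<open>Subtracting the combination is a translation by an element of M, and makes all
  coordinates zero.\<close>

lemma representative: "m - combination (\<phi> m) \<in> \<Gamma>" "wt r a (m - combination (\<phi> m)) = wt r a m"
proof -
  have neg: "- combination z \<in> M_lattice r a" for z
    using M_lattice_closed(3)[OF a M_lattice_closed(1)[OF a] combination_mem[of z]] by simp
  have "real_of_int (\<phi> (m + - combination (\<phi> m)) $ i) = 0" for i
    by (subst coordinates_add[OF neg])
       (use rvec_diff[of 0 "combination (\<phi> m)"] in \<open>simp add: rvec_zero pairing_combination\<close>)
  then show "m - combination (\<phi> m) \<in> \<Gamma>" by (simp add: vec_eq_iff)
  show "wt r a (m - combination (\<phi> m)) = wt r a m"
    by (simp add: wt_eq_iff[OF a] neg)
qed

lemma representative_unique:
  assumes "m \<in> \<Gamma>" "n \<in> \<Gamma>" "wt r a m = wt r a n"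
  shows "m = n"
proof (rule eq_if_pairings_eq)
  fix i
  have "m - n \<in> M_lattice r a" using assms(3) by (simp add: wt_eq_iff[OF a])
  from coordinates_add[OF this, of n i] assms(1,2)
  show "rvec m \<bullet> u $ i = rvec n \<bullet> u $ i" by (simp add: rvec_diff inner_diff_left)
qed

lemma wt_in_eq: "wt_in r a \<Gamma> m = m - combination (\<phi> m)"
  unfolding wt_in_def
  by (rule the_equality) (use representative representative_unique in metis)+

lemma G_prebrick_fibre: "G_prebrick r a \<Gamma>"
  unfolding G_prebrick_def
proof (intro conjI allI impI ballI)
  show "0 \<in> \<Gamma>" by (simp add: coordinates_zero)
  show "bij_betw (wt r a) \<Gamma> (G_dual r a)"
    unfolding bij_betw_def
  proof
    show "inj_on (wt r a) \<Gamma>" using representative_unique by (auto intro: inj_onI)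
    show "wt r a ` \<Gamma> = G_dual r a"
    proof
      show "wt r a ` \<Gamma> \<subseteq> G_dual r a" using wt_mem_G_dual[OF a] by blast
      show "G_dual r a \<subseteq> wt r a ` \<Gamma>"
        using G_dual_eq_wt[OF a] representative by (metis image_eqI subsetI)
    qed
  qed
  show "n + m \<in> \<Gamma>" if "m \<in> \<Gamma>" "0 \<le> n" "0 \<le> n'" "n' + n + m \<in> \<Gamma>" for m n n'
    using coordinates_mono[OF that(2), of m] coordinates_mono[OF that(3), of "n + m"] that
    by (simp add: add.assoc)
  fix m assume "m \<in> \<Gamma>"
  then show "(m, 0) \<in> {(p, q). p \<in> \<Gamma> \<and> q \<in> \<Gamma> \<and> (\<exists>i. q = p + axis i 1 \<or> q = p - axis i 1)}\<^sup>*"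
    using lifts_steps_fibre[OF coordinates_lift, of m 0 0] coordinates_zero by (simp add: steps_def)
qed

text \<open>By monotonicity the coordinates of a generator of the semigroup in the dual basis are
  nonnegative. Conversely, the lift of the step from 0 to the i-th unit vector makes d i a
  generator.\<close>

lemma S_semigroup_fibre: "S_semigroup r a \<Gamma> = cone_semigroup r a \<sigma>"
proof (intro subset_antisym subsetI)
  fix s assume "s \<in> S_semigroup r a \<Gamma>"
  then show "s \<in> cone_semigroup r a \<sigma>"
  proof induction
    case (gen n m)
    have "0 \<le> \<phi> (n + m)" using coordinates_mono[OF gen(1), of m] gen(2) by simp
    then show ?case
      by (simp add: wt_in_eq cone_semigroup_iff combination_mem pairing_combination less_eq_vec_def)
  qed (rule add_mem)
next
  fix s assume "s \<in> cone_semigroup r a \<sigma>"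
  then show "s \<in> S_semigroup r a \<Gamma>"
  proof (induction rule: monoid_induct)
    case zero
    then show ?case
      using S_semigroup.gen[of 0 0 \<Gamma> r a] by (simp add: wt_in_eq coordinates_zero combination_zero)
  next
    case (gen i s)
    obtain m j where m: "\<phi> m = 0" "\<phi> (m + axis j 1) = 0 + axis i 1"
      using lifts_steps_step[OF coordinates_lift] .
    have "axis j 1 + m - wt_in r a \<Gamma> (axis j 1 + m) \<in> S_semigroup r a \<Gamma>"
      by (rule S_semigroup.gen) (use m in \<open>simp_all add: less_eq_vec_def axis_def\<close>)
    then have "d $ i \<in> S_semigroup r a \<Gamma>"
      using m by (simp add: wt_in_eq combination_axis add.commute)
    then show ?case using gen(2) by (rule S_semigroup.add)
  qed
qed

lemma lookup_torus_act: "Poly_Mapping.lookup (torus_act t f) s = t s * Poly_Mapping.lookup f s"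
  by (simp add: torus_act_def mapp.rep_eq in_keys_iff when_def)

lemma G_brick_fibre: "G_brick r a \<Gamma>"
  unfolding G_brick_def
proof (intro conjI exI ballI)
  let ?P = "{f \<in> A. Poly_Mapping.lookup f 0 = 0}"
  show "G_prebrick r a \<Gamma>" by (rule G_prebrick_fibre)
  show "maximalideal ?P (semigroup_algebra (S_semigroup r a \<Gamma>))"
    unfolding S_semigroup_fibre by (rule maximal_vanishing_origin)
  fix t assume t: "t \<in> torus r a"
  have nz: "t s \<noteq> 0" if "s \<in> cone_semigroup r a \<sigma>" for s
    using t that by (simp add: torus_def cone_semigroup_iff)
  have act: "torus_act t' f \<in> ?P" if "f \<in> ?P" for t' f
    using that by (auto simp: lookup_torus_act in_keys_iff)
  show "torus_act t ` ?P = ?P"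
  proof
    show "torus_act t ` ?P \<subseteq> ?P" using act by blast
    show "?P \<subseteq> torus_act t ` ?P"
    proof
      fix f assume f: "f \<in> ?P"
      have "f = torus_act t (torus_act (\<lambda>s. 1 / t s) f)"
      proof (rule poly_mapping_eqI)
        fix s
        show "Poly_Mapping.lookup f s = Poly_Mapping.lookup (torus_act t (torus_act (\<lambda>s. 1 / t s) f)) s"
          using f nz[of s] by (cases "s \<in> cone_semigroup r a \<sigma>") (auto simp: lookup_torus_act in_keys_iff)
      qed
      then show "f \<in> torus_act t ` ?P" using act[OF f] by blast
    qed
  qed
qed

end

end

section \<open>Faces of the orthant and star subdivisions\<close>

lemma cone_bound:
  assumes "\<And>t. t \<in> T \<Longrightarrow> 0 \<le> m \<bullet> t" "x \<in> convex_cone hull T"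
  shows "0 \<le> (m :: real^3) \<bullet> x"
proof -
  have "T \<subseteq> {x. m \<bullet> x \<ge> 0}" using assms(1) by auto
  then have "convex_cone hull T \<subseteq> {x. m \<bullet> x \<ge> 0}" by (rule hull_minimal) (rule convex_cone_halfspace_ge)
  then show ?thesis using assms(2) by auto
qed

definition coordinate_cone :: "3 set \<Rightarrow> (real^3) set" where
  "coordinate_cone I = {x. \<forall>i. 0 \<le> x $ i \<and> (i \<notin> I \<longrightarrow> x $ i = 0)}"

lemma cone_hull_axes: "convex_cone hull ((\<lambda>i. axis i 1) ` I) = coordinate_cone I"
proof
  show "convex_cone hull ((\<lambda>i. axis i 1) ` I) \<subseteq> coordinate_cone I"
    by (rule hull_minimal) (auto simp: convex_cone_iff coordinate_cone_def axis_def)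
  show "coordinate_cone I \<subseteq> convex_cone hull ((\<lambda>i. axis i 1) ` I)"
  proof
    fix x assume x: "x \<in> coordinate_cone I"
    have mem: "x $ i *\<^sub>R axis i 1 \<in> convex_cone hull ((\<lambda>i. axis i 1) ` I)" for i
    proof (cases "i \<in> I")
      case True
      then show ?thesis using x
        by (intro convex_cone_scaleR convex_cone_convex_cone_hull hull_inc) (auto simp: coordinate_cone_def)
    next
      case False
      then show ?thesis using x by (simp add: coordinate_cone_def convex_cone_hull_contains_0)
    qed
    have "x = (\<Sum>i\<in>UNIV. x $ i *\<^sub>R axis i 1)" by (simp add: vec_eq_iff axis_def if_distrib cong: if_cong)
    also have "\<dots> \<in> convex_cone hull ((\<lambda>i. axis i 1) ` I)"
      unfolding sum_3 by (intro convex_cone_add[OF convex_cone_convex_cone_hull] mem)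
    finally show "x \<in> convex_cone hull ((\<lambda>i. axis i 1) ` I)" .
  qed
qed

lemma face_of_orthant: "coordinate_cone I face_of coordinate_cone UNIV"
  unfolding face_of_def
proof (intro conjI ballI impI)
  show "convex (coordinate_cone I)"
    unfolding cone_hull_axes[symmetric] by (rule convex_convex_cone_hull)
  fix x y z
  assume xy: "x \<in> coordinate_cone UNIV" "y \<in> coordinate_cone UNIV" and z: "z \<in> coordinate_cone I"
    and seg: "z \<in> open_segment x y"
  obtain t where t: "0 < t" "t < 1" "z = (1 - t) *\<^sub>R x + t *\<^sub>R y" using seg by (auto simp: in_segment)
  have "x $ i = 0 \<and> y $ i = 0" if "i \<notin> I" for i
  proof -
    have "(1 - t) * x $ i + t * y $ i = 0" using z that by (simp add: coordinate_cone_def t(3))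
    moreover have "0 \<le> (1 - t) * x $ i" "0 \<le> t * y $ i" using xy t by (simp_all add: coordinate_cone_def)
    ultimately have "(1 - t) * x $ i = 0" "t * y $ i = 0" by linarith+
    then show ?thesis using t by simp
  qed
  then show "x \<in> coordinate_cone I" "y \<in> coordinate_cone I" using xy by (auto simp: coordinate_cone_def)
qed (auto simp: coordinate_cone_def)

text \<open>Let I be the set of coordinates that are positive somewhere on F. Averaging gives a
  point z of F at which all of them are positive. Every other point of the coordinate cone of I is
  an end point of a segment in the orthant with z in its interior.\<close>

lemma face_of_orthant_eq:
  assumes F: "F face_of coordinate_cone UNIV" "F \<noteq> {}"
  shows "\<exists>I. F = coordinate_cone I"
proof -
  define I where "I = {i. \<exists>x\<in>F. 0 < x $ i}"
  have FC: "F \<subseteq> coordinate_cone UNIV" and "convex F" using F(1) by (auto simp: face_of_def)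
  have sub: "F \<subseteq> coordinate_cone I"
    using FC by (force simp: coordinate_cone_def I_def order.order_iff_strict)
  have "\<forall>i\<in>I. \<exists>x. x \<in> F \<and> 0 < x $ i" by (auto simp: I_def)
  from bchoice[OF this] obtain p where p: "\<And>i. i \<in> I \<Longrightarrow> p i \<in> F \<and> 0 < p i $ i" by blast
  obtain z where z: "z \<in> F" "\<And>i. i \<in> I \<Longrightarrow> 0 < z $ i"
  proof (cases "I = {}")
    case True
    then show ?thesis using that F(2) by blast
  next
    case False
    let ?z = "\<Sum>i\<in>I. (1 / real (card I)) *\<^sub>R p i"
    have card: "0 < card I" using False by (simp add: card_gt_0_iff)
    have "?z \<in> F" by (rule convex_sum) (use \<open>convex F\<close> p card in auto)
    moreover have "0 < ?z $ i" if "i \<in> I" for i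
    proof -
      have "0 \<le> p j $ i" if "j \<in> I" for j using p[OF that] FC by (auto simp: coordinate_cone_def)
      then have "0 < (\<Sum>j\<in>I. p j $ i)" using p[OF that] that by (intro sum_pos2[of _ i]) auto
      then show ?thesis using card by (simp flip: sum_divide_distrib)
    qed
    ultimately show ?thesis using that by blast
  qed
  have "coordinate_cone I \<subseteq> F"
  proof
    fix y assume y: "y \<in> coordinate_cone I"
    show "y \<in> F"
    proof (cases "y = z")
      case False
      \<comment> \<open>extend the segment from y to z slightly beyond z, inside the orthant\<close>
      define \<epsilon> where "\<epsilon> = Min (insert 1 ((\<lambda>i. z $ i / (y $ i + 1)) ` I))"
      have y0: "0 \<le> y $ i" for i using y by (simp add: coordinate_cone_def)
      have \<epsilon>: "0 < \<epsilon>" using z(2) y0 by (auto simp: \<epsilon>_def intro!: divide_pos_pos add_nonneg_pos)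
      define b where "b = z + \<epsilon> *\<^sub>R (z - y)"
      have "0 \<le> b $ i" for i
      proof (cases "i \<in> I")
        case True
        have "\<epsilon> \<le> z $ i / (y $ i + 1)" using True by (simp add: \<epsilon>_def)
        then have "\<epsilon> * (y $ i + 1) \<le> z $ i" using y0[of i] by (simp add: pos_le_divide_eq)
        moreover have "0 \<le> \<epsilon> * z $ i" using \<epsilon> z(2)[OF True] by simp
        ultimately show ?thesis using \<epsilon> by (simp add: b_def algebra_simps)
      next
        case False
        then have "y $ i = 0" "z $ i = 0" using y sub z(1) by (auto simp: coordinate_cone_def)
        then show ?thesis by (simp add: b_def)
      qed
      then have b: "b \<in> coordinate_cone UNIV" by (simp add: coordinate_cone_def)
      have "b - y = (1 + \<epsilon>) *\<^sub>R (z - y)" by (simp add: b_def algebra_simps)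
      then have "y \<noteq> b" using False \<epsilon> by (metis add_pos_pos eq_iff_diff_eq_0 less_irrefl scaleR_eq_0_iff zero_less_one)
      moreover have "z = (1 - 1 / (1 + \<epsilon>)) *\<^sub>R y + (1 / (1 + \<epsilon>)) *\<^sub>R b"
      proof -
        have "(1 / (1 + \<epsilon>)) *\<^sub>R (b - y) = z - y"
          unfolding \<open>b - y = (1 + \<epsilon>) *\<^sub>R (z - y)\<close> using \<epsilon> by simp
        then show ?thesis by (simp add: algebra_simps)
      qed
      moreover have "0 < 1 / (1 + \<epsilon>)" "1 / (1 + \<epsilon>) < 1" using \<epsilon> by simp_all
      ultimately have "z \<in> open_segment y b" unfolding in_segment by blast
      moreover have "y \<in> coordinate_cone UNIV" using y by (simp add: coordinate_cone_def)
      ultimately show ?thesis using F(1) b z(1) unfolding face_of_def by blast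
    qed (use z in simp)
  qed
  with sub show ?thesis by blast
qed

lemma orthant_fan_eq: "orthant_fan = {convex_cone hull T | T. T \<subseteq> range (\<lambda>i. axis i 1)}"
proof -
  have "orthant_fan = range coordinate_cone"
  proof -
    have "0 \<in> coordinate_cone I" for I by (simp add: coordinate_cone_def)
    then have "coordinate_cone I \<noteq> {}" for I by blast
    then show ?thesis
      unfolding orthant_fan_def cone_hull_axes[of UNIV] using face_of_orthant face_of_orthant_eq by blast
  qed
  also have "\<dots> = {convex_cone hull T | T. T \<subseteq> range (\<lambda>i. axis i 1)}"
    by (auto simp: subset_image_iff simp flip: cone_hull_axes)
  finally show ?thesis .
qed

definition cones :: "(real^3) set set \<Rightarrow> (real^3) set set" where
  "cones \<T> = {convex_cone hull T | T. \<exists>t\<in>\<T>. T \<subseteq> t}"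

lemma cone_hull_insert_hull: "convex_cone hull (insert v (convex_cone hull T)) = convex_cone hull (insert v T)"
proof (rule hull_unique)
  show "insert v (convex_cone hull T) \<subseteq> convex_cone hull (insert v T)"
    using hull_mono[of T "insert v T" convex_cone] by (auto intro: hull_inc)
  show "convex_cone hull (insert v T) \<subseteq> C" if "insert v (convex_cone hull T) \<subseteq> C" "convex_cone C" for C
    by (rule hull_minimal) (use that hull_subset[of T convex_cone] in auto)
qed (rule convex_cone_convex_cone_hull)

text \<open>Subdivision at an interior point v of the simplicial cone over t0: if no other cone
  contains v, then the cone over t0 is replaced by the cones over v and the facets of t0.\<close>

lemma star_subdivision_cones:
  assumes t0: "t\<^sub>0 \<in> \<T>" "v \<in> convex_cone hull t\<^sub>0" "v \<notin> t\<^sub>0"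
    and carrier: "\<And>t T. t \<in> \<T> \<Longrightarrow> T \<subseteq> t \<Longrightarrow> v \<in> convex_cone hull T \<Longrightarrow> t = t\<^sub>0 \<and> T = t\<^sub>0"
    and vertices: "\<And>t T. t \<in> \<T> \<Longrightarrow> T \<subseteq> t \<Longrightarrow> T \<subseteq> convex_cone hull t\<^sub>0 \<Longrightarrow> T \<subseteq> t\<^sub>0"
  shows "star_subdivision (cones \<T>) v = cones (\<T> - {t\<^sub>0} \<union> {insert v (t\<^sub>0 - {x}) | x. x \<in> t\<^sub>0})"
    (is "_ = cones ?\<T>'")
proof (intro subset_antisym subsetI)
  have proper: "\<exists>t\<in>?\<T>'. insert v T \<subseteq> t" if T: "T \<subseteq> t\<^sub>0" "T \<noteq> t\<^sub>0" for T
  proof -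
    obtain x where "x \<in> t\<^sub>0" "x \<notin> T" using T by blast
    then show ?thesis using T by (intro bexI[of _ "insert v (t\<^sub>0 - {x})"]) auto
  qed
  fix \<sigma> assume "\<sigma> \<in> star_subdivision (cones \<T>) v"
  then consider "\<sigma> \<in> cones \<T>" "v \<notin> \<sigma>"
    | \<tau> \<sigma>' where "\<sigma> = convex_cone hull (insert v \<tau>)" "\<tau> \<in> cones \<T>" "v \<notin> \<tau>" "\<sigma>' \<in> cones \<T>" "insert v \<tau> \<subseteq> \<sigma>'"
    unfolding star_subdivision_def by blast
  then show "\<sigma> \<in> cones ?\<T>'"
  proof cases
    case 1
    then obtain T t where T: "\<sigma> = convex_cone hull T" "t \<in> \<T>" "T \<subseteq> t" by (auto simp: cones_def)
    show ?thesis
    proof (cases "t = t\<^sub>0")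
      case True
      then have "T \<noteq> t\<^sub>0" using 1(2) T(1) t0(2) by auto
      then show ?thesis using proper[of T] T True unfolding cones_def by blast
    qed (use T in \<open>auto simp: cones_def\<close>)
  next
    case 2
    from 2(2) obtain T t where T: "\<tau> = convex_cone hull T" "t \<in> \<T>" "T \<subseteq> t" by (auto simp: cones_def)
    from 2(4) obtain T' t' where T': "\<sigma>' = convex_cone hull T'" "t' \<in> \<T>" "T' \<subseteq> t'" by (auto simp: cones_def)
    have "T' = t\<^sub>0" using carrier[OF T'(2,3)] 2(5) T'(1) by auto
    then have "T \<subseteq> convex_cone hull t\<^sub>0" using 2(5) T(1) T'(1) hull_subset[of T convex_cone] by auto
    then have "T \<subseteq> t\<^sub>0" using vertices[OF T(2,3)] by blast
    moreover have "T \<noteq> t\<^sub>0" using 2(3) T(1) t0(2) by auto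
    ultimately obtain t'' where "t'' \<in> ?\<T>'" "insert v T \<subseteq> t''" using proper by blast
    then show ?thesis unfolding 2(1) T(1) cone_hull_insert_hull cones_def by blast
  qed
next
  fix \<sigma> assume "\<sigma> \<in> cones ?\<T>'"
  then obtain T t where T: "\<sigma> = convex_cone hull T" "t \<in> ?\<T>'" "T \<subseteq> t" unfolding cones_def by blast
  have old: "convex_cone hull T' \<in> cones \<T>" "v \<notin> convex_cone hull T'" if "T' \<subseteq> t\<^sub>0" "T' \<noteq> t\<^sub>0" for T'
    using that t0(1) carrier[OF t0(1) that(1)] unfolding cones_def by blast+
  from T(2) consider "t \<in> \<T>" "t \<noteq> t\<^sub>0" | x where "x \<in> t\<^sub>0" "t = insert v (t\<^sub>0 - {x})" by blast
  then show "\<sigma> \<in> star_subdivision (cones \<T>) v"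
  proof cases
    case 1
    then have "v \<notin> \<sigma>" using carrier[OF 1(1) T(3)] T(1) by blast
    then show ?thesis using 1 T unfolding star_subdivision_def cones_def by blast
  next
    case 2
    define T' where "T' = T - {v}"
    have T': "T' \<subseteq> t\<^sub>0" "T' \<noteq> t\<^sub>0" using 2 T(3) by (auto simp: T'_def)
    show ?thesis
    proof (cases "v \<in> T")
      case False
      then have "T' = T" by (simp add: T'_def)
      then show ?thesis using old[OF T'] T(1) unfolding star_subdivision_def by blast
    next
      case True
      then have "\<sigma> = convex_cone hull (insert v (convex_cone hull T'))"
        unfolding cone_hull_insert_hull T(1) T'_def by (simp add: insert_absorb)
      moreover have "insert v (convex_cone hull T') \<subseteq> convex_cone hull t\<^sub>0"
        using t0(2) hull_mono[OF T'(1)] by auto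
      moreover have "convex_cone hull t\<^sub>0 \<in> cones \<T>" using t0(1) unfolding cones_def by blast
      ultimately show ?thesis using old[OF T'] unfolding star_subdivision_def by blast
    qed
  qed
qed

section \<open>Lattice points of the strip\<close>

text \<open>The pairs (i, j) with r dividing j - a i form a lattice of index r in the plane.
  Modulo integral combinations of u and v, every lattice point can be moved into the parallelogram
  spanned by u and v, and after a reflection in its centre, if necessary, into the triangle 0, u,
  v. If this contains no lattice points but its vertices, then u and v are a basis of the
  lattice.\<close>

lemma empty_triangle_unimodular:
  fixes r a u1 u2 v1 v2 :: int
  defines "D \<equiv> v1 * u2 - v2 * u1"
  assumes r: "0 < r" and u: "r dvd u2 - a * u1" and v: "r dvd v2 - a * v1" and D: "0 < D"
    and empty: "\<And>z1 z2 k l. r dvd z2 - a * z1 \<Longrightarrow> 0 \<le> k \<Longrightarrow> 0 \<le> l \<Longrightarrow> k + l \<le> D \<Longrightarrow> k < D \<Longrightarrow> l < D \<Longrightarrow>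
      D * z1 = k * u1 + l * v1 \<Longrightarrow> D * z2 = k * u2 + l * v2 \<Longrightarrow> k = 0 \<and> l = 0"
  shows "D = r"
proof -
  \<comment> \<open>every lattice point is an integral combination of u and v\<close>
  have span: "\<exists>k l. z1 = k * u1 + l * v1 \<and> z2 = k * u2 + l * v2" if z: "r dvd z2 - a * z1" for z1 z2
  proof -
    define p where "p = v1 * z2 - v2 * z1"
    define q where "q = z1 * u2 - z2 * u1"
    define k where "k = p mod D"
    define l where "l = q mod D"
    have cramer: "D * z1 = p * u1 + q * v1" "D * z2 = p * u2 + q * v2"
      by (simp_all add: D_def p_def q_def algebra_simps)
    have p: "p = D * (p div D) + k" and q: "q = D * (q div D) + l" by (simp_all add: k_def l_def)
    define y1 where "y1 = z1 - (p div D) * u1 - (q div D) * v1"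
    define y2 where "y2 = z2 - (p div D) * u2 - (q div D) * v2"
    have y: "D * y1 = k * u1 + l * v1" "D * y2 = k * u2 + l * v2"
    proof -
      have "D * y1 = p * u1 + q * v1 - D * (p div D) * u1 - D * (q div D) * v1"
        unfolding y1_def cramer(1)[symmetric] by (simp add: algebra_simps)
      also have "\<dots> = (p - D * (p div D)) * u1 + (q - D * (q div D)) * v1" by (simp add: algebra_simps)
      finally show "D * y1 = k * u1 + l * v1" unfolding k_def l_def minus_mult_div_eq_mod .
      have "D * y2 = p * u2 + q * v2 - D * (p div D) * u2 - D * (q div D) * v2"
        unfolding y2_def cramer(2)[symmetric] by (simp add: algebra_simps)
      also have "\<dots> = (p - D * (p div D)) * u2 + (q - D * (q div D)) * v2" by (simp add: algebra_simps)
      finally show "D * y2 = k * u2 + l * v2" unfolding k_def l_def minus_mult_div_eq_mod .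
    qed
    have y_mem: "r dvd y2 - a * y1"
    proof -
      have "y2 - a * y1 = (z2 - a * z1) - (p div D) * (u2 - a * u1) - (q div D) * (v2 - a * v1)"
        by (simp add: y1_def y2_def algebra_simps)
      then show ?thesis using z u v by simp
    qed
    have bounds: "0 \<le> k" "k < D" "0 \<le> l" "l < D" using D by (simp_all add: k_def l_def)
    have "k = 0 \<and> l = 0"
    proof (cases "k + l \<le> D")
      case True
      show ?thesis by (rule empty[OF y_mem]) (use y bounds True in simp_all)
    next
      case False
      \<comment> \<open>the point reflected in the centre of the parallelogram lies in the triangle\<close>
      have mem': "r dvd (u2 + v2 - y2) - a * (u1 + v1 - y1)"
      proof -
        have "(u2 + v2 - y2) - a * (u1 + v1 - y1) = (u2 - a * u1) + (v2 - a * v1) - (y2 - a * y1)"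
          by (simp add: algebra_simps)
        moreover have "r dvd (u2 - a * u1) + (v2 - a * v1) - (y2 - a * y1)"
          by (rule dvd_diff[OF dvd_add[OF u v] y_mem])
        ultimately show ?thesis by (simp only:)
      qed
      have "D * (u1 + v1 - y1) = D * u1 + D * v1 - D * y1" "D * (u2 + v2 - y2) = D * u2 + D * v2 - D * y2"
        by (simp_all only: right_diff_distrib distrib_left)
      moreover have "D * u1 + D * v1 - (k * u1 + l * v1) = (D - k) * u1 + (D - l) * v1"
        "D * u2 + D * v2 - (k * u2 + l * v2) = (D - k) * u2 + (D - l) * v2"
        by (simp_all only: left_diff_distrib)
      ultimately have eqs: "D * (u1 + v1 - y1) = (D - k) * u1 + (D - l) * v1"
        "D * (u2 + v2 - y2) = (D - k) * u2 + (D - l) * v2"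
        by (simp_all only: y)
      have "D - k = 0 \<and> D - l = 0"
      proof (rule empty[OF mem'])
        show "0 \<le> D - k" "0 \<le> D - l" "(D - k) + (D - l) \<le> D" "D - k < D" "D - l < D"
          using bounds False by linarith+
      qed (rule eqs)+
      then show ?thesis using bounds by simp
    qed
    then have "D * y1 = 0" "D * y2 = 0" using y by simp_all
    then have "y1 = 0" "y2 = 0" using D by simp_all
    then have "z1 = (p div D) * u1 + (q div D) * v1" "z2 = (p div D) * u2 + (q div D) * v2"
      by (simp_all add: y1_def y2_def)
    then show ?thesis by blast
  qed
  \<comment> \<open>so the determinants of (u, v) and of the basis (1, a), (0, r) divide each other\<close>
  obtain k l where 1: "1 = k * u1 + l * v1" "a = k * u2 + l * v2"
    using span[of a 1] by auto
  obtain k' l' where 2: "0 = k' * u1 + l' * v1" "r = k' * u2 + l' * v2"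
    using span[of r 0] by auto
  have "r = (k * u1 + l * v1) * (k' * u2 + l' * v2) - (k * u2 + l * v2) * (k' * u1 + l' * v1)"
    by (simp flip: 1 2)
  also have "\<dots> = D * (l * k' - k * l')" by (simp add: D_def algebra_simps)
  finally have "D dvd r" by simp
  moreover have "r dvd D"
  proof -
    have "D = v1 * (u2 - a * u1) - u1 * (v2 - a * v1)" by (simp add: D_def algebra_simps)
    then show ?thesis using u v by simp
  qed
  ultimately show "D = r" using zdvd_antisym_nonneg[of D r] D r by linarith
qed

locale economic =
  fixes r a :: nat
  assumes coprime: "coprime r a" and a: "1 \<le> a" "a < r"
begin

text \<open>The pair (i, j) stands for the point (i, j, r - j) / r of L. For n < r these points
  are e3, e2 and v_1, ..., v_n.\<close>

definition points :: "nat \<Rightarrow> (int \<times> int) set" where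
  "points n = {(i, j). int r dvd j - int a * i \<and> 0 \<le> i \<and> i \<le> int n \<and> 0 \<le> j \<and> j \<le> int r}"

text \<open>The point v_k for 1 \<le> k < r, and e3 for k = 0.\<close>

definition centre :: "nat \<Rightarrow> int \<times> int" where
  "centre k = (int k, int (a * k mod r))"

lemma points_mono: "m \<le> n \<Longrightarrow> points m \<subseteq> points n"
  by (auto simp: points_def)

text \<open>a is invertible modulo r, so j determines i modulo r.\<close>

lemma points_eq_if_snd_eq:
  assumes "P \<in> points n" "Q \<in> points n" "n < r" "snd P = snd Q"
  shows "P = Q"
proof -
  obtain i j i' where P: "P = (i, j)" and Q: "Q = (i', j)" using assms(4) by (metis prod.collapse)
  have "int r dvd (j - int a * i') - (j - int a * i)"
    using assms(1,2) dvd_diff[of "int r" "j - int a * i'" "j - int a * i"] by (simp add: points_def P Q)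
  then have "int r dvd int a * (i - i')" by (simp add: algebra_simps)
  moreover have "coprime (int r) (int a)" using coprime by simp
  ultimately have "int r dvd i - i'" by (simp add: coprime_dvd_mult_right_iff)
  moreover have "\<bar>i - i'\<bar> < int r" using assms(1,2,3) by (auto simp: points_def P Q)
  ultimately have "i = i'" using zdvd_not_zless[of "\<bar>i - i'\<bar>" "int r"] by (cases "i = i'") auto
  then show ?thesis by (simp add: P Q)
qed

lemma snd_centre_bounds:
  assumes "1 \<le> k" "k < r"
  shows "0 < snd (centre k)" "snd (centre k) < int r"
proof -
  have "\<not> r dvd a * k"
  proof
    assume "r dvd a * k"
    then have "r dvd k" using coprime by (simp add: coprime_dvd_mult_right_iff)
    then show False using assms by (simp add: nat_dvd_not_less)
  qed
  then show "0 < snd (centre k)" "snd (centre k) < int r" using a by (simp_all add: centre_def mod_greater_zero_iff_not_dvd)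
qed

lemma centre_mem: "k \<le> n \<Longrightarrow> centre k \<in> points n"
proof -
  have "int r dvd int a * int k mod int r - int a * int k"
    by (simp add: mod_eq_dvd_iff[symmetric])
  then show "k \<le> n \<Longrightarrow> centre k \<in> points n"
    using a by (simp add: points_def centre_def zmod_int less_imp_le)
qed

lemma points_0: "points 0 = {(0, 0), (0, int r)}"
proof -
  have "j = 0 \<or> j = int r" if "int r dvd j" "0 \<le> j" "j \<le> int r" for j
    using that zdvd_not_zless[of j "int r"] by (cases "j = 0 \<or> j = int r") auto
  moreover have "(i, j) \<in> points 0 \<longleftrightarrow> i = 0 \<and> int r dvd j \<and> 0 \<le> j \<and> j \<le> int r" for i j
    by (cases "i = 0") (simp_all add: points_def)
  ultimately have "(i, j) \<in> points 0 \<longleftrightarrow> (i, j) \<in> {(0, 0), (0, int r)}" for i j by auto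
  then show ?thesis by (intro subset_antisym subrelI) blast+
qed

lemma points_Suc:
  assumes "Suc n < r"
  shows "points (Suc n) = insert (centre (Suc n)) (points n)" "centre (Suc n) \<notin> points n"
proof -
  have "P = centre (Suc n)" if P: "P \<in> points (Suc n)" "P \<notin> points n" for P
  proof (rule points_eq_if_snd_eq[OF P(1) centre_mem[of "Suc n"] assms])
    obtain i j where ij: "P = (i, j)" by (cases P)
    then have i: "i = int (Suc n)" and j: "int r dvd j - int a * i" "0 \<le> j" "j \<le> int r"
      using P by (auto simp: points_def)
    let ?c = "snd (centre (Suc n))"
    have c: "int r dvd ?c - int a * i" using centre_mem[of "Suc n" "Suc n"] by (auto simp: points_def centre_def i)
    have "int r dvd j - ?c" using dvd_diff[OF j(1) c] by simp
    moreover have "\<bar>j - ?c\<bar> < int r" using j snd_centre_bounds[of "Suc n"] assms by auto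
    ultimately have "j = ?c" using zdvd_not_zless[of "\<bar>j - ?c\<bar>" "int r"] by (cases "j = ?c") auto
    then show "snd P = ?c" by (simp add: ij)
  qed simp
  then show "points (Suc n) = insert (centre (Suc n)) (points n)"
    using centre_mem[of "Suc n" "Suc n"] points_mono[of n "Suc n"] by auto
  show "centre (Suc n) \<notin> points n" by (auto simp: points_def centre_def)
qed

lemma finite_points: "n < r \<Longrightarrow> finite (points n)"
proof (induction n)
  case (Suc n)
  then show ?case using points_Suc(1)[OF Suc.prems] by simp
qed (simp add: points_0)

text \<open>Together with e1, neighbours in the order by the second coordinate span the cones
  around e1 after n subdivisions.\<close>

definition adjacent :: "nat \<Rightarrow> int \<times> int \<Rightarrow> int \<times> int \<Rightarrow> bool" where
  "adjacent n P Q \<longleftrightarrow> P \<in> points n \<and> Q \<in> points n \<and> snd P < snd Q \<and>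
     (\<forall>Z\<in>points n. snd Z \<le> snd P \<or> snd Q \<le> snd Z)"

lemma adjacentD:
  assumes "adjacent n P Q"
  shows "P \<in> points n" "Q \<in> points n" "snd P < snd Q"
    "Z \<in> points n \<Longrightarrow> snd Z \<le> snd P \<or> snd Q \<le> snd Z"
proof -
  show "P \<in> points n" "Q \<in> points n" "snd P < snd Q" using assms by (simp_all only: adjacent_def)
  show "snd Z \<le> snd P \<or> snd Q \<le> snd Z" if "Z \<in> points n"
    using assms that unfolding adjacent_def by (elim conjE) (erule (1) bspec)
qed

definition splits :: "nat \<Rightarrow> int \<times> int \<Rightarrow> int \<times> int \<Rightarrow> bool" where
  "splits n P Q \<longleftrightarrow> adjacent n P Q \<and> snd P < snd (centre (Suc n)) \<and> snd (centre (Suc n)) < snd Q"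

lemma adjacent_unique:
  assumes "adjacent n P Q" "adjacent n P' Q'" "n < r" "snd P < y" "y < snd Q" "snd P' < y" "y < snd Q'"
  shows "P = P'" "Q = Q'"
proof -
  note g = adjacentD(4)[OF assms(1)] adjacentD(4)[OF assms(2)]
  note mem = adjacentD(1,2)[OF assms(1)] adjacentD(1,2)[OF assms(2)]
  have "snd P = snd P'" using g(1)[OF mem(3)] g(2)[OF mem(1)] assms(4-7) by linarith
  then show "P = P'" by (rule points_eq_if_snd_eq[OF mem(1,3) assms(3)])
  have "snd Q = snd Q'" using g(1)[OF mem(4)] g(2)[OF mem(2)] assms(4-7) by linarith
  then show "Q = Q'" by (rule points_eq_if_snd_eq[OF mem(2,4) assms(3)])
qed

lemma splits_exists:
  assumes "Suc n < r"
  obtains P Q where "splits n P Q"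
proof -
  let ?y = "snd (centre (Suc n))"
  have fin: "finite (points n)" using finite_points assms by simp
  have y: "0 < ?y" "?y < int r" using snd_centre_bounds[of "Suc n"] assms by auto
  have ne: "?y \<noteq> snd Z" if "Z \<in> points n" for Z
  proof
    assume eq: "?y = snd Z"
    have "Z \<in> points (Suc n)" using that points_mono[of n "Suc n"] by auto
    then have "centre (Suc n) = Z"
      using points_eq_if_snd_eq[OF centre_mem[OF order_refl] _ assms eq] by blast
    then show False using that points_Suc(2)[OF assms] by simp
  qed
  have corners: "(0, 0) \<in> points n" "(0, int r) \<in> points n" using points_0 points_mono[of 0 n] by auto
  have P: "finite {Z \<in> points n. snd Z < ?y}" "{Z \<in> points n. snd Z < ?y} \<noteq> {}" using fin corners y by auto
  have Q: "finite {Z \<in> points n. ?y < snd Z}" "{Z \<in> points n. ?y < snd Z} \<noteq> {}" using fin corners y by auto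
  obtain P where P: "P \<in> points n" "snd P < ?y" "\<And>Z. Z \<in> points n \<Longrightarrow> snd Z < ?y \<Longrightarrow> snd Z \<le> snd P"
  proof -
    have "Max (snd ` {Z \<in> points n. snd Z < ?y}) \<in> snd ` {Z \<in> points n. snd Z < ?y}"
      using P by (intro Max_in) auto
    then obtain P where "P \<in> points n" "snd P < ?y" "Max (snd ` {Z \<in> points n. snd Z < ?y}) = snd P" by auto
    then show ?thesis using that[of P] P(1) by (metis (mono_tags, lifting) Max_ge finite_imageI imageI mem_Collect_eq)
  qed
  obtain Q where Q: "Q \<in> points n" "?y < snd Q" "\<And>Z. Z \<in> points n \<Longrightarrow> ?y < snd Z \<Longrightarrow> snd Q \<le> snd Z"
  proof -
    have "Min (snd ` {Z \<in> points n. ?y < snd Z}) \<in> snd ` {Z \<in> points n. ?y < snd Z}"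
      using Q by (intro Min_in) auto
    then obtain Q where "Q \<in> points n" "?y < snd Q" "Min (snd ` {Z \<in> points n. ?y < snd Z}) = snd Q" by auto
    then show ?thesis using that[of Q] Q(1) by (metis (mono_tags, lifting) Min_le finite_imageI imageI mem_Collect_eq)
  qed
  have "splits n P Q"
    unfolding splits_def adjacent_def
  proof (intro conjI ballI)
    fix Z assume Z: "Z \<in> points n"
    show "snd Z \<le> snd P \<or> snd Q \<le> snd Z"
    proof (cases "snd Z < ?y")
      case True
      then show ?thesis using P(3)[OF Z] by simp
    next
      case False
      then show ?thesis using Q(3)[OF Z] ne[OF Z] by simp
    qed
  qed (use P(1,2) Q(1,2) in simp_all)
  then show ?thesis using that by blast
qed

lemma splitsD:
  assumes "splits n P Q"
  shows "adjacent n P Q" "snd P < snd (centre (Suc n))" "snd (centre (Suc n)) < snd Q"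
  using assms by (simp_all only: splits_def)

lemma adjacent_Suc:
  assumes n: "Suc n < r" and s: "splits n P Q"
  shows "adjacent (Suc n) A B \<longleftrightarrow>
    adjacent n A B \<and> (A, B) \<noteq> (P, Q) \<or> A = P \<and> B = centre (Suc n) \<or> A = centre (Suc n) \<and> B = Q"
    (is "_ \<longleftrightarrow> ?rhs")
proof -
  define V where "V = centre (Suc n)"
  note PQ = splitsD[OF s, folded V_def]
  note P = adjacentD(1,2)[OF PQ(1)] and gap = adjacentD(4)[OF PQ(1)]
  have inj: "A = B" if "A \<in> points n" "B \<in> points n" "snd A \<le> snd B" "snd B \<le> snd A" for A B
    using points_eq_if_snd_eq[OF that(1,2)] that(3,4) n by linarith
  have ins: "points (Suc n) = insert V (points n)" "V \<notin> points n"
    using points_Suc[OF n] unfolding V_def by blast+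
  have V: "V \<in> points (Suc n)" and old: "\<And>Z. Z \<in> points n \<Longrightarrow> Z \<in> points (Suc n)"
    by (simp_all add: ins)
  show ?thesis
    unfolding V_def[symmetric]
  proof
    assume L: "adjacent (Suc n) A B"
    note A = adjacentD(1)[OF L] and B = adjacentD(2)[OF L] and AB = adjacentD(3)[OF L] and gapL = adjacentD(4)[OF L]
    consider "A = V" | "B = V" | "A \<in> points n" "B \<in> points n" using A B unfolding ins by blast
    then show "adjacent n A B \<and> (A, B) \<noteq> (P, Q) \<or> A = P \<and> B = V \<or> A = V \<and> B = Q"
    proof cases
      case 1
      then have B': "B \<in> points n" using B AB unfolding ins by auto
      have "snd Q \<le> snd B" using gap[OF B'] AB[unfolded 1] PQ(2) by linarith
      moreover have "snd B \<le> snd Q" using gapL[OF old[OF P(2)], unfolded 1] PQ(3) by linarith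
      ultimately show ?thesis using inj[OF B' P(2)] 1 by simp
    next
      case 2
      then have A': "A \<in> points n" using A AB unfolding ins by auto
      have "snd A \<le> snd P" using gap[OF A'] AB[unfolded 2] PQ(3) by linarith
      moreover have "snd P \<le> snd A" using gapL[OF old[OF P(1)], unfolded 2] PQ(2) by linarith
      ultimately show ?thesis using inj[OF A' P(1)] 2 by simp
    next
      case 3
      have "adjacent n A B" unfolding adjacent_def using 3 AB gapL[OF old] by blast
      moreover have "(A, B) \<noteq> (P, Q)" using gapL[OF V] PQ(2,3) by auto
      ultimately show ?thesis by blast
    qed
  next
    assume "adjacent n A B \<and> (A, B) \<noteq> (P, Q) \<or> A = P \<and> B = V \<or> A = V \<and> B = Q"
    then consider "adjacent n A B" "(A, B) \<noteq> (P, Q)" | "A = P" "B = V" | "A = V" "B = Q" by blast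
    then show "adjacent (Suc n) A B"
    proof cases
      case 1
      note AB = adjacentD[OF 1(1)]
      have V_out: "snd V \<le> snd A \<or> snd B \<le> snd V"
      proof (rule ccontr)
        assume "\<not> ?thesis"
        then have "P = A" "Q = B" using adjacent_unique[OF PQ(1) 1(1) _ PQ(2,3)] n by linarith+
        then show False using 1(2) by simp
      qed
      show ?thesis
        unfolding adjacent_def
      proof (intro conjI ballI)
        fix Z assume "Z \<in> points (Suc n)"
        then show "snd Z \<le> snd A \<or> snd B \<le> snd Z" using V_out AB(4)[of Z] unfolding ins by blast
      qed (simp_all only: AB old)
    next
      case 2
      show ?thesis
        unfolding adjacent_def
      proof (intro conjI ballI)
        fix Z assume "Z \<in> points (Suc n)"
        then consider "Z = V" | "Z \<in> points n" unfolding ins by blast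
        then show "snd Z \<le> snd A \<or> snd B \<le> snd Z" using gap[of Z] PQ(2,3) 2 by cases auto
      qed (simp_all only: 2 V old P PQ)
    next
      case 3
      show ?thesis
        unfolding adjacent_def
      proof (intro conjI ballI)
        fix Z assume "Z \<in> points (Suc n)"
        then consider "Z = V" | "Z \<in> points n" unfolding ins by blast
        then show "snd Z \<le> snd A \<or> snd B \<le> snd Z" using gap[of Z] PQ(2,3) 3 by cases auto
      qed (simp_all only: 3 V old P PQ)
    qed
  qed
qed

text \<open>Any lattice point of the triangle P, v_{n+1}, Q has first coordinate at most n + 1, so
  it is v_{n+1} or one of the points that are present already; but there are none of these
  strictly between P and Q. Hence the triangle is unimodular, and the identity is the value r of
  its determinant.\<close>

lemma new_point_height_one:
  assumes n: "Suc n < r" and s: "splits n P Q"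
  defines "V \<equiv> centre (Suc n)"
  shows "(snd Q - snd P) * fst V = int r + (snd V - snd P) * fst Q + (snd Q - snd V) * fst P"
proof -
  note PQ = splitsD[OF s, folded V_def]
  note P = adjacentD(1,2)[OF PQ(1)] and gap = adjacentD(4)[OF PQ(1)]
  obtain p1 p2 where p: "P = (p1, p2)" by (cases P)
  obtain q1 q2 where q: "Q = (q1, q2)" by (cases Q)
  obtain v1 v2 where v: "V = (v1, v2)" by (cases V)
  have vn: "v1 = int (Suc n)" using v by (simp add: V_def centre_def)
  have pq_bounds: "0 \<le> p1" "p1 < v1" "0 \<le> q1" "q1 < v1" "0 \<le> p2" "q2 \<le> int r"
    using P by (auto simp: points_def p q vn)
  have lt: "p2 < v2" "v2 < q2" using PQ by (auto simp: p q v)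
  have P': "int r dvd p2 - int a * p1" and Q': "int r dvd q2 - int a * q1" using P by (auto simp: points_def p q)
  have V': "int r dvd v2 - int a * v1" using centre_mem[of "Suc n" "Suc n"] v by (auto simp: points_def V_def)
  have "(v1 - p1) * (q2 - p2) - (v2 - p2) * (q1 - p1) = int r"
  proof (rule empty_triangle_unimodular[where a = "int a"])
    show "0 < int r" using a by simp
    have "int r dvd (q2 - int a * q1) - (p2 - int a * p1)" using P' Q' by (rule dvd_diff[rotated])
    then show "int r dvd (q2 - p2) - int a * (q1 - p1)" by (simp add: algebra_simps)
    have "int r dvd (v2 - int a * v1) - (p2 - int a * p1)" using P' V' by (rule dvd_diff[rotated])
    then show "int r dvd (v2 - p2) - int a * (v1 - p1)" by (simp add: algebra_simps)
    have "(v1 - p1) * (q2 - p2) - (v2 - p2) * (q1 - p1) = (v1 - p1) * (q2 - v2) + (v1 - q1) * (v2 - p2)"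
      by (simp add: algebra_simps)
    also have "0 < \<dots>" using pq_bounds lt by (intro add_pos_pos mult_pos_pos) auto
    finally show "0 < (v1 - p1) * (q2 - p2) - (v2 - p2) * (q1 - p1)" .
  next
    fix z1 z2 k l :: int
    let ?D = "(v1 - p1) * (q2 - p2) - (v2 - p2) * (q1 - p1)"
    assume z: "int r dvd z2 - int a * z1"
      and b': "0 \<le> k" "0 \<le> l" "k + l \<le> ?D" "k < ?D" "l < ?D"
      and e': "?D * z1 = k * (q1 - p1) + l * (v1 - p1)" "?D * z2 = k * (q2 - p2) + l * (v2 - p2)"
    define D where "D = ?D"
    note b = b'[folded D_def] and e = e'[folded D_def]
    have D0: "0 < D" using b by linarith
    define x1 where "x1 = p1 + z1"
    define x2 where "x2 = p2 + z2"
    have x: "D * x1 = (D - k - l) * p1 + k * q1 + l * v1" "D * x2 = (D - k - l) * p2 + k * q2 + l * v2"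
      using e by (simp_all add: x1_def x2_def algebra_simps)
    have le: "x1 \<le> v1" "0 \<le> x1" "p2 \<le> x2" "x2 \<le> q2"
    proof -
      have "D * x1 \<le> (D - k - l) * v1 + k * v1 + l * v1"
        unfolding x(1) by (intro add_mono mult_left_mono) (use b pq_bounds in auto)
      also have "\<dots> = D * v1" by (simp add: algebra_simps)
      finally show "x1 \<le> v1" using D0 by simp
      have "0 \<le> D * x1" unfolding x(1) by (intro add_nonneg_nonneg mult_nonneg_nonneg) (use b pq_bounds in auto)
      then show "0 \<le> x1" using D0 by (simp add: zero_le_mult_iff)
      have "D * p2 = (D - k - l) * p2 + k * p2 + l * p2" by (simp add: algebra_simps)
      also have "\<dots> \<le> D * x2" unfolding x(2) by (intro add_mono mult_left_mono) (use b lt in auto)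
      finally show "p2 \<le> x2" using D0 by simp
      have "D * x2 \<le> (D - k - l) * q2 + k * q2 + l * q2"
        unfolding x(2) by (intro add_mono mult_left_mono) (use b lt in auto)
      also have "\<dots> = D * q2" by (simp add: algebra_simps)
      finally show "x2 \<le> q2" using D0 by simp
    qed
    have "int r dvd (p2 - int a * p1) + (z2 - int a * z1)" using P' z by (rule dvd_add)
    then have "int r dvd x2 - int a * x1" by (simp add: x1_def x2_def algebra_simps)
    then have "(x1, x2) \<in> points (Suc n)" using le pq_bounds by (simp add: points_def vn)
    then have "(x1, x2) = V \<or> (x1, x2) \<in> points n" using points_Suc(1)[OF n] by (simp add: V_def)
    moreover have "x2 \<le> p2 \<or> q2 \<le> x2" if "(x1, x2) \<in> points n" using gap[OF that] by (simp add: p q)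
    ultimately consider "(x1, x2) = V" | "x2 = p2" "(x1, x2) \<in> points n" | "x2 = q2" "(x1, x2) \<in> points n" using le by force
    then show "k = 0 \<and> l = 0"
    proof cases
      case 1
      then have "D * v1 = (D - k - l) * p1 + k * q1 + l * v1" using x(1) by (simp add: v)
      then have "(D - k - l) * (v1 - p1) + k * (v1 - q1) = 0" by (simp add: algebra_simps)
      moreover have "0 \<le> (D - k - l) * (v1 - p1)" "0 \<le> k * (v1 - q1)" using b pq_bounds by simp_all
      ultimately have "(D - k - l) * (v1 - p1) = 0" "k * (v1 - q1) = 0" by linarith+
      then show ?thesis using b pq_bounds by auto
    next
      case 2
      then have "k * (q2 - p2) + l * (v2 - p2) = 0" using x(2) by (simp add: algebra_simps)
      moreover have "0 \<le> k * (q2 - p2)" "0 \<le> l * (v2 - p2)" using b lt by simp_all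
      ultimately have "k * (q2 - p2) = 0" "l * (v2 - p2) = 0" by linarith+
      then show ?thesis using lt by auto
    next
      case 3
      then have "(D - k - l) * (q2 - p2) + l * (q2 - v2) = 0" using x(2) by (simp add: algebra_simps)
      moreover have "0 \<le> (D - k - l) * (q2 - p2)" "0 \<le> l * (q2 - v2)" using b lt by simp_all
      ultimately have "(D - k - l) * (q2 - p2) = 0" "l * (q2 - v2) = 0" by linarith+
      then show ?thesis using lt b by auto
    qed
  qed
  then show ?thesis by (simp add: p q v algebra_simps)
qed

end

section \<open>The stages of the economic fan\<close>

context economic
begin

definition pt :: "int \<times> int \<Rightarrow> real^3" where
  "pt P = vector [of_int (fst P) / r, of_int (snd P) / r, (of_int (int r - snd P)) / r]"

definition e1 :: "real^3" where "e1 = axis 1 1"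

lemma r_pos: "0 < real r" using a by simp

lemma pt_nth: "pt P $ 1 = of_int (fst P) / r" "pt P $ 2 = of_int (snd P) / r"
  "pt P $ 3 = of_int (int r - snd P) / r"
  by (simp_all add: pt_def)

lemma e1_nth: "e1 $ 1 = 1" "e1 $ 2 = 0" "e1 $ 3 = 0"
  by (simp_all add: e1_def axis_def)

lemma pt_eq_iff: "pt P = pt Q \<longleftrightarrow> P = Q"
  using a by (auto simp: vec_eq_iff forall_3 pt_nth prod_eq_iff)

lemma pt_neq_e1: "pt P \<noteq> e1"
proof
  assume "pt P = e1"
  then have "pt P $ 2 + pt P $ 3 = 0" by (simp add: e1_nth)
  moreover have "pt P $ 2 + pt P $ 3 = 1" using r_pos by (simp add: pt_nth flip: add_divide_distrib)
  ultimately show False by simp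
qed

lemma v_vec_eq_centre: "1 \<le> k \<Longrightarrow> k < r \<Longrightarrow> v_vec r a k = pt (centre k)"
proof -
  assume k: "1 \<le> k" "k < r"
  have "0 < snd (centre k)" "snd (centre k) < int r" using snd_centre_bounds[OF k] .
  then have c: "0 < a * k mod r" by (simp add: centre_def)
  have "(int r - int a * int k) mod int r = int r - int (a * k mod r)"
  proof -
    have "int a * int k mod int r \<noteq> 0" using c by (simp flip: zmod_int of_nat_mult)
    then show ?thesis unfolding minus_mod_self1 zmod_zminus1_eq_if by (simp add: zmod_int)
  qed
  then show ?thesis
    by (simp add: v_vec_def vec_eq_iff forall_3 pt_nth centre_def)
qed

lemma inner_pt: "vector [x, y, z] \<bullet> pt P = (x * of_int (fst P) + y * of_int (snd P) + z * of_int (int r - snd P)) / r"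
  by (simp add: inner_vec_def sum_3 pt_nth add_divide_distrib)

lemma inner_e1: "vector [x, y, z] \<bullet> e1 = (x :: real)"
  by (simp add: inner_vec_def sum_3 e1_nth)

lemma centre_combination:
  assumes "Suc n < r" "splits n P Q"
  defines "V \<equiv> centre (Suc n)"
  shows "of_int (snd Q - snd P) *\<^sub>R pt V = e1 + of_int (snd V - snd P) *\<^sub>R pt Q + of_int (snd Q - snd V) *\<^sub>R pt P"
proof -
  have "(snd Q - snd P) * fst V = int r + (snd V - snd P) * fst Q + (snd Q - snd V) * fst P"
    unfolding V_def by (rule new_point_height_one[OF assms(1,2)])
  then have "real_of_int ((snd Q - snd P) * fst V) = of_int (int r + (snd V - snd P) * fst Q + (snd Q - snd V) * fst P)"
    by (simp only:)
  then have 1: "real_of_int (snd Q - snd P) * of_int (fst V)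
      = real r + real_of_int (snd V - snd P) * real_of_int (fst Q) + real_of_int (snd Q - snd V) * real_of_int (fst P)"
    by (simp only: of_int_add of_int_mult of_int_of_nat_eq)
  have "real_of_int (snd Q - snd P) * of_int (fst V) / r
      = 1 + real_of_int (snd V - snd P) * real_of_int (fst Q) / r + real_of_int (snd Q - snd V) * real_of_int (fst P) / r"
    unfolding 1 using r_pos by (simp add: add_divide_distrib)
  then have "(of_int (snd Q - snd P) *\<^sub>R pt V) $ 1
      = (e1 + of_int (snd V - snd P) *\<^sub>R pt Q + of_int (snd Q - snd V) *\<^sub>R pt P) $ 1"
    by (simp add: pt_nth e1_nth)
  moreover have "(of_int (snd Q - snd P) *\<^sub>R pt V) $ 2
      = (e1 + of_int (snd V - snd P) *\<^sub>R pt Q + of_int (snd Q - snd V) *\<^sub>R pt P) $ 2"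
    using r_pos by (simp add: pt_nth e1_nth field_simps)
  moreover have "(of_int (snd Q - snd P) *\<^sub>R pt V) $ 3
      = (e1 + of_int (snd V - snd P) *\<^sub>R pt Q + of_int (snd Q - snd V) *\<^sub>R pt P) $ 3"
    using r_pos by (simp add: pt_nth e1_nth field_simps)
  ultimately show ?thesis unfolding vec_eq_iff forall_3 by blast
qed

lemma centre_mem_chamber:
  assumes "Suc n < r" "splits n P Q"
  shows "pt (centre (Suc n)) \<in> convex_cone hull {e1, pt P, pt Q}"
proof -
  let ?V = "centre (Suc n)" and ?C = "convex_cone hull {e1, pt P, pt Q}"
  note s = splitsD[OF assms(2)]
  have "e1 + of_int (snd ?V - snd P) *\<^sub>R pt Q + of_int (snd Q - snd ?V) *\<^sub>R pt P \<in> ?C"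
    by (intro convex_cone_add convex_cone_scaleR convex_cone_convex_cone_hull hull_inc) (use s in auto)
  then have wV: "of_int (snd Q - snd P) *\<^sub>R pt ?V \<in> ?C" by (simp only: centre_combination[OF assms])
  have mem: "(1 / real_of_int (snd Q - snd P)) *\<^sub>R of_int (snd Q - snd P) *\<^sub>R pt ?V \<in> ?C"
    by (rule convex_cone_scaleR[OF convex_cone_convex_cone_hull _ wV]) (use s in auto)
  have eq: "(1 / real_of_int (snd Q - snd P)) *\<^sub>R of_int (snd Q - snd P) *\<^sub>R pt ?V = pt ?V"
    using s(2,3) by simp
  show ?thesis using mem unfolding eq .
qed

text \<open>The generators of the maximal cones after n subdivisions. The cones around e1 change
  with n, whereas the triangle cut off from such a cone by the point v_{k+1} is kept by all later
  subdivisions.\<close>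

definition triangles :: "nat \<Rightarrow> (real^3) set set" where
  "triangles n = {{e1, pt P, pt Q} | P Q. adjacent n P Q} \<union>
     {{pt P, pt (centre (Suc k)), pt Q} | k P Q. k < n \<and> splits k P Q}"

text \<open>Seen from e1, the cone over e1, P and Q is the strip between P and Q.\<close>

lemma adjacent_bounds:
  assumes "T \<subseteq> {e1, pt P, pt Q}" "snd P < snd Q" "pt Z \<in> convex_cone hull T"
  shows "snd P \<le> snd Z" "snd Z \<le> snd Q" "pt P \<notin> T \<Longrightarrow> snd Q \<le> snd Z" "pt Q \<notin> T \<Longrightarrow> snd Z \<le> snd P"
proof -
  \<comment> \<open>the linear form that takes the value j - y at the point with second coordinate j and vanishes at e1\<close>
  let ?m = "\<lambda>y :: int. vector [0, real_of_int (int r - y), - real_of_int y] :: real^3"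
  have m: "?m y \<bullet> pt Y = of_int (snd Y - y)" for y Y
    unfolding inner_pt using r_pos by (simp add: field_simps)
  have m_e1: "?m y \<bullet> e1 = 0" for y by (rule inner_e1)
  have lower: "y \<le> snd Z" if "\<And>Y. pt Y \<in> T \<Longrightarrow> Y = P \<or> Y = Q \<Longrightarrow> y \<le> snd Y" for y
  proof -
    have "0 \<le> ?m y \<bullet> pt Z"
    proof (rule cone_bound[OF _ assms(3)])
      fix t assume "t \<in> T"
      then consider "t = e1" | Y where "t = pt Y" "pt Y \<in> T" "Y = P \<or> Y = Q" using assms(1) by blast
      then show "0 \<le> ?m y \<bullet> t" by cases (simp_all only: m_e1 m of_int_0_le_iff that diff_ge_0_iff_ge order_refl)
    qed
    then show ?thesis unfolding m by linarith
  qed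
  have upper: "snd Z \<le> y" if "\<And>Y. pt Y \<in> T \<Longrightarrow> Y = P \<or> Y = Q \<Longrightarrow> snd Y \<le> y" for y
  proof -
    have "0 \<le> (- ?m y) \<bullet> pt Z"
    proof (rule cone_bound[OF _ assms(3)])
      fix t assume "t \<in> T"
      then consider "t = e1" | Y where "t = pt Y" "pt Y \<in> T" "Y = P \<or> Y = Q" using assms(1) by blast
      then show "0 \<le> (- ?m y) \<bullet> t"
      proof cases
        case 2
        then show ?thesis using that[of Y] unfolding inner_minus_left 2(1) m by simp
      qed (simp only: inner_minus_left m_e1 minus_zero order_refl)
    qed
    then show ?thesis unfolding inner_minus_left m by linarith
  qed
  show "snd P \<le> snd Z" by (rule lower) (use assms(2) in auto)
  show "snd Z \<le> snd Q" by (rule upper) (use assms(2) in auto)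
  show "snd Q \<le> snd Z" if "pt P \<notin> T" by (rule lower) (use that in auto)
  show "snd Z \<le> snd P" if "pt Q \<notin> T" by (rule upper) (use that in auto)
qed

lemma height_bound:
  assumes T: "T \<subseteq> pt ` points n"
  shows "e1 \<notin> convex_cone hull T" and "pt Z \<in> convex_cone hull T \<Longrightarrow> fst Z \<le> int n"
proof -
  \<comment> \<open>the linear form that takes the value n - i at the point with first coordinate i and is negative at e1\<close>
  let ?m = "vector [- real r, real n, real n] :: real^3"
  have m: "?m \<bullet> pt Y = of_int (int n - fst Y)" for Y
    unfolding inner_pt using r_pos by (simp add: field_simps)
  have nonneg: "0 \<le> ?m \<bullet> v" if "v \<in> convex_cone hull T" for v
    by (rule cone_bound[OF _ that]) (use T in \<open>auto simp: m points_def\<close>)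
  show "e1 \<notin> convex_cone hull T" using nonneg[of e1] r_pos by (auto simp: inner_e1)
  show "fst Z \<le> int n" if "pt Z \<in> convex_cone hull T" using nonneg[OF that] unfolding m by linarith
qed

lemma triangle_points:
  assumes "t \<in> triangles n" "n < r"
  shows "t \<subseteq> insert e1 (pt ` points n)" "card t = 3"
proof -
  consider P Q where "t = {e1, pt P, pt Q}" "adjacent n P Q"
    | k P Q where "t = {pt P, pt (centre (Suc k)), pt Q}" "k < n" "splits k P Q"
    using assms(1) unfolding triangles_def by blast
  then have "t \<subseteq> insert e1 (pt ` points n) \<and> card t = 3"
  proof cases
    case 1
    note adj = adjacentD[OF 1(2)]
    have "t \<subseteq> insert e1 (pt ` points n)" using adj(1,2) 1(1) by blast
    moreover have "P \<noteq> Q" using adj(3) by auto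
    ultimately show ?thesis using pt_neq_e1 by (simp add: 1(1) pt_eq_iff pt_neq_e1[symmetric])
  next
    case 2
    note s = splitsD[OF 2(3)]
    have "P \<in> points n" "Q \<in> points n" "centre (Suc k) \<in> points n"
      using adjacentD(1,2)[OF s(1)] points_mono[of k n] centre_mem[of "Suc k" n] 2(2) by auto
    then have "t \<subseteq> insert e1 (pt ` points n)" using 2(1) by blast
    moreover have "P \<noteq> Q" "P \<noteq> centre (Suc k)" "Q \<noteq> centre (Suc k)" using s(2,3) by auto
    ultimately show ?thesis by (simp add: 2(1) pt_eq_iff)
  qed
  then show "t \<subseteq> insert e1 (pt ` points n)" "card t = 3" by blast+
qed

lemma vertices_in_chamber:
  assumes n: "n < r" and adj: "adjacent n P Q" and T: "T \<subseteq> insert e1 (pt ` points n)"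
    and sub: "T \<subseteq> convex_cone hull {e1, pt P, pt Q}"
  shows "T \<subseteq> {e1, pt P, pt Q}"
proof
  note A = adjacentD[OF adj]
  fix x assume x: "x \<in> T"
  show "x \<in> {e1, pt P, pt Q}"
  proof (cases "x = e1")
    case False
    then obtain Z where Z: "x = pt Z" "Z \<in> points n" using x T by blast
    have "pt Z \<in> convex_cone hull {e1, pt P, pt Q}" using x sub Z(1) by blast
    from adjacent_bounds(1,2)[OF subset_refl A(3) this] A(4)[OF Z(2)]
    have "snd Z = snd P \<or> snd Z = snd Q" by linarith
    then have "Z = P \<or> Z = Q" using points_eq_if_snd_eq[OF Z(2) A(1) n] points_eq_if_snd_eq[OF Z(2) A(2) n] by blast
    then show ?thesis using Z(1) by blast
  qed simp
qed

lemma vertices_in_triangle: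
  assumes n: "Suc k < r" "k < n" "n < r" and s: "splits k P Q" and T: "T \<subseteq> insert e1 (pt ` points n)"
    and sub: "T \<subseteq> convex_cone hull {pt P, pt (centre (Suc k)), pt Q}"
  shows "T \<subseteq> {pt P, pt (centre (Suc k)), pt Q}"
proof
  note S = splitsD[OF s]
  note A = adjacentD[OF S(1)]
  have vert: "{pt P, pt (centre (Suc k)), pt Q} \<subseteq> pt ` points (Suc k)"
    using A(1,2) points_Suc(1)[OF n(1)] by auto
  have V: "pt (centre (Suc k)) \<in> convex_cone hull {e1, pt P, pt Q}"
    by (rule centre_mem_chamber[OF n(1) s])
  fix x assume x: "x \<in> T"
  then have x': "x \<in> convex_cone hull {pt P, pt (centre (Suc k)), pt Q}" using sub by blast
  then have "x \<noteq> e1" using height_bound(1)[OF vert] by blast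
  then obtain Z where Z: "x = pt Z" "Z \<in> points n" using x T by blast
  have "fst Z \<le> int (Suc k)" by (rule height_bound(2)[OF vert x'[unfolded Z(1)]])
  then have Z': "Z \<in> points (Suc k)" using Z(2) by (auto simp: points_def)
  show "x \<in> {pt P, pt (centre (Suc k)), pt Q}"
  proof (cases "Z = centre (Suc k)")
    case False
    then have Zk: "Z \<in> points k" using Z' points_Suc(1)[OF n(1)] by blast
    have "convex_cone hull {pt P, pt (centre (Suc k)), pt Q} \<subseteq> convex_cone hull {e1, pt P, pt Q}"
      by (rule hull_minimal) (use V in \<open>auto intro: hull_inc convex_cone_convex_cone_hull\<close>)
    then have "{pt Z} \<subseteq> convex_cone hull {e1, pt P, pt Q}" using x' Z(1) by blast
    then have "{pt Z} \<subseteq> {e1, pt P, pt Q}"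
      by (intro vertices_in_chamber[OF _ S(1)]) (use n Zk in auto)
    then show ?thesis using Z(1) pt_neq_e1 by auto
  qed (simp add: Z)
qed


text \<open>A cone that contains v_{n+1} must have the ray e1 because of the index of v_{n+1}, and
  both neighbours of v_{n+1} as further rays because of the second coordinate of v_{n+1}.\<close>

lemma carrier_of_centre:
  assumes n: "Suc n < r" and s: "splits n P Q" and t: "t \<in> triangles n" and T: "T \<subseteq> t"
    and v: "pt (centre (Suc n)) \<in> convex_cone hull T"
  shows "t = {e1, pt P, pt Q} \<and> T = {e1, pt P, pt Q}"
proof -
  let ?V = "centre (Suc n)"
  note S = splitsD[OF s]
  have "e1 \<in> T"
  proof (rule ccontr)
    assume "e1 \<notin> T"
    then have "T \<subseteq> pt ` points n" using triangle_points(1)[OF t] T n by auto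
    then have "fst ?V \<le> int n" using height_bound(2) v by blast
    then show False by (simp add: centre_def)
  qed
  then have "t \<noteq> {pt A, pt C, pt B}" for A B C using T by (auto simp: pt_neq_e1[symmetric])
  then obtain A B where AB: "t = {e1, pt A, pt B}" "adjacent n A B"
    using t unfolding triangles_def by blast
  note adj = adjacentD[OF AB(2)]
  note bounds = adjacent_bounds[OF T[unfolded AB(1)] adj(3) v]
  have V: "?V \<notin> points n" "?V \<in> points (Suc n)" using points_Suc[OF n] by auto
  have ne: "snd Z \<noteq> snd ?V" if "Z \<in> points n" for Z
  proof
    assume eq: "snd Z = snd ?V"
    have "Z \<in> points (Suc n)" using that points_mono[of n "Suc n"] by auto
    then have "Z = ?V" by (rule points_eq_if_snd_eq[OF _ V(2) n eq])
    then show False using that V(1) by simp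
  qed
  have lt: "snd A < snd ?V" "snd ?V < snd B"
    using bounds(1,2) ne[OF adj(1)] ne[OF adj(2)] by linarith+
  have "n < r" using n by simp
  note unique = adjacent_unique[OF S(1) AB(2) this S(2,3) lt]
  have "pt A \<in> T" by (rule ccontr) (use bounds(3) lt(2) in auto)
  moreover have "pt B \<in> T" by (rule ccontr) (use bounds(4) lt(1) in auto)
  ultimately show ?thesis using AB(1) T \<open>e1 \<in> T\<close> unfolding unique by blast
qed

lemma triangles_0: "triangles 0 = {range (\<lambda>i. axis i 1)}"
proof -
  have adj: "adjacent 0 P Q \<longleftrightarrow> P = (0, 0) \<and> Q = (0, int r)" for P Q
  proof
    assume "adjacent 0 P Q"
    note A = adjacentD(1-3)[OF this]
    show "P = (0, 0) \<and> Q = (0, int r)" using A(3) A(1,2)[unfolded points_0] by auto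
  next
    assume "P = (0, 0) \<and> Q = (0, int r)"
    then show "adjacent 0 P Q" using a by (simp add: adjacent_def points_0)
  qed
  have "pt (0, int r) = axis 2 1" "pt (0, 0) = axis 3 1"
    using r_pos by (simp_all add: vec_eq_iff forall_3 pt_nth axis_def)
  then show ?thesis by (auto simp: triangles_def adj e1_def UNIV_3)
qed

lemma triangles_Suc:
  assumes n: "Suc n < r" and s: "splits n P Q"
  defines "t\<^sub>0 \<equiv> {e1, pt P, pt Q}" and "v \<equiv> pt (centre (Suc n))"
  shows "triangles (Suc n) = triangles n - {t\<^sub>0} \<union> {insert v (t\<^sub>0 - {x}) | x. x \<in> t\<^sub>0}"
proof -
  let ?V = "centre (Suc n)"
  note S = splitsD[OF s]
  have PQ: "P \<noteq> Q" using adjacentD(3)[OF S(1)] by auto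
  have new: "{insert v (t\<^sub>0 - {x}) | x. x \<in> t\<^sub>0} = {{pt P, v, pt Q}, {e1, v, pt Q}, {e1, pt P, v}}"
  proof -
    have "{insert v (t\<^sub>0 - {x}) | x. x \<in> t\<^sub>0} = {insert v (t\<^sub>0 - {e1}), insert v (t\<^sub>0 - {pt P}), insert v (t\<^sub>0 - {pt Q})}"
      unfolding t\<^sub>0_def by blast
    moreover have "t\<^sub>0 - {e1} = {pt P, pt Q}" "t\<^sub>0 - {pt P} = {e1, pt Q}" "t\<^sub>0 - {pt Q} = {e1, pt P}"
      using PQ by (auto simp: t\<^sub>0_def pt_eq_iff pt_neq_e1 pt_neq_e1[symmetric])
    ultimately show ?thesis by (simp add: insert_commute)
  qed
  have splits_Suc: "splits n P' Q' \<longleftrightarrow> P' = P \<and> Q' = Q" for P' Q'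
  proof
    assume s': "splits n P' Q'"
    note S' = splitsD[OF s']
    have "n < r" using n by simp
    then show "P' = P \<and> Q' = Q" using adjacent_unique[OF S'(1) S(1) _ S'(2,3) S(2,3)] by blast
  qed (use s in simp)
  have chambers: "{{e1, pt A, pt B} | A B. adjacent (Suc n) A B}
      = {{e1, pt A, pt B} | A B. adjacent n A B} - {t\<^sub>0} \<union> {{e1, v, pt Q}, {e1, pt P, v}}"
  proof -
    have "{e1, pt A, pt B} = t\<^sub>0 \<longleftrightarrow> (A, B) = (P, Q)" if "adjacent n A B" for A B
    proof
      assume "{e1, pt A, pt B} = t\<^sub>0"
      then have "{pt A, pt B} = {pt P, pt Q}"
        unfolding t\<^sub>0_def by (subst (asm) insert_ident) (simp_all add: pt_neq_e1[symmetric])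
      then have "A = P \<and> B = Q \<or> A = Q \<and> B = P" by (auto simp: doubleton_eq_iff pt_eq_iff)
      then show "(A, B) = (P, Q)" using adjacentD(3)[OF that] adjacentD(3)[OF S(1)] by auto
    qed (simp add: t\<^sub>0_def)
    then show ?thesis unfolding adjacent_Suc[OF n s] v_def by blast
  qed
  have triangle_ne: "{pt A, pt (centre (Suc k)), pt B} \<noteq> t\<^sub>0" for A B k
  proof
    assume "{pt A, pt (centre (Suc k)), pt B} = t\<^sub>0"
    then have "e1 \<in> {pt A, pt (centre (Suc k)), pt B}" by (simp add: t\<^sub>0_def)
    then show False using pt_neq_e1 by (metis empty_iff insert_iff)
  qed
  let ?D = "\<lambda>n. {{pt A, pt (centre (Suc k)), pt B} | k A B. k < n \<and> splits k A B}"
  have "?D (Suc n) = ?D n \<union> {{pt A, pt ?V, pt B} | A B. splits n A B}"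
    unfolding less_Suc_eq by blast
  also have "{{pt A, pt ?V, pt B} | A B. splits n A B} = {{pt P, v, pt Q}}"
    unfolding splits_Suc v_def by blast
  finally have D: "?D (Suc n) = ?D n \<union> {{pt P, v, pt Q}}" .
  have "t\<^sub>0 \<notin> ?D n" using triangle_ne by fast
  then have "?D n - {t\<^sub>0} = ?D n" by (rule Diff_insert0[of _ _ "{}", simplified])
  then show ?thesis unfolding new unfolding triangles_def chambers D Un_Diff by (simp add: Un_ac insert_commute)
qed

lemma economic_fan_stage:
  "n < r \<Longrightarrow> fold (\<lambda>i \<Sigma>. star_subdivision \<Sigma> (v_vec r a i)) [1..<Suc n] orthant_fan = cones (triangles n)"
proof (induction n)
  case 0
  show ?case by (simp add: orthant_fan_eq cones_def triangles_0)
next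
  case (Suc n)
  obtain P Q where s: "splits n P Q" using splits_exists[OF Suc.prems] .
  note S = splitsD[OF s]
  let ?t = "{e1, pt P, pt Q}" and ?v = "pt (centre (Suc n))"
  have "fold (\<lambda>i \<Sigma>. star_subdivision \<Sigma> (v_vec r a i)) [1..<Suc (Suc n)] orthant_fan
      = star_subdivision (cones (triangles n)) ?v"
    using Suc.IH Suc.prems by (simp add: v_vec_eq_centre)
  also have "\<dots> = cones (triangles n - {?t} \<union> {insert ?v (?t - {x}) | x. x \<in> ?t})"
  proof (rule star_subdivision_cones)
    show "?t \<in> triangles n" using S(1) unfolding triangles_def by blast
    show "?v \<in> convex_cone hull ?t" by (rule centre_mem_chamber[OF Suc.prems s])
    have "centre (Suc n) \<noteq> P" "centre (Suc n) \<noteq> Q" using S(2,3) by auto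
    then show "?v \<notin> ?t" using pt_neq_e1 by (simp add: pt_eq_iff)
  next
    fix t T assume "t \<in> triangles n" "T \<subseteq> t"
    then show "?v \<in> convex_cone hull T \<Longrightarrow> t = ?t \<and> T = ?t"
      using carrier_of_centre[OF Suc.prems s] by blast
    show "T \<subseteq> convex_cone hull ?t \<Longrightarrow> T \<subseteq> ?t"
      by (rule vertices_in_chamber[OF _ S(1)])
         (use Suc.prems triangle_points(1)[OF \<open>t \<in> triangles n\<close>] \<open>T \<subseteq> t\<close> in auto)
  qed
  also have "\<dots> = cones (triangles (Suc n))" by (simp only: triangles_Suc[OF Suc.prems s])
  finally show ?case .
qed

lemma subset_if_cone_subset:
  assumes n: "n < r" and t: "t \<in> triangles n" and T: "T \<subseteq> insert e1 (pt ` points n)"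
    and sub: "convex_cone hull T \<subseteq> convex_cone hull t"
  shows "T \<subseteq> t"
proof -
  have sub': "T \<subseteq> convex_cone hull t" using sub hull_subset[of T convex_cone] by blast
  from t consider P Q where "t = {e1, pt P, pt Q}" "adjacent n P Q"
    | k P Q where "t = {pt P, pt (centre (Suc k)), pt Q}" "k < n" "splits k P Q"
    unfolding triangles_def by blast
  then show ?thesis
  proof cases
    case 1
    then show ?thesis using vertices_in_chamber[OF n 1(2) T] sub' by simp
  next
    case 2
    then show ?thesis using vertices_in_triangle[OF _ 2(2) n 2(3) T] sub' n by simp
  qed
qed

text \<open>Inclusions between the cones over the sets in triangles (r - 1) imply inclusions
  between these sets, which all have three elements.\<close>

theorem Sigma_max_eq: "Sigma_max r a = (\<lambda>t. convex_cone hull t) ` triangles (r - 1)"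
proof -
  have n: "r - 1 < r" using a by simp
  have fan: "economic_fan r a = cones (triangles (r - 1))"
    using economic_fan_stage[OF n] a by (simp add: economic_fan_def)
  have eq: "convex_cone hull t = convex_cone hull T" if "t \<in> triangles (r - 1)" "t' \<in> triangles (r - 1)" "T \<subseteq> t'"
    "convex_cone hull t \<subseteq> convex_cone hull T" for t t' T
  proof -
    have "convex_cone hull t \<subseteq> convex_cone hull t'" using that(4) hull_mono[OF that(3)] by blast
    then have "t \<subseteq> t'" by (rule subset_if_cone_subset[OF n that(2) triangle_points(1)[OF that(1) n]])
    moreover have "card t = 3" "card t' = 3" using triangle_points(2) that(1,2) n by blast+
    ultimately have "t = t'" by (metis card.infinite card_subset_eq zero_neq_numeral)
    then show ?thesis using that(4) hull_mono[OF that(3)] by blast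
  qed
  show ?thesis
  proof (intro subset_antisym subsetI)
    fix \<sigma> assume \<sigma>: "\<sigma> \<in> Sigma_max r a"
    then obtain T t where T: "\<sigma> = convex_cone hull T" "t \<in> triangles (r - 1)" "T \<subseteq> t"
      unfolding Sigma_max_def fan cones_def by blast
    then have "convex_cone hull t \<in> economic_fan r a" "\<sigma> \<subseteq> convex_cone hull t"
      using hull_mono[OF T(3)] unfolding fan cones_def by blast+
    then show "\<sigma> \<in> (\<lambda>t. convex_cone hull t) ` triangles (r - 1)"
      using \<sigma> T(2) unfolding Sigma_max_def by blast
  next
    fix \<sigma> assume "\<sigma> \<in> (\<lambda>t. convex_cone hull t) ` triangles (r - 1)"
    then obtain t where t: "\<sigma> = convex_cone hull t" "t \<in> triangles (r - 1)" by blast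
    show "\<sigma> \<in> Sigma_max r a"
      unfolding Sigma_max_def
    proof (intro CollectI conjI ballI impI)
      show "\<sigma> \<in> economic_fan r a" using t unfolding fan cones_def by blast
      fix \<tau> assume "\<tau> \<in> economic_fan r a" "\<sigma> \<subseteq> \<tau>"
      then obtain T t' where T: "\<tau> = convex_cone hull T" "t' \<in> triangles (r - 1)" "T \<subseteq> t'"
        unfolding fan cones_def by blast
      show "\<sigma> = \<tau>" using eq[OF t(2) T(2,3)] \<open>\<sigma> \<subseteq> \<tau>\<close> t(1) T(1) by blast
    qed
  qed
qed

end

section \<open>Dual bases and coordinates of the maximal cones\<close>

lemma (in unimodular_cone) smooth_cone:
  "smooth_Spec (semigroup_algebra (cone_semigroup r a \<sigma>)) scalar"
  by (rule smooth_semigroup_algebra)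

context economic
begin

lemma pt_mem_L:
  assumes "int r dvd snd P - int a * fst P"
  shows "pt P \<in> L_lattice r a"
proof -
  obtain q where q: "snd P - int a * fst P = int r * q" using assms by blast
  then have "snd P = int a * fst P + int r * q" by simp
  then have "pt P = rvec (vector [0, q, 1 - q - fst P]) + (of_int (fst P) / real r) *\<^sub>R vector [1, real a, real r - real a]"
    using r_pos by (simp add: vec_eq_iff forall_3 pt_nth rvec_def field_simps)
  then show ?thesis unfolding L_lattice_def by blast
qed

lemma pointsD:
  assumes "P \<in> points n"
  shows "int r dvd snd P - int a * fst P" "0 \<le> snd P" "snd P \<le> int r"
  using assms by (cases P; simp add: points_def)+

lemma point_mem_L: "P \<in> points n \<Longrightarrow> pt P \<in> L_lattice r a"
  by (rule pt_mem_L[OF pointsD(1)])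

lemma e1_mem_L: "e1 \<in> L_lattice r a"
proof -
  have "e1 = rvec (axis 1 1) + (of_int 0 / real r) *\<^sub>R vector [1, real a, real r - real a]"
    by (simp add: vec_eq_iff forall_3 e1_nth rvec_def axis_def)
  then show ?thesis unfolding L_lattice_def by blast
qed

text \<open>Rounding down needs that c i + c k \<le> w for two different coefficients; here they
  are two of 1, c and w - c.\<close>

lemma star_coordinates:
  assumes n: "Suc n < r" and s: "splits n P Q" and \<phi>: "ray_coordinates r a (vector [e1, pt Q, pt P]) \<phi>"
  shows "\<exists>\<psi>. ray_coordinates r a (\<chi> j. if j = i then pt (centre (Suc n)) else (vector [e1, pt Q, pt P] :: real^3^3) $ j) \<psi>"
proof -
  let ?V = "centre (Suc n)"
  note S = splitsD[OF s]
  define c :: "3 \<Rightarrow> int" where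
    "c k = (vector [1, snd ?V - snd P, snd Q - snd ?V] :: int^3) $ k" for k
  have c: "c 1 = 1" "c 2 = snd ?V - snd P" "c 3 = snd Q - snd ?V" by (simp_all add: c_def)
  have "\<forall>k. 0 < c k" using S(2,3) by (simp add: forall_3 c)
  moreover have "\<forall>k. k \<noteq> i \<longrightarrow> c i + c k \<le> snd Q - snd P"
    using exhaust_3[of i] S(2,3) by (auto simp: forall_3 c)
  moreover have "pt ?V \<in> L_lattice r a" by (rule point_mem_L[OF centre_mem[OF order_refl]])
  moreover have "of_int (snd Q - snd P) *\<^sub>R pt ?V = (\<Sum>k\<in>UNIV. of_int (c k) *\<^sub>R (vector [e1, pt Q, pt P] :: real^3^3) $ k)"
    unfolding centre_combination[OF n s] by (simp add: sum_3 c)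
  ultimately show ?thesis
    using ray_coordinates_star[OF \<phi>, of c i "snd Q - snd P" "pt ?V"] by blast
qed

lemma replace_ray:
  fixes x y z v :: "'a::zero"
  shows "(\<chi> j. if j = 1 then v else (vector [x, y, z] :: 'a^3) $ j) = vector [v, y, z]"
    "(\<chi> j. if j = 2 then v else (vector [x, y, z] :: 'a^3) $ j) = vector [x, v, z]"
    "(\<chi> j. if j = 3 then v else (vector [x, y, z] :: 'a^3) $ j) = vector [x, y, v]"
  by (simp_all add: vec_eq_iff forall_3)

lemma chamber_coordinates:
  "n < r \<Longrightarrow> adjacent n P Q \<Longrightarrow> \<exists>\<phi>. ray_coordinates r a (vector [e1, pt Q, pt P]) \<phi>"
proof (induction n arbitrary: P Q)
  case 0
  have "P = (0, 0)" "Q = (0, int r)"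
    using adjacentD(1-3)[OF 0(2)] by (auto simp: points_0)
  then have "vector [e1, pt Q, pt P] = (\<chi> i. axis i 1)"
    using r_pos by (simp add: vec_eq_iff forall_3 pt_nth e1_nth axis_def)
  then show ?case using ray_coordinates_orthant by metis
next
  case (Suc n)
  obtain P' Q' where s: "splits n P' Q'" using splits_exists[OF Suc.prems(1)] .
  have n: "n < r" using Suc.prems(1) by simp
  obtain \<phi> where \<phi>: "ray_coordinates r a (vector [e1, pt Q', pt P']) \<phi>"
    using Suc.IH[OF n splitsD(1)[OF s]] by blast
  consider "adjacent n P Q" | "P = P'" "Q = centre (Suc n)" | "P = centre (Suc n)" "Q = Q'"
    using Suc.prems(2) unfolding adjacent_Suc[OF Suc.prems(1) s] by blast
  then show ?case
  proof cases
    case 1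
    then show ?thesis using Suc.IH[OF n] by blast
  next
    case 2
    then show ?thesis using star_coordinates[OF Suc.prems(1) s \<phi>, of 2] unfolding replace_ray by simp
  next
    case 3
    then show ?thesis using star_coordinates[OF Suc.prems(1) s \<phi>, of 3] unfolding replace_ray by simp
  qed
qed

lemma inner_rvec_pt:
  "rvec m \<bullet> pt P = of_int (m $ 1 * fst P + (m $ 2 - m $ 3) * snd P + int r * m $ 3) / r"
  using r_pos by (simp add: inner_vec_def sum_3 pt_nth rvec_def field_simps)

lemma inner_rvec_e1: "rvec m \<bullet> e1 = of_int (m $ 1)"
  by (simp add: inner_vec_def sum_3 e1_nth rvec_def)

text \<open>The determinant of a point of the plane y + z = 1 with B and C, divided by r, is
  linear in the point; this is its exponent vector. It vanishes on B and C.\<close>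

definition line_form :: "int \<times> int \<Rightarrow> int \<times> int \<Rightarrow> int^3" where
  "line_form B C = (let q = (fst B * snd C - fst C * snd B) div int r in
     vector [snd B - snd C, q + fst C - fst B, q])"

lemma line_form:
  assumes "int r dvd snd B - int a * fst B" "int r dvd snd C - int a * fst C"
  shows "line_form B C \<in> M_lattice r a"
    and "rvec (line_form B C) \<bullet> pt P =
      of_int (fst P * (snd B - snd C) + snd P * (fst C - fst B) + fst B * snd C - fst C * snd B) / r"
proof -
  let ?q = "(fst B * snd C - fst C * snd B) div int r"
  have "fst B * snd C - fst C * snd B = fst B * (snd C - int a * fst C) - fst C * (snd B - int a * fst B)"
    by (simp add: algebra_simps)
  then have "int r dvd fst B * snd C - fst C * snd B" using assms by simp
  then have q: "int r * ?q = fst B * snd C - fst C * snd B" by simp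
  have f: "line_form B C $ 1 = snd B - snd C" "line_form B C $ 2 = ?q + fst C - fst B" "line_form B C $ 3 = ?q"
    by (simp_all add: line_form_def Let_def)
  have "weight_exponent a (line_form B C) = (snd B - int a * fst B) - (snd C - int a * fst C)"
    unfolding weight_exponent_def f by (simp add: algebra_simps)
  then show "line_form B C \<in> M_lattice r a" using assms by (simp add: M_lattice_iff[OF a])
  show "rvec (line_form B C) \<bullet> pt P =
      of_int (fst P * (snd B - snd C) + snd P * (fst C - fst B) + fst B * snd C - fst C * snd B) / r"
    unfolding inner_rvec_pt f q by (simp add: algebra_simps)
qed

lemma triangle_unimodular:
  assumes n: "Suc n < r" and s: "splits n P Q"
  shows "\<exists>d. unimodular_cone r a (vector [pt (centre (Suc n)), pt Q, pt P]) d"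
proof -
  let ?V = "centre (Suc n)"
  note S = splitsD[OF s]
  have mem: "P \<in> points n" "Q \<in> points n" "?V \<in> points (Suc n)"
    using adjacentD(1,2)[OF S(1)] centre_mem[OF order_refl] by blast+
  have dvd: "int r dvd snd P - int a * fst P" "int r dvd snd Q - int a * fst Q" "int r dvd snd ?V - int a * fst ?V"
    by (rule pointsD(1)[OF mem(1)], rule pointsD(1)[OF mem(2)], rule pointsD(1)[OF mem(3)])
  have height: "(snd Q - snd P) * fst ?V = int r + (snd ?V - snd P) * fst Q + (snd Q - snd ?V) * fst P"
    by (rule new_point_height_one[OF n s])
  have det: "fst ?V * (snd Q - snd P) + snd ?V * (fst P - fst Q) + fst Q * snd P - fst P * snd Q = int r"
    "fst Q * (snd P - snd ?V) + snd Q * (fst ?V - fst P) + fst P * snd ?V - fst ?V * snd P = int r"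
    "fst P * (snd ?V - snd Q) + snd P * (fst Q - fst ?V) + fst ?V * snd Q - fst Q * snd ?V = int r"
    using height by (simp_all add: algebra_simps)
  let ?d = "vector [line_form Q P, line_form P ?V, line_form ?V Q] :: int^3^3"
  let ?u = "vector [pt ?V, pt Q, pt P] :: real^3^3"
  have "unimodular_cone r a ?u ?d"
  proof
    have "\<forall>i. ?d $ i \<in> M_lattice r a"
      unfolding forall_3 vector_3 by (intro conjI line_form(1) dvd)
    then show "?d $ i \<in> M_lattice r a" for i by blast
    have "\<forall>i. ?u $ i \<in> L_lattice r a"
      unfolding forall_3 vector_3 by (intro conjI pt_mem_L dvd)
    then show "?u $ i \<in> L_lattice r a" for i by blast
    have "\<forall>i j. rvec (?d $ i) \<bullet> ?u $ j = (if i = j then 1 else 0)"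
      unfolding forall_3 vector_3 line_form(2)[OF dvd(2,1)] line_form(2)[OF dvd(1,3)] line_form(2)[OF dvd(3,2)] det
      using r_pos by (simp add: algebra_simps)
    then show "rvec (?d $ i) \<bullet> ?u $ j = (if i = j then 1 else 0)" for i j by blast
  qed (use a in auto)
  then show ?thesis by blast
qed

text \<open>a is invertible modulo r, so all second coordinates from 0 to r occur among the
  points.\<close>

lemma adjacent_final:
  assumes adj: "adjacent (r - 1) P Q"
  shows "snd Q = snd P + 1"
proof (rule ccontr)
  note A = adjacentD[OF adj]
  assume "snd Q \<noteq> snd P + 1"
  then have j: "snd P < snd P + 1" "snd P + 1 < snd Q" using A(3) by auto
  let ?j = "snd P + 1"
  obtain u v where uv: "u * int a + v * int r = 1"
    using bezout_int[of "int a" "int r"] coprime by (auto simp: coprime_iff_gcd_eq_1 gcd.commute)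
  define i where "i = (u * ?j) mod int r"
  have "?j - int a * i = ?j * (u * int a + v * int r) - int a * (u * ?j - int r * ((u * ?j) div int r))"
    unfolding i_def minus_mult_div_eq_mod uv by simp
  also have "\<dots> = int r * (?j * v + int a * ((u * ?j) div int r))" by (simp add: algebra_simps)
  finally have "int r dvd ?j - int a * i" by simp
  moreover have "0 \<le> i" "i \<le> int (r - 1)" using a by (simp_all add: i_def of_nat_diff)
  moreover have "0 \<le> ?j" "?j \<le> int r" using pointsD(2)[OF A(1)] pointsD(3)[OF A(2)] j by linarith+
  ultimately have "(i, ?j) \<in> points (r - 1)" by (simp add: points_def)
  from A(4)[OF this] j show False by simp
qed

lemma chamber_unimodular:
  assumes adj: "adjacent (r - 1) P Q"
  shows "\<exists>d. unimodular_cone r a (vector [e1, pt Q, pt P]) d"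
proof -
  note A = adjacentD[OF adj]
  define i i' j where "i = fst P" and "i' = fst Q" and "j = snd P"
  have P: "fst P = i" "snd P = j" and Q: "fst Q = i'" "snd Q = j + 1"
    by (simp_all add: i_def i'_def j_def adjacent_final[OF adj])
  have dvd: "int r dvd j - int a * i" "int r dvd j + 1 - int a * i'"
    using pointsD(1)[OF A(1)] pointsD(1)[OF A(2)] unfolding P Q .
  have "- i - j * (i - i') = (j - int a * i) * (i' - i) + i * ((j - int a * i) - (j + 1 - int a * i'))"
    by (simp add: algebra_simps)
  also have "int r dvd \<dots>"
    by (intro dvd_add dvd_mult2[OF dvd(1)] dvd_mult dvd_diff[OF dvd])
  finally obtain q where q: "- i - j * (i - i') = int r * q" by blast
  let ?d = "vector [vector [1, q + i - i', q], vector [0, int r - j, - j], vector [0, 1 + j - int r, 1 + j]] :: int^3^3"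
  let ?u = "vector [e1, pt Q, pt P] :: real^3^3"
  have "unimodular_cone r a ?u ?d"
  proof
    have "weight_exponent a (vector [1, q + i - i', q]) = (j + 1 - int a * i') - (j - int a * i)"
      "weight_exponent a (vector [0, int r - j, - j]) = int r * int a"
      "weight_exponent a (vector [0, 1 + j - int r, 1 + j]) = int r * (- int a)"
      by (simp_all add: weight_exponent_def algebra_simps)
    then have "vector [1, q + i - i', q] \<in> M_lattice r a" "vector [0, int r - j, - j] \<in> M_lattice r a"
      "vector [0, 1 + j - int r, 1 + j] \<in> M_lattice r a"
      using dvd by (simp_all only: M_lattice_iff[OF a] dvd_diff dvd_triv_left)
    then have "\<forall>k. ?d $ k \<in> M_lattice r a" unfolding forall_3 vector_3 by blast
    then show "?d $ k \<in> M_lattice r a" for k by blast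
    have "\<forall>k. ?u $ k \<in> L_lattice r a"
      unfolding forall_3 vector_3 by (intro conjI e1_mem_L point_mem_L[OF A(1)] point_mem_L[OF A(2)])
    then show "?u $ k \<in> L_lattice r a" for k by blast
    have "real_of_int (i' + (i - i') * (j + 1) + int r * q) = 0" "real_of_int (i + (i - i') * j + int r * q) = 0"
      by (simp_all only: q[symmetric]) (simp_all add: algebra_simps)
    then have "\<forall>k l. rvec (?d $ k) \<bullet> ?u $ l = (if k = l then 1 else 0)"
      using r_pos by (simp add: forall_3 inner_rvec_pt inner_rvec_e1 P Q field_simps)
    then show "rvec (?d $ k) \<bullet> ?u $ l = (if k = l then 1 else 0)" for k l by blast
  qed (use a in auto)
  then show ?thesis by blast
qed

text \<open>A triangle inherits the coordinates of the cone around e1 from which it is cut off,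
  with the ray e1 replaced by the new point.\<close>

lemma triangle_rays:
  assumes t: "t \<in> triangles (r - 1)"
  shows "\<exists>u \<phi> d. t = range (\<lambda>i. u $ i) \<and> ray_coordinates r a u \<phi> \<and> unimodular_cone r a u d"
proof -
  have range: "range (\<lambda>i. (vector [x, y, z] :: real^3^3) $ i) = {x, y, z}" for x y z
    by (auto simp: UNIV_3)
  from t consider P Q where "t = {e1, pt P, pt Q}" "adjacent (r - 1) P Q"
    | k P Q where "t = {pt P, pt (centre (Suc k)), pt Q}" "k < r - 1" "splits k P Q"
    unfolding triangles_def by blast
  then show ?thesis
  proof cases
    case 1
    obtain \<phi> where "ray_coordinates r a (vector [e1, pt Q, pt P]) \<phi>"
      using chamber_coordinates[OF _ 1(2)] a by auto
    moreover obtain d where "unimodular_cone r a (vector [e1, pt Q, pt P]) d"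
      using chamber_unimodular[OF 1(2)] by blast
    moreover have "t = range (\<lambda>i. (vector [e1, pt Q, pt P] :: real^3^3) $ i)" unfolding range 1(1) by blast
    ultimately show ?thesis by blast
  next
    case 2
    have k: "Suc k < r" "k < r" using 2(2) by simp_all
    obtain \<phi> where "ray_coordinates r a (vector [e1, pt Q, pt P]) \<phi>"
      using chamber_coordinates[OF k(2) splitsD(1)[OF 2(3)]] by blast
    from star_coordinates[OF k(1) 2(3) this, of 1]
    obtain \<psi> where "ray_coordinates r a (vector [pt (centre (Suc k)), pt Q, pt P]) \<psi>"
      unfolding replace_ray by blast
    moreover obtain d where "unimodular_cone r a (vector [pt (centre (Suc k)), pt Q, pt P]) d"
      using triangle_unimodular[OF k(1) 2(3)] by blast
    moreover have "t = range (\<lambda>i. (vector [pt (centre (Suc k)), pt Q, pt P] :: real^3^3) $ i)"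
      unfolding range 2(1) by blast
    ultimately show ?thesis by blast
  qed
qed

lemma maximal_cone_properties:
  assumes "\<sigma> \<in> Sigma_max r a"
  shows "\<exists>\<Delta>. G_brick r a \<Delta> \<and> S_semigroup r a \<Delta> = cone_semigroup r a \<sigma>"
    and "\<sigma> = {x. \<forall>m\<in>cone_semigroup r a \<sigma>. 0 \<le> rvec m \<bullet> x}"
    and "smooth_Spec (semigroup_algebra (cone_semigroup r a \<sigma>)) scalar"
proof -
  obtain t where t: "\<sigma> = convex_cone hull t" "t \<in> triangles (r - 1)" using assms unfolding Sigma_max_eq by blast
  obtain u \<phi> d where u: "t = range (\<lambda>i. u $ i)" "ray_coordinates r a u \<phi>" "unimodular_cone r a u d"
    using triangle_rays[OF t(2)] by blast
  note \<sigma> = t(1)[unfolded u(1)]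
  show "\<exists>\<Delta>. G_brick r a \<Delta> \<and> S_semigroup r a \<Delta> = cone_semigroup r a \<sigma>"
    unfolding \<sigma> using unimodular_cone.G_brick_fibre[OF u(3,2)] unimodular_cone.S_semigroup_fibre[OF u(3,2)] by blast
  show "\<sigma> = {x. \<forall>m\<in>cone_semigroup r a \<sigma>. 0 \<le> rvec m \<bullet> x}"
    unfolding \<sigma> by (rule unimodular_cone.cone_eq_dual_of_semigroup[OF u(3)])
  show "smooth_Spec (semigroup_algebra (cone_semigroup r a \<sigma>)) scalar"
    unfolding \<sigma> by (rule unimodular_cone.smooth_cone[OF u(3)])
qed

end

theorem proposition4p8:
  fixes r a :: nat
  assumes "coprime r a" and "1 \<le> a" and "a \<le> r - 1"
  shows "\<exists>(\<SS> :: (int^3) set set) (\<Gamma> :: (real^3) set \<Rightarrow> (int^3) set).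
    (\<forall>\<Delta> \<in> \<SS>. G_brick r a \<Delta>) \<and>
    bij_betw \<Gamma> (Sigma_max r a) \<SS> \<and>
    (\<forall>\<sigma> \<in> Sigma_max r a.
       S_semigroup r a (\<Gamma> \<sigma>) = cone_semigroup r a \<sigma> \<and>
       Spec_iso (semigroup_algebra (S_semigroup r a (\<Gamma> \<sigma>))) scalar
                (semigroup_algebra (cone_semigroup r a \<sigma>)) scalar \<and>
       smooth_Spec (semigroup_algebra (cone_semigroup r a \<sigma>)) scalar)"
proof -
  interpret economic r a
    using assms by unfold_locales auto
  have "\<forall>\<sigma>\<in>Sigma_max r a. \<exists>\<Delta>. G_brick r a \<Delta> \<and> S_semigroup r a \<Delta> = cone_semigroup r a \<sigma>"
    using maximal_cone_properties(1) by blast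
  from bchoice[OF this] obtain \<Gamma> where
    \<Gamma>: "\<And>\<sigma>. \<sigma> \<in> Sigma_max r a \<Longrightarrow> G_brick r a (\<Gamma> \<sigma>) \<and> S_semigroup r a (\<Gamma> \<sigma>) = cone_semigroup r a \<sigma>"
    by blast
  have "inj_on \<Gamma> (Sigma_max r a)"
  proof (rule inj_onI)
    fix \<sigma> \<tau> assume *: "\<sigma> \<in> Sigma_max r a" "\<tau> \<in> Sigma_max r a" "\<Gamma> \<sigma> = \<Gamma> \<tau>"
    then have eq: "cone_semigroup r a \<sigma> = cone_semigroup r a \<tau>" using \<Gamma> by metis
    have "\<sigma> = {x. \<forall>m\<in>cone_semigroup r a \<sigma>. 0 \<le> rvec m \<bullet> x}" by (rule maximal_cone_properties(2)[OF *(1)])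
    also have "\<dots> = {x. \<forall>m\<in>cone_semigroup r a \<tau>. 0 \<le> rvec m \<bullet> x}" by (simp only: eq)
    also have "\<dots> = \<tau>" by (rule maximal_cone_properties(2)[OF *(2), symmetric])
    finally show "\<sigma> = \<tau>" .
  qed
  then have "bij_betw \<Gamma> (Sigma_max r a) (\<Gamma> ` Sigma_max r a)" by (rule inj_on_imp_bij_betw)
  then show ?thesis
    using \<Gamma> maximal_cone_properties(3)
    by (intro exI[of _ "\<Gamma> ` Sigma_max r a"] exI[of _ \<Gamma>]) (simp add: Spec_iso_refl)
qed

end
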